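(* For all constants $k,d$ and $\varepsilon>0$, the $\varepsilon$-gapped pinned $k$-local $d$-bounded-degree uniform stoquastic frustration-free Hamiltonian problem is in $\mathrm{P}$.
   Context: Let $\Sigma=\{0,\dots,q-1\}$ be a fixed finite alphabet; $n$-qudit states are unit vectors in $(\mathbb C^\Sigma)^{\otimes n}$. For a nonempty set $T$ of strings, $|T\rangle=|T|^{-1/2}\sum_{x\in T}|x\rangle$. The pinned problem: the input is a set of $m=m(n)$ (polynomially many) uniform stoquastic terms $H_1,\dots,H_m$ with $0\le H_i\le I$, each acting on $k$ of the $n$ qudits, with at most $d$ terms acting non-trivially on each qudit. Stoquastic means the off-diagonal entries of each $H_i$ in the computational basis are non-positive. Uniform means the projector onto the groundspace of $H_i$ is $\sum_j|T_{i,j}\rangle\langle T_{i,j}|$ with pairwise disjoint nonempty $T_{i,j}\subseteq\Sigma^k$. Let $H=\frac1m\sum_j H_j\otimes I$. Promised that one of the following holds, decide which. Yes: there is an $n$-qudit state $|\psi\rangle$ with $\langle\psi|0^n\rangle>0$ and $\langle\psi|H|\psi\rangle=0$. No: for all $n$-qudit states $|\psi\rangle$, $\langle\psi|H|\psi\rangle\ge\varepsilon$. $\mathrm P$ is taken as a class of promise problems. *)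

theory Defs
  imports Complex_Main "HOL-Library.Disjoint_Sets" "HOL-Computational_Algebra.Polynomial"
begin

section \<open>Promise problems in polynomial time\<close>

text \<open>
  Deterministic Turing machines with a fixed number of two-way infinite tapes. States and tape
  symbols are natural numbers below fixed bounds. Symbol 0 is the blank; the input bits False and
  True are written as 1 and 2 on the first tape, starting at cell 0, where all heads start.
\<close>

datatype head_move = Move_Left | Move_Stay | Move_Right

record turing_machine =
  num_tapes :: nat
  num_symbols :: nat
  num_states :: nat
  start_state :: nat
  accept_state :: nat
  reject_state :: nat
  transition :: "nat \<Rightarrow> nat list \<Rightarrow> nat \<times> (nat \<times> head_move) list"

definition wf_tm :: "turing_machine \<Rightarrow> bool" where
  "wf_tm M \<longleftrightarrow>
     num_tapes M \<ge> 1 \<and> num_symbols M \<ge> 3 \<and>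
     start_state M < num_states M \<and> accept_state M < num_states M \<and>
     reject_state M < num_states M \<and> accept_state M \<noteq> reject_state M \<and>
     (\<forall>s < num_states M. \<forall>as. length as = num_tapes M \<and> set as \<subseteq> {..<num_symbols M} \<longrightarrow>
        fst (transition M s as) < num_states M \<and>
        length (snd (transition M s as)) = num_tapes M \<and>
        fst ` set (snd (transition M s as)) \<subseteq> {..<num_symbols M})"

type_synonym tape = "(int \<Rightarrow> nat) \<times> int"
type_synonym tm_config = "nat \<times> tape list"

fun head_shift :: "head_move \<Rightarrow> int" where
  "head_shift Move_Left = -1"
| "head_shift Move_Stay = 0"
| "head_shift Move_Right = 1"

definition tape_read :: "tape \<Rightarrow> nat" where
  "tape_read t = fst t (snd t)"

definition tape_act :: "nat \<times> head_move \<Rightarrow> tape \<Rightarrow> tape" where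
  "tape_act a t = ((fst t)(snd t := fst a), snd t + head_shift (snd a))"

definition halted :: "turing_machine \<Rightarrow> tm_config \<Rightarrow> bool" where
  "halted M c \<longleftrightarrow> fst c = accept_state M \<or> fst c = reject_state M"

definition tm_step :: "turing_machine \<Rightarrow> tm_config \<Rightarrow> tm_config" where
  "tm_step M c =
     (if halted M c then c
      else let r = transition M (fst c) (map tape_read (snd c))
           in (fst r, map2 tape_act (snd r) (snd c)))"

definition blank_tape :: tape where
  "blank_tape = ((\<lambda>_. 0), 0)"

definition input_tape :: "bool list \<Rightarrow> tape" where
  "input_tape w =
     ((\<lambda>i. if 0 \<le> i \<and> i < int (length w) then (if w ! nat i then 2 else 1) else 0), 0)"

definition tm_init :: "turing_machine \<Rightarrow> bool list \<Rightarrow> tm_config" where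
  "tm_init M w = (start_state M, input_tape w # replicate (num_tapes M - 1) blank_tape)"

definition tm_run :: "turing_machine \<Rightarrow> bool list \<Rightarrow> nat \<Rightarrow> tm_config" where
  "tm_run M w t = (tm_step M ^^ t) (tm_init M w)"

text \<open>
  A promise problem is the pair of its Yes and No inputs. The machine has to halt in polynomial
  time on every input, while its answer is constrained only on inputs satisfying the promise.
\<close>

type_synonym promise_problem = "bool list set \<times> bool list set"

definition promise_P :: "promise_problem set" where
  "promise_P = {(Yes, No). \<exists>M (p :: nat poly). wf_tm M \<and>
     (\<forall>w. halted M (tm_run M w (poly p (length w)))) \<and>
     (\<forall>w\<in>Yes. fst (tm_run M w (poly p (length w))) = accept_state M) \<and>
     (\<forall>w\<in>No. fst (tm_run M w (poly p (length w))) = reject_state M)}"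


section \<open>Qudit states and operators\<close>

text \<open>
  A vector of $n$ qudits is its function of amplitudes on strings, taken to be 0 off
  \<open>qstrings q n\<close>. An operator is its matrix in the computational basis; its entries off
  \<open>qstrings q n\<close> are never used.
\<close>

definition qstrings :: "nat \<Rightarrow> nat \<Rightarrow> nat list set" where
  "qstrings q n = {x. length x = n \<and> set x \<subseteq> {..<q}}"

type_synonym qvector = "nat list \<Rightarrow> complex"
type_synonym qoperator = "nat list \<Rightarrow> nat list \<Rightarrow> complex"

definition qspace :: "nat \<Rightarrow> nat \<Rightarrow> qvector set" where
  "qspace q n = {v. \<forall>x. x \<notin> qstrings q n \<longrightarrow> v x = 0}"

definition braket :: "nat \<Rightarrow> nat \<Rightarrow> qvector \<Rightarrow> qvector \<Rightarrow> complex" where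
  "braket q n u v = (\<Sum>x\<in>qstrings q n. cnj (u x) * v x)"

definition qapply :: "nat \<Rightarrow> nat \<Rightarrow> qoperator \<Rightarrow> qvector \<Rightarrow> qvector" where
  "qapply q n A v = (\<lambda>x. if x \<in> qstrings q n then \<Sum>y\<in>qstrings q n. A x y * v y else 0)"

definition qstates :: "nat \<Rightarrow> nat \<Rightarrow> qvector set" where
  "qstates q n = {\<psi> \<in> qspace q n. braket q n \<psi> \<psi> = 1}"

definition expectation :: "nat \<Rightarrow> nat \<Rightarrow> qoperator \<Rightarrow> qvector \<Rightarrow> complex" where
  "expectation q n A \<psi> = braket q n \<psi> (qapply q n A \<psi>)"

definition ket :: "nat list \<Rightarrow> qvector" where
  "ket x = (\<lambda>y. if y = x then 1 else 0)"

definition subset_ket :: "nat list set \<Rightarrow> qvector" where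
  "subset_ket T = (\<lambda>y. (1 / complex_of_real (sqrt (real (card T)))) * (\<Sum>x\<in>T. ket x y))"

definition ketbra :: "qvector \<Rightarrow> qvector \<Rightarrow> qoperator" where
  "ketbra u v = (\<lambda>x y. u x * cnj (v y))"

definition hermitian :: "nat \<Rightarrow> nat \<Rightarrow> qoperator \<Rightarrow> bool" where
  "hermitian q n A \<longleftrightarrow> (\<forall>x\<in>qstrings q n. \<forall>y\<in>qstrings q n. A y x = cnj (A x y))"

definition between_0_and_I :: "nat \<Rightarrow> nat \<Rightarrow> qoperator \<Rightarrow> bool" where
  "between_0_and_I q n A \<longleftrightarrow> hermitian q n A \<and>
     (\<forall>v\<in>qspace q n. 0 \<le> Re (expectation q n A v) \<and>
                      Re (expectation q n A v) \<le> Re (braket q n v v))"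

definition stoquastic :: "nat \<Rightarrow> nat \<Rightarrow> qoperator \<Rightarrow> bool" where
  "stoquastic q n A \<longleftrightarrow>
     (\<forall>x\<in>qstrings q n. \<forall>y\<in>qstrings q n. x \<noteq> y \<longrightarrow> A x y \<in> \<real> \<and> Re (A x y) \<le> 0)"

definition is_eigenvalue :: "nat \<Rightarrow> nat \<Rightarrow> qoperator \<Rightarrow> real \<Rightarrow> bool" where
  "is_eigenvalue q n A \<mu> \<longleftrightarrow>
     (\<exists>v\<in>qspace q n. v \<noteq> (\<lambda>_. 0) \<and> qapply q n A v = (\<lambda>x. complex_of_real \<mu> * v x))"

text \<open>
  The groundspace is the eigenspace of the smallest eigenvalue, which is not assumed to be 0.
  The next two definitions are only meaningful for Hermitian operators.
\<close>

definition ground_energy :: "nat \<Rightarrow> nat \<Rightarrow> qoperator \<Rightarrow> real" where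
  "ground_energy q n A = (LEAST \<mu>. is_eigenvalue q n A \<mu>)"

definition groundspace :: "nat \<Rightarrow> nat \<Rightarrow> qoperator \<Rightarrow> qvector set" where
  "groundspace q n A =
     {v \<in> qspace q n. qapply q n A v = (\<lambda>x. complex_of_real (ground_energy q n A) * v x)}"

definition is_projector_onto :: "nat \<Rightarrow> nat \<Rightarrow> qoperator \<Rightarrow> qvector set \<Rightarrow> bool" where
  "is_projector_onto q n P G \<longleftrightarrow> hermitian q n P \<and>
     (\<forall>v\<in>qspace q n. qapply q n P (qapply q n P v) = qapply q n P v) \<and>
     qapply q n P ` qspace q n = G"

definition uniform_term :: "nat \<Rightarrow> nat \<Rightarrow> qoperator \<Rightarrow> bool" where
  "uniform_term q k A \<longleftrightarrow> (\<exists>\<T>. (\<forall>T\<in>\<T>. T \<noteq> {} \<and> T \<subseteq> qstrings q k) \<and> disjoint \<T> \<and>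
     is_projector_onto q k (\<lambda>x y. \<Sum>T\<in>\<T>. ketbra (subset_ket T) (subset_ket T) x y)
       (groundspace q k A))"


section \<open>Local Hamiltonians\<close>

text \<open>
  A term lists the qudits it acts on, in order, with a matrix indexed by strings over those
  qudits. Entries are rational so that instances are finite objects; a stoquastic Hermitian matrix
  is real in any case.
\<close>

record local_term =
  term_qudits :: "nat list"
  term_matrix :: "nat list \<Rightarrow> nat list \<Rightarrow> rat"

record hamiltonian_instance =
  num_qudits :: nat
  ham_terms :: "local_term list"

definition local_operator :: "local_term \<Rightarrow> qoperator" where
  "local_operator h = (\<lambda>x y. of_rat (term_matrix h x y))"

definition restrict_string :: "nat list \<Rightarrow> nat list \<Rightarrow> nat list" where
  "restrict_string x bs = map (\<lambda>b. x ! b) bs"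

definition embedded_operator :: "nat \<Rightarrow> local_term \<Rightarrow> qoperator" where
  "embedded_operator n h = (\<lambda>x y.
     if \<forall>b<n. b \<notin> set (term_qudits h) \<longrightarrow> x ! b = y ! b
     then local_operator h (restrict_string x (term_qudits h)) (restrict_string y (term_qudits h))
     else 0)"

definition hamiltonian :: "hamiltonian_instance \<Rightarrow> qoperator" where
  "hamiltonian I = (\<lambda>x y. (1 / of_nat (length (ham_terms I))) *
     (\<Sum>i<length (ham_terms I). embedded_operator (num_qudits I) (ham_terms I ! i) x y))"

text \<open>
  An operator acts trivially on qudit $b$ if it is the identity on $b$ tensored with an operator
  $B$ on the other qudits. A term may act trivially on qudits that it lists; these do not count
  towards the degree.
\<close>

definition delete_position :: "nat \<Rightarrow> nat list \<Rightarrow> nat list" where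
  "delete_position b x = take b x @ drop (Suc b) x"

definition acts_trivially_on :: "nat \<Rightarrow> nat \<Rightarrow> qoperator \<Rightarrow> nat \<Rightarrow> bool" where
  "acts_trivially_on q n A b \<longleftrightarrow> (\<exists>B :: qoperator. \<forall>x\<in>qstrings q n. \<forall>y\<in>qstrings q n.
     A x y = (if x ! b = y ! b then B (delete_position b x) (delete_position b y) else 0))"

definition valid_term :: "nat \<Rightarrow> nat \<Rightarrow> nat \<Rightarrow> local_term \<Rightarrow> bool" where
  "valid_term q k n h \<longleftrightarrow>
     length (term_qudits h) = k \<and> distinct (term_qudits h) \<and> set (term_qudits h) \<subseteq> {..<n} \<and>
     between_0_and_I q k (local_operator h) \<and>
     stoquastic q k (local_operator h) \<and>
     uniform_term q k (local_operator h)"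

definition bounded_degree :: "nat \<Rightarrow> nat \<Rightarrow> hamiltonian_instance \<Rightarrow> bool" where
  "bounded_degree q d I \<longleftrightarrow> (\<forall>b<num_qudits I.
     card {i. i < length (ham_terms I) \<and>
       \<not> acts_trivially_on q (num_qudits I)
           (embedded_operator (num_qudits I) (ham_terms I ! i)) b} \<le> d)"

text \<open>The polynomial \<open>p\<close> bounds the number of terms in the number of qudits.\<close>

definition valid_instance ::
    "nat \<Rightarrow> nat \<Rightarrow> nat \<Rightarrow> nat poly \<Rightarrow> hamiltonian_instance \<Rightarrow> bool" where
  "valid_instance q k d p I \<longleftrightarrow>
     1 \<le> length (ham_terms I) \<and> length (ham_terms I) \<le> poly p (num_qudits I) \<and>
     (\<forall>h\<in>set (ham_terms I). valid_term q k (num_qudits I) h) \<and>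
     bounded_degree q d I"

definition pinned_yes :: "nat \<Rightarrow> hamiltonian_instance \<Rightarrow> bool" where
  "pinned_yes q I \<longleftrightarrow> (\<exists>\<psi>\<in>qstates q (num_qudits I).
     (\<exists>r>0. braket q (num_qudits I) \<psi> (ket (replicate (num_qudits I) 0)) = complex_of_real r) \<and>
     expectation q (num_qudits I) (hamiltonian I) \<psi> = 0)"

definition pinned_no :: "nat \<Rightarrow> real \<Rightarrow> hamiltonian_instance \<Rightarrow> bool" where
  "pinned_no q \<epsilon> I \<longleftrightarrow> (\<forall>\<psi>\<in>qstates q (num_qudits I).
     \<epsilon> \<le> Re (expectation q (num_qudits I) (hamiltonian I) \<psi>))"


section \<open>Encoding of instances\<close>

text \<open>
  All parts of the encoding are self-delimiting. The number of qudits, the number of terms and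
  qudit indices are in unary, so that polynomial in the input length includes polynomial in $n$.
  Matrix entries are reduced fractions in binary, least significant bit first, with each bit
  preceded by a marker. A matrix is listed row by row, the strings being ordered as in
  \<open>List.n_lists\<close>.
\<close>

definition encode_unary :: "nat \<Rightarrow> bool list" where
  "encode_unary n = replicate n True @ [False]"

fun binary_digits :: "nat \<Rightarrow> bool list" where
  "binary_digits n = (if n = 0 then [] else odd n # binary_digits (n div 2))"

declare binary_digits.simps [simp del]

definition encode_binary :: "nat \<Rightarrow> bool list" where
  "encode_binary n = concat (map (\<lambda>b. [True, b]) (binary_digits n)) @ [False]"

definition encode_rat :: "rat \<Rightarrow> bool list" where
  "encode_rat r = (case quotient_of r of (a, b) \<Rightarrow>
     (a < 0) # encode_binary (nat \<bar>a\<bar>) @ encode_binary (nat b))"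

definition encode_term :: "nat \<Rightarrow> nat \<Rightarrow> local_term \<Rightarrow> bool list" where
  "encode_term q k h =
     concat (map encode_unary (term_qudits h)) @
     concat (map (\<lambda>x. concat (map (\<lambda>y. encode_rat (term_matrix h x y)) (List.n_lists k [0..<q])))
       (List.n_lists k [0..<q]))"

definition encode_instance :: "nat \<Rightarrow> nat \<Rightarrow> hamiltonian_instance \<Rightarrow> bool list" where
  "encode_instance q k I =
     encode_unary (num_qudits I) @ encode_unary (length (ham_terms I)) @
     concat (map (encode_term q k) (ham_terms I))"

definition pinned_hamiltonian_problem ::
    "nat \<Rightarrow> nat \<Rightarrow> nat \<Rightarrow> nat poly \<Rightarrow> real \<Rightarrow> promise_problem" where
  "pinned_hamiltonian_problem q k d p \<epsilon> =
     (encode_instance q k ` {I. valid_instance q k d p I \<and> pinned_yes q I},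
      encode_instance q k ` {I. valid_instance q k d p I \<and> pinned_no q \<epsilon> I})"

end

theory Submission
  imports Defs
begin

text \<open>
  Round all matrix entries to multiples of $1/K$ for a large constant $K$. Join two distinct strings
  by an edge if some term has a nonzero rounded entry there, and call a string bad for a term if its
  rounded row sum is at least $q^k K^{-1}$. In the Yes case every term has zero energy, so the
  amplitude of $\psi$ is constant along edges and the exact row sums vanish wherever it is nonzero;
  no bad string is reachable from $0^n$.

  In the No case the uniform superposition of a set $S$ of good strings has energy at least
  $\varepsilon$, almost all of which comes from edges leaving $S$. By the bounded degree, one of the
  terms that leave $S$ on a constant fraction of its strings avoids the supports of the terms already
  used in the current layer; moving along it enlarges $S$ by a constant factor. Constantly many layers
  would exhaust all strings, so a bad string turns up, and its backward light cone shows that a bad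
  string is reachable from $0^n$ by a constant number $R$ of moves.

  Whether $R+1$ given terms contain such a walk depends only on which of their qudits coincide and on
  their rounded matrices. This is a bounded amount of information, and a finite automaton obtains it
  in one scan of the input with heads started at all items of the terms. Trying all positions of the
  heads takes polynomial time.
\<close>


section \<open>A Turing machine that tries all tuples of marks\<close>

text \<open>A number of moves linear in \<open>m\<close> may be needed before a bad string turns up,
  so expansion alone leaves it far from the origin. Layers shorten the distance: since the supports
  in a layer are disjoint, a qudit is touched by at most one of its moves, and looking back through
  the layer multiplies the number of watched qudits by at most \<open>k + 1\<close>, however wide
  the layer is. A layer has room for a number of moves proportional to \<open>m\<close>. The number
  of strings that moves can produce at all is at most \<open>q ^ (k * m)\<close>, because qudits
  outside all supports never change. So \<open>m\<close> cancels, and the number of layers depends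
  only on \<open>q\<close>, \<open>k\<close>, \<open>d\<close> and \<epsilon>.

  The threshold for bad strings comes from the rounding: a row has at most \<open>q ^ k\<close>
  nonzero entries, each off by less than \<open>1 / K\<close>, so an exact row sum of 0 stays below
  \<open>q ^ k / K\<close>. In the No case, what rounding hides costs each string at most
  \<open>3 * q ^ k / K\<close> per term, and \<open>K\<close> is chosen to make this at most
  \<epsilon>/2. The other half of \<epsilon> must then be paid by edges leaving the set.\<close>

definition cell :: "bool list \<Rightarrow> nat \<Rightarrow> nat" where
  "cell w p = (if p < length w then if w ! p then 2 else 1 else 0)"

text \<open>
  The symbols read at time \<open>t\<close> of a scan. Tape 0 holds the input, with the head at cell \<open>t\<close>; tapes
  1 to \<open>r\<close> hold copies of it, with the heads at the cells \<open>c i + t\<close>; tapes \<open>r + 1\<close> to \<open>2 * r\<close> are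
  blank but for a 1 in cell 0, and their heads, at \<open>c i - t\<close>, read 1 exactly at time \<open>c i\<close>.
\<close>

definition letter :: "nat \<Rightarrow> bool list \<Rightarrow> (nat \<Rightarrow> nat) \<Rightarrow> nat \<Rightarrow> nat \<Rightarrow> nat" where
  "letter r w c t j =
     (if j = 0 then cell w t
      else if j \<le> r then cell w (c (j - 1) + t)
      else if j \<le> 2 * r then of_bool (c (j - Suc r) = t)
      else 0)"

fun scan :: "('s \<Rightarrow> (nat \<Rightarrow> nat) \<Rightarrow> 's) \<Rightarrow> 's \<Rightarrow> nat \<Rightarrow> bool list \<Rightarrow> (nat \<Rightarrow> nat) \<Rightarrow> nat \<Rightarrow> 's" where
  "scan \<delta> s r w c 0 = s"
| "scan \<delta> s r w c (Suc t) = \<delta> (scan \<delta> s r w c t) (letter r w c t)"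

text \<open>The machine is an odometer. Between scans the value of mark \<open>i\<close> is written
  nowhere: it is the common position of the heads on tapes \<open>i + 1\<close> and
  \<open>r + i + 1\<close>. Hence \<open>Back\<close> has to return all heads, carrying the verdict
  of the scan. \<open>Inc i\<close> then advances mark \<open>i\<close>; at the end of the input
  \<open>Rst i\<close> walks it home instead, and the carry passes to the next mark.
  \<open>Acc\<close> is entered when the carry leaves the last mark.\<close>

datatype phase = Acc | Rej | Mark | Copy | Rew | Back bool | Inc nat | Rst nat | Scan nat

locale scanner =
  fixes r N :: nat and \<delta> :: "nat \<Rightarrow> (nat \<Rightarrow> nat) \<Rightarrow> nat" and s0 :: nat and F :: "nat \<Rightarrow> bool"
  assumes s0: "s0 < N" and \<delta>: "\<And>s l. s < N \<Longrightarrow> \<delta> s l < N"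
begin

definition phases :: "phase set" where
  "phases = {Acc, Rej, Mark, Copy, Rew, Back True, Back False} \<union> Inc ` {..r} \<union> Rst ` {..<r} \<union> Scan ` {..<N}"

definition code :: "phase \<Rightarrow> nat" where
  "code = (SOME h. bij_betw h phases {..<card phases})"

lemma code: "bij_betw code phases {..<card phases}"
proof -
  have "finite phases" by (simp add: phases_def)
  then have "\<exists>h. bij_betw h phases {..<card phases}"
    using ex_bij_betw_finite_nat[of phases] by (simp add: lessThan_atLeast0)
  then show ?thesis unfolding code_def by (rule someI_ex)
qed

definition shift_main :: "head_move \<Rightarrow> nat \<Rightarrow> head_move" where
  "shift_main m j = (if j \<le> r then m else Move_Stay)"

definition shift_mark :: "nat \<Rightarrow> head_move \<Rightarrow> nat \<Rightarrow> head_move" where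
  "shift_mark i m j = (if j = Suc i \<or> j = Suc (r + i) then m else Move_Stay)"

definition fwd :: "nat \<Rightarrow> head_move" where
  "fwd j = (if j \<le> r then Move_Right else Move_Left)"

definition bwd :: "nat \<Rightarrow> head_move" where
  "bwd j = (if j \<le> r then Move_Left else Move_Right)"

fun trans :: "phase \<Rightarrow> (nat \<Rightarrow> nat) \<Rightarrow> phase \<times> (nat \<Rightarrow> nat) \<times> (nat \<Rightarrow> head_move)" where
  "trans Mark l = (Copy, (\<lambda>j. if j \<le> r then l j else 1), \<lambda>j. Move_Stay)"
| "trans Copy l = (if l 0 = 0 then (Rew, l, shift_main Move_Left)
     else (Copy, (\<lambda>j. if j \<le> r then l 0 else l j), shift_main Move_Right))"
| "trans Rew l = (if l 0 = 0 then (Scan s0, l, shift_main Move_Right) else (Rew, l, shift_main Move_Left))"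
| "trans (Scan s) l = (if l 0 = 0 then (Back (F s), l, bwd) else (Scan (\<delta> s l), l, fwd))"
| "trans (Back b) l = (if l 0 = 0 then (if b then Rej else Inc 0, l, fwd) else (Back b, l, bwd))"
| "trans (Inc i) l = (if i \<ge> r then (Acc, l, \<lambda>j. Move_Stay)
     else if l (Suc i) = 0 then (Rst i, l, shift_mark i Move_Left)
     else (Scan s0, l, shift_mark i Move_Right))"
| "trans (Rst i) l = (if l (Suc i) = 0 then (Inc (Suc i), l, shift_mark i Move_Right)
     else (Rst i, l, shift_mark i Move_Left))"
| "trans Acc l = (Acc, l, \<lambda>j. Move_Stay)"
| "trans Rej l = (Rej, l, \<lambda>j. Move_Stay)"

definition symbols_at :: "nat list \<Rightarrow> nat \<Rightarrow> nat" where
  "symbols_at as j = (if j < Suc (2 * r) then as ! j else 0)"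

definition M :: turing_machine where
  "M = \<lparr> num_tapes = Suc (2 * r), num_symbols = 3, num_states = card phases,
     start_state = code Mark, accept_state = code Acc, reject_state = code Rej,
     transition = (\<lambda>s as.
       case trans (inv_into phases code s) (symbols_at as) of
         (s', wr, mv) \<Rightarrow> (code s', map (\<lambda>j. (wr j, mv j)) [0..<Suc (2 * r)])) \<rparr>"

lemma phases_I [simp]:
  "Acc \<in> phases" "Rej \<in> phases" "Mark \<in> phases" "Copy \<in> phases" "Rew \<in> phases" "Back b \<in> phases"
  "Inc i \<in> phases \<longleftrightarrow> i \<le> r" "Rst i \<in> phases \<longleftrightarrow> i < r" "Scan s \<in> phases \<longleftrightarrow> s < N"
  by (cases b) (auto simp: phases_def)

lemma code_less [simp]: "s \<in> phases \<Longrightarrow> code s < card phases"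
  using code by (auto simp: bij_betw_def)

lemma code_eq [simp]: "s \<in> phases \<Longrightarrow> s' \<in> phases \<Longrightarrow> code s = code s' \<longleftrightarrow> s = s'"
  using code by (auto simp: bij_betw_def inj_on_def)

lemma inv_code [simp]: "s \<in> phases \<Longrightarrow> inv_into phases code (code s) = s"
  using code by (simp add: bij_betw_def inv_into_f_f)

lemma trans_phases: "s \<in> phases \<Longrightarrow> fst (trans s l) \<in> phases"
  using s0 \<delta> by (cases s) (auto simp del: code_less)

lemma trans_write:
  assumes "\<And>j. l j < 3"
  shows "fst (snd (trans s l)) j < 3"
  using assms by (cases s) (auto split: if_splits)

lemma wf_M: "wf_tm M"
proof -
  have "fst (transition M s as) < card phases \<and>
        length (snd (transition M s as)) = Suc (2 * r) \<and>
        fst ` set (snd (transition M s as)) \<subseteq> {..<3}"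
    if s: "s < card phases" and as: "length as = Suc (2 * r)" "set as \<subseteq> {..<3}" for s as
  proof -
    let ?s = "inv_into phases code s"
    have "?s \<in> phases" using s code
      by (metis bij_betw_imp_surj_on inv_into_into lessThan_iff)
    then have *: "fst (trans ?s (symbols_at as)) \<in> phases" by (rule trans_phases)
    have "symbols_at as j < 3" for j
      using as nth_mem[of j as] by (auto simp: symbols_at_def subset_eq simp del: nth_mem)
    then have "fst (snd (trans ?s (symbols_at as))) j < 3" for j by (rule trans_write)
    then show ?thesis using * by (auto simp: M_def split: prod.splits)
  qed
  then show ?thesis by (simp add: wf_tm_def M_def)
qed

section \<open>Configurations given by tape contents and head positions\<close>

definition conf :: "phase \<Rightarrow> (nat \<Rightarrow> int \<Rightarrow> nat) \<Rightarrow> (nat \<Rightarrow> int) \<Rightarrow> tm_config" where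
  "conf s T P = (code s, map (\<lambda>j. (T j, P j)) [0..<Suc (2 * r)])"

lemma conf_cong:
  assumes "s = s'" "\<And>j. j \<le> 2 * r \<Longrightarrow> T j = T' j" "\<And>j. j \<le> 2 * r \<Longrightarrow> P j = P' j"
  shows "conf s T P = conf s' T' P'"
  using assms by (auto simp: conf_def)

definition reads :: "(nat \<Rightarrow> int \<Rightarrow> nat) \<Rightarrow> (nat \<Rightarrow> int) \<Rightarrow> nat \<Rightarrow> nat" where
  "reads T P j = (if j \<le> 2 * r then T j (P j) else 0)"

lemma step_conf:
  assumes "s \<in> phases" "s \<noteq> Acc" "s \<noteq> Rej" "trans s (reads T P) = (s', wr, mv)"
  shows "tm_step M (conf s T P) =
    conf s' (\<lambda>j. (T j)(P j := wr j)) (\<lambda>j. P j + head_shift (mv j))"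
proof -
  have "symbols_at (map tape_read (map (\<lambda>j. (T j, P j)) [0..<Suc (2 * r)])) = reads T P"
    by (auto simp: symbols_at_def reads_def tape_read_def fun_eq_iff simp del: upt_Suc)
  moreover have "\<not> halted M (conf s T P)"
    using assms by (simp add: halted_def conf_def M_def)
  ultimately show ?thesis using assms
    by (simp add: tm_step_def conf_def M_def Let_def map2_map_map tape_act_def del: upt_Suc)
qed

lemma step_conf_move:
  assumes "s \<in> phases" "s \<noteq> Acc" "s \<noteq> Rej" "trans s (reads T P) = (s', reads T P, mv)"
    "\<And>j. j \<le> 2 * r \<Longrightarrow> P' j = P j + head_shift (mv j)"
  shows "tm_step M (conf s T P) = conf s' T P'"
  unfolding step_conf[OF assms(1-4)]
  by (rule conf_cong) (auto simp: reads_def assms)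

definition content :: "bool list \<Rightarrow> nat \<Rightarrow> int \<Rightarrow> nat" where
  "content w j p = (if j \<le> r then (if p < 0 then 0 else cell w (nat p)) else of_bool (p = 0))"

text \<open>The time is an integer because the way back ends at -1: the blank to the left of the
  input is the only sign of its beginning.\<close>

definition pos :: "(nat \<Rightarrow> nat) \<Rightarrow> int \<Rightarrow> nat \<Rightarrow> int" where
  "pos c t j = (if j = 0 then t else if j \<le> r then int (c (j - 1)) + t else int (c (j - Suc r)) - t)"

lemma reads_0: "reads (content w) P 0 = (if P 0 < 0 then 0 else cell w (nat (P 0)))"
  by (simp add: reads_def content_def)

lemma reads_letter: "reads (content w) (pos c (int t)) = letter r w c t"
  by (auto simp: reads_def content_def pos_def letter_def fun_eq_iff nat_add_distrib)

text \<open>An upper bound on the number of steps suffices, since a halted configuration no longer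
  changes.\<close>

definition takes :: "tm_config \<Rightarrow> nat \<Rightarrow> tm_config \<Rightarrow> bool" where
  "takes a n b \<longleftrightarrow> (\<exists>t\<le>n. (tm_step M ^^ t) a = b)"

lemma takes_refl [simp]: "takes a n a"
  unfolding takes_def by (rule exI[of _ 0]) simp

lemma takes_trans:
  assumes "takes a m b" "takes b n c" "m + n \<le> k"
  shows "takes a k c"
proof -
  obtain s t where "s \<le> m" "(tm_step M ^^ s) a = b" "t \<le> n" "(tm_step M ^^ t) b = c"
    using assms by (auto simp: takes_def)
  then have "t + s \<le> k" "(tm_step M ^^ (t + s)) a = c"
    using assms(3) by (auto simp: funpow_add)
  then show ?thesis unfolding takes_def by blast
qed

lemma takes_step: "tm_step M a = b \<Longrightarrow> takes a 1 b"
  unfolding takes_def by (rule exI[of _ 1]) simp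

lemma takes_step': "tm_step M a = b \<Longrightarrow> takes b n c \<Longrightarrow> takes a (Suc n) c"
  using takes_trans[OF takes_step] by auto

lemma takes_mono: "takes a m b \<Longrightarrow> m \<le> n \<Longrightarrow> takes a n b"
  unfolding takes_def by (auto intro: order.trans)

lemma scan_less: "scan \<delta> s0 r w c t < N"
  using s0 \<delta> by (induction t) auto

abbreviation conf_at :: "bool list \<Rightarrow> phase \<Rightarrow> (nat \<Rightarrow> nat) \<Rightarrow> int \<Rightarrow> tm_config" where
  "conf_at w s c t \<equiv> conf s (content w) (pos c t)"

definition found :: "bool list \<Rightarrow> (nat \<Rightarrow> nat) \<Rightarrow> bool" where
  "found w c \<longleftrightarrow> F (scan \<delta> s0 r w c (length w))"

section \<open>One scan, forth and back\<close>

lemma scan_forward: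
  assumes "t \<le> length w"
  shows "takes (conf_at w (Scan s0) c 0) t
           (conf_at w (Scan (scan \<delta> s0 r w c t)) c (int t))"
  using assms
proof (induction t)
  case (Suc t)
  have "tm_step M (conf_at w (Scan (scan \<delta> s0 r w c t)) c (int t)) =
     conf_at w (Scan (scan \<delta> s0 r w c (Suc t))) c (int (Suc t))"
  proof (rule step_conf_move)
    have "letter r w c t 0 \<noteq> 0" using Suc.prems by (simp add: letter_def cell_def)
    then show "trans (Scan (scan \<delta> s0 r w c t)) (reads (content w) (pos c (int t))) =
      (Scan (scan \<delta> s0 r w c (Suc t)), reads (content w) (pos c (int t)), fwd)"
      by (simp add: reads_letter)
  qed (use scan_less in \<open>auto simp: pos_def fwd_def\<close>)
  from takes_trans[OF Suc.IH takes_step[OF this]] Suc.prems show ?case by simp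
qed simp

lemma scan_back:
  assumes "t \<le> length w"
  shows "takes (conf_at w (Back b) c (int t - 1)) t
           (conf_at w (Back b) c (- 1))"
  using assms
proof (induction t)
  case (Suc t)
  have "tm_step M (conf_at w (Back b) c (int t)) =
     conf_at w (Back b) c (int t - 1)"
  proof (rule step_conf_move)
    have "letter r w c t 0 \<noteq> 0" using Suc.prems by (simp add: letter_def cell_def)
    then show "trans (Back b) (reads (content w) (pos c (int t))) =
      (Back b, reads (content w) (pos c (int t)), bwd)"
      by (simp add: reads_letter)
  qed (auto simp: pos_def bwd_def)
  from takes_step'[OF this Suc.IH] Suc.prems show ?case by simp
qed simp

lemma scan_once:
  defines "b w c \<equiv> F (scan \<delta> s0 r w c (length w))"
  shows "takes (conf_at w (Scan s0) c 0) (2 * length w + 2)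
     (conf_at w (if b w c then Rej else Inc 0) c 0)"
proof -
  let ?L = "length w"
  have 1: "tm_step M (conf_at w (Scan (scan \<delta> s0 r w c ?L)) c (int ?L)) =
     conf_at w (Back (b w c)) c (int ?L - 1)"
  proof (rule step_conf_move)
    have "letter r w c ?L 0 = 0" by (simp add: letter_def cell_def)
    then show "trans (Scan (scan \<delta> s0 r w c ?L)) (reads (content w) (pos c (int ?L))) =
      (Back (b w c), reads (content w) (pos c (int ?L)), bwd)"
      by (simp add: reads_letter b_def)
  qed (use scan_less in \<open>auto simp: pos_def bwd_def\<close>)
  have 2: "tm_step M (conf_at w (Back (b w c)) c (- 1)) =
     conf_at w (if b w c then Rej else Inc 0) c 0"
  proof (rule step_conf_move)
    show "trans (Back (b w c)) (reads (content w) (pos c (- 1))) =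
      (if b w c then Rej else Inc 0, reads (content w) (pos c (- 1)), fwd)"
      by (simp add: reads_0 pos_def)
  qed (auto simp: pos_def fwd_def)
  show ?thesis
    by (rule takes_trans[OF scan_forward[OF order_refl]
          takes_step'[OF 1 takes_trans[OF scan_back[OF order_refl] takes_step[OF 2] order_refl]]]) simp
qed

section \<open>Advancing and resetting the marks\<close>

lemma inc_step:
  assumes "i < r" "c i < length w"
  shows "tm_step M (conf_at w (Inc i) c 0) =
    conf_at w (Scan s0) (c(i := Suc (c i))) 0"
proof (rule step_conf_move)
  have "reads (content w) (pos c 0) (Suc i) \<noteq> 0"
    using assms reads_letter[of w c 0] by (simp add: letter_def cell_def)
  then show "trans (Inc i) (reads (content w) (pos c 0)) =
      (Scan s0, reads (content w) (pos c 0), shift_mark i Move_Right)" using assms by simp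
qed (use assms s0 in \<open>auto simp: pos_def shift_mark_def\<close>)

text \<open>The head positions are an arbitrary \<open>P\<close> because mark \<open>i\<close> steps
  on cell -1 before it turns, and no tuple of natural numbers describes that.\<close>

lemma rst_steps:
  assumes i: "i < r" and "t \<le> length w"
    and P: "P (Suc i) = int t - 1" "P (Suc (r + i)) = int t - 1"
  shows "takes (conf (Rst i) (content w) P) (Suc t)
     (conf (Inc (Suc i)) (content w) (P(Suc i := 0, Suc (r + i) := 0)))"
  using assms(2-)
proof (induction t arbitrary: P)
  case 0
  have "reads (content w) P (Suc i) = 0" using 0 i by (simp add: reads_def content_def)
  then have "tm_step M (conf (Rst i) (content w) P) =
     conf (Inc (Suc i)) (content w) (P(Suc i := 0, Suc (r + i) := 0))"
    using 0 i by (intro step_conf_move[where mv = "shift_mark i Move_Right"]) (auto simp: shift_mark_def)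
  from takes_step[OF this] show ?case by (simp only: One_nat_def of_nat_0 diff_0)
next
  case (Suc t)
  let ?P = "P(Suc i := int t - 1, Suc (r + i) := int t - 1)"
  have "reads (content w) P (Suc i) \<noteq> 0" using Suc.prems i
    by (simp add: reads_def content_def cell_def)
  then have 1: "tm_step M (conf (Rst i) (content w) P) = conf (Rst i) (content w) ?P"
    using Suc.prems i by (intro step_conf_move[where mv = "shift_mark i Move_Left"]) (auto simp: shift_mark_def)
  have "takes (conf (Rst i) (content w) ?P) (Suc t)
     (conf (Inc (Suc i)) (content w) (?P(Suc i := 0, Suc (r + i) := 0)))"
    by (rule Suc.IH) (use Suc.prems i in auto)
  moreover have "?P(Suc i := 0, Suc (r + i) := 0) = P(Suc i := 0, Suc (r + i) := 0)"
    by (simp add: fun_eq_iff)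
  ultimately show ?case using takes_step'[OF 1] by metis
qed

lemma inc_reset:
  assumes i: "i < r" and "c i = length w"
  shows "takes (conf_at w (Inc i) c 0) (length w + 2)
     (conf_at w (Inc (Suc i)) (c(i := 0)) 0)"
proof -
  let ?L = "length w"
  let ?P = "(pos c 0)(Suc i := int ?L - 1, Suc (r + i) := int ?L - 1)"
  have "reads (content w) (pos c 0) (Suc i) = 0"
    using assms reads_letter[of w c 0] by (simp add: letter_def cell_def)
  then have 1: "tm_step M (conf_at w (Inc i) c 0) = conf (Rst i) (content w) ?P"
    using assms by (intro step_conf_move[where mv = "shift_mark i Move_Left"])
      (auto simp: shift_mark_def pos_def)
  have 2: "takes (conf (Rst i) (content w) ?P) (Suc ?L)
     (conf (Inc (Suc i)) (content w) (?P(Suc i := 0, Suc (r + i) := 0)))"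
    by (rule rst_steps) (use i in auto)
  have 3: "conf (Inc (Suc i)) (content w) (?P(Suc i := 0, Suc (r + i) := 0)) =
    conf_at w (Inc (Suc i)) (c(i := 0)) 0"
    using i by (intro conf_cong) (auto simp: pos_def)
  from takes_step'[OF 1 2] show ?thesis unfolding 3 by simp
qed

definition tuples_above :: "bool list \<Rightarrow> nat \<Rightarrow> (nat \<Rightarrow> nat) \<Rightarrow> (nat \<Rightarrow> nat) set" where
  "tuples_above w i c = {c'. (\<forall>j<i. c' j \<le> length w) \<and> (\<forall>j\<ge>i. c' j = c j)}"

definition rejects :: "tm_config \<Rightarrow> nat \<Rightarrow> bool" where
  "rejects a n \<longleftrightarrow> (\<exists>T P. takes a n (conf Rej T P))"

lemma rejects_trans: "takes a m b \<Longrightarrow> rejects b n \<Longrightarrow> m + n \<le> k \<Longrightarrow> rejects a k"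
  unfolding rejects_def using takes_trans by blast

text \<open>Induction over the marks: a sweep over the marks up to \<open>i\<close> consists of a
  sweep over the lower ones for each of the \<open>length w + 1\<close> values of mark
  \<open>i\<close>. A sweep that finds nothing leaves the lower marks at 0 again, hence ends with
  the tuple \<open>c\<close> it started from. The factor \<open>2 * length w + 8\<close> gained per
  level pays for these sweeps, the single steps between them and the reset.\<close>

lemma odometer:
  fixes w :: "bool list"
  assumes "i \<le> r" "\<And>j. j < i \<Longrightarrow> c j = 0"
  defines "B \<equiv> \<lambda>i. (2 * length w + 8) ^ Suc i"
  shows "((\<exists>c'\<in>tuples_above w i c. found w c') \<longrightarrow>
      rejects (conf_at w (Scan s0) c 0) (B i)) \<and>
    (\<not> (\<exists>c'\<in>tuples_above w i c. found w c') \<longrightarrow>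
      takes (conf_at w (Scan s0) c 0) (B i) (conf_at w (Inc i) c 0))"
  using assms(1,2)
proof (induction i arbitrary: c)
  case 0
  have sing: "tuples_above w 0 c = {c}" by (auto simp: tuples_above_def)
  have "2 * length w + 2 \<le> B 0" by (simp add: B_def)
  note once = takes_mono[OF scan_once[of w c] this, folded found_def]
  show ?case unfolding sing rejects_def using once by (cases "found w c") auto
next
  case (Suc i)
  let ?L = "length w"
  define u where "u v = c(i := v)" for v
  let ?C = "\<lambda>v. conf_at w (Scan s0) (u v) 0"
  let ?U = "\<lambda>v. tuples_above w i (u v)"
  have i: "i < r" using Suc.prems by simp
  have IH: "((\<exists>c'\<in>?U v. found w c') \<longrightarrow> rejects (?C v) (B i)) \<and>
    (\<not> (\<exists>c'\<in>?U v. found w c') \<longrightarrow> takes (?C v) (B i) (conf_at w (Inc i) (u v) 0))" for v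
    by (rule Suc.IH) (use Suc.prems in \<open>auto simp: u_def\<close>)
  have split: "tuples_above w (Suc i) c = (\<Union>v\<le>?L. ?U v)"
  proof (intro equalityI subsetI)
    fix x assume x: "x \<in> tuples_above w (Suc i) c"
    then have "x \<in> ?U (x i)" "x i \<le> ?L" by (auto simp: tuples_above_def u_def)
    then show "x \<in> (\<Union>v\<le>?L. ?U v)" by blast
  next
    fix x assume "x \<in> (\<Union>v\<le>?L. ?U v)"
    then obtain v where v: "v \<le> ?L" "x \<in> ?U v" by blast
    then show "x \<in> tuples_above w (Suc i) c"
      by (auto simp: tuples_above_def u_def less_Suc_eq Suc_le_eq split: if_splits)
  qed
  \<comment> \<open>Induction on the number of values of mark \<open>i\<close> above
    \<open>b\<close>; a sweep that succeeds ends the search at once.\<close>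
  have loop: "((\<exists>c'\<in>(\<Union>v\<in>{b..?L}. ?U v). found w c') \<longrightarrow> rejects (?C b) ((?L - b) * (B i + 1) + B i)) \<and>
     (\<not> (\<exists>c'\<in>(\<Union>v\<in>{b..?L}. ?U v). found w c') \<longrightarrow>
        takes (?C b) ((?L - b) * (B i + 1) + B i) (conf_at w (Inc i) (u ?L) 0))"
    if "b \<le> ?L" for b
    using that
  proof (induction "?L - b" arbitrary: b)
    case 0
    then show ?case using IH[of b] by auto
  next
    case (Suc n)
    then have b: "b < ?L" and n: "?L - b = Suc n" "?L - Suc b = n" by auto
    have un: "{b..?L} = insert b {Suc b..?L}" using b by auto
    have st: "tm_step M (conf_at w (Inc i) (u b) 0) = ?C (Suc b)"
      using inc_step[OF i, of "u b" w] b by (simp add: u_def)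
    show ?case
    proof (cases "\<exists>c'\<in>?U b. found w c'")
      case True
      then have "rejects (?C b) (B i)" using IH[of b] by blast
      then have "rejects (?C b) (Suc n * (B i + 1) + B i)" unfolding rejects_def
        by (meson le_add2 takes_mono)
      then show ?thesis using True unfolding un n by auto
    next
      case False
      then have t: "takes (?C b) (B i + 1) (?C (Suc b))"
        using IH[of b] takes_trans[OF _ takes_step[OF st]] by blast
      have hyp: "((\<exists>c'\<in>(\<Union>v\<in>{Suc b..?L}. ?U v). found w c') \<longrightarrow> rejects (?C (Suc b)) (n * (B i + 1) + B i)) \<and>
     (\<not> (\<exists>c'\<in>(\<Union>v\<in>{Suc b..?L}. ?U v). found w c') \<longrightarrow>
        takes (?C (Suc b)) (n * (B i + 1) + B i) (conf_at w (Inc i) (u ?L) 0))"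
        using Suc.hyps(1)[of "Suc b"] b n by auto
      have "(\<exists>c'\<in>(\<Union>v\<in>{b..?L}. ?U v). found w c') = (\<exists>c'\<in>(\<Union>v\<in>{Suc b..?L}. ?U v). found w c')"
        using False unfolding un by auto
      then show ?thesis using hyp unfolding n
        by (auto intro: takes_trans[OF t] rejects_trans[OF t])
    qed
  qed
  have bound: "?L * (B i + 1) + B i + (?L + 2) \<le> B (Suc i)"
  proof -
    have "2 * ?L + 8 \<le> B i" unfolding B_def by (rule self_le_power) auto
    then have "?L * (B i + 1) + B i + (?L + 2) \<le> (2 * ?L + 8) * B i"
      by (simp add: algebra_simps)
    then show ?thesis by (simp only: B_def power_Suc)
  qed
  have C0: "u 0 = c"
    using Suc.prems by (auto simp: u_def fun_upd_idem)
  have U: "(\<Union>v\<in>{0..?L}. ?U v) = tuples_above w (Suc i) c" unfolding split by auto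
  note loop0 = loop[of 0, unfolded U C0, OF le0, unfolded diff_zero]
  show ?case
  proof (cases "\<exists>c'\<in>tuples_above w (Suc i) c. found w c'")
    case True
    then have "rejects (conf_at w (Scan s0) c 0) (?L * (B i + 1) + B i)"
      using loop0 by simp
    then show ?thesis using True bound rejects_trans[OF takes_refl[of _ 0]] by simp
  next
    case False
    then have "takes (conf_at w (Scan s0) c 0) (?L * (B i + 1) + B i)
        (conf_at w (Inc i) (u ?L) 0)"
      using loop0 by simp
    moreover have "(u ?L)(i := 0) = c" "u ?L i = ?L"
      using Suc.prems by (auto simp: u_def fun_upd_idem)
    ultimately have "takes (conf_at w (Scan s0) c 0) (B (Suc i))
        (conf_at w (Inc (Suc i)) c 0)"
      using takes_trans[OF _ inc_reset[OF i, of "u ?L" w] bound] by simp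
    then show ?thesis using False by simp
  qed
qed

section \<open>Setting up the tapes\<close>

definition copied :: "bool list \<Rightarrow> nat \<Rightarrow> nat \<Rightarrow> int \<Rightarrow> nat" where
  "copied w t j p = (if j = 0 then content w 0 p
     else if j \<le> r then (if p < int t then content w j p else 0) else of_bool (p = 0))"

lemma init_conf:
  "tm_init M w = conf Mark (\<lambda>j. if j = 0 then content w 0 else (\<lambda>_. 0)) (\<lambda>_. 0)"
proof -
  have "map (\<lambda>j. (if j = 0 then content w 0 else (\<lambda>_. 0), 0)) [0..<Suc (2 * r)] =
    input_tape w # replicate (2 * r) blank_tape"
    by (rule nth_equalityI)
      (auto simp: nth_Cons blank_tape_def input_tape_def content_def cell_def fun_eq_iff
        simp del: upt_Suc split: nat.splits)
  then show ?thesis by (simp add: tm_init_def M_def conf_def)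
qed

lemma mark_step: "tm_step M (tm_init M w) = conf Copy (copied w 0) (\<lambda>_. 0)"
  unfolding init_conf
  by (subst step_conf[OF _ _ _ trans.simps(1)])
    (auto intro!: conf_cong simp: copied_def reads_def fun_eq_iff content_def)

definition main_pos :: "int \<Rightarrow> nat \<Rightarrow> int" where
  "main_pos t j = (if j \<le> r then t else 0)"

lemma copy_steps:
  assumes "t \<le> length w"
  shows "takes (conf Copy (copied w 0) (main_pos 0)) t (conf Copy (copied w t) (main_pos (int t)))"
  using assms
proof (induction t)
  case (Suc t)
  let ?l = "reads (copied w t) (main_pos (int t))"
  have l0: "?l 0 = cell w t" by (simp add: reads_def copied_def content_def main_pos_def)
  then have tr: "trans Copy ?l = (Copy, (\<lambda>j. if j \<le> r then ?l 0 else ?l j), shift_main Move_Right)"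
    using Suc.prems by (simp add: cell_def)
  have "tm_step M (conf Copy (copied w t) (main_pos (int t))) =
    conf Copy (copied w (Suc t)) (main_pos (int (Suc t)))"
    by (subst step_conf[OF _ _ _ tr], simp_all only: l0)
      (auto intro!: conf_cong simp: copied_def reads_def content_def main_pos_def shift_main_def fun_eq_iff)
  from takes_trans[OF Suc.IH takes_step[OF this]] Suc.prems show ?case by simp
qed simp

lemma copied_all: "copied w (length w) = content w"
  by (auto simp: copied_def content_def cell_def fun_eq_iff)

lemma rewind_steps:
  assumes "t \<le> length w"
  shows "takes (conf Rew (content w) (main_pos (int t - 1))) (Suc t)
    (conf_at w (Scan s0) (\<lambda>_. 0) 0)"
  using assms
proof (induction t)
  case 0
  have "reads (content w) (main_pos (- 1)) 0 = 0" by (simp add: reads_0 main_pos_def)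
  then have "tm_step M (conf Rew (content w) (main_pos (- 1))) = conf_at w (Scan s0) (\<lambda>_. 0) 0"
    by (intro step_conf_move[where mv = "shift_main Move_Right"])
      (auto simp: shift_main_def main_pos_def pos_def)
  from takes_step[OF this] show ?case by (simp only: One_nat_def of_nat_0 diff_0)
next
  case (Suc t)
  have "reads (content w) (main_pos (int t)) 0 \<noteq> 0"
    using Suc.prems by (simp add: reads_0 main_pos_def cell_def)
  then have "tm_step M (conf Rew (content w) (main_pos (int t))) = conf Rew (content w) (main_pos (int t - 1))"
    by (intro step_conf_move[where mv = "shift_main Move_Left"])
      (auto simp: shift_main_def main_pos_def)
  from takes_step'[OF this Suc.IH] Suc.prems show ?case by simp
qed

lemma setup_steps:
  "takes (tm_init M w) (2 * length w + 3) (conf_at w (Scan s0) (\<lambda>_. 0) 0)"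
proof -
  let ?L = "length w"
  have m0: "(\<lambda>_. 0) = main_pos 0" by (simp add: main_pos_def fun_eq_iff)
  have "reads (content w) (main_pos (int ?L)) 0 = 0" by (simp add: reads_0 main_pos_def cell_def)
  then have "tm_step M (conf Copy (content w) (main_pos (int ?L))) = conf Rew (content w) (main_pos (int ?L - 1))"
    by (intro step_conf_move[where mv = "shift_main Move_Left"])
      (auto simp: shift_main_def main_pos_def)
  note 1 = takes_step'[OF this rewind_steps[OF order_refl]]
  have 2: "takes (conf Copy (copied w 0) (main_pos 0)) ?L (conf Copy (content w) (main_pos (int ?L)))"
    using copy_steps[of ?L w] by (simp add: copied_all)
  show ?thesis
    by (rule takes_mono[OF takes_step'[OF mark_step[unfolded m0] takes_trans[OF 2 1 order_refl]]]) simp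
qed

section \<open>Verdict and running time\<close>

lemma run_from_takes:
  assumes "takes (tm_init M w) n (conf s T P)" "s = Acc \<or> s = Rej" "n \<le> m"
  shows "tm_run M w m = conf s T P"
proof -
  obtain t where t: "t \<le> n" "(tm_step M ^^ t) (tm_init M w) = conf s T P"
    using assms(1) by (auto simp: takes_def)
  have idle: "tm_step M (conf s T P) = conf s T P"
    using assms(2) by (auto simp: tm_step_def halted_def conf_def M_def)
  have "(tm_step M ^^ u) (conf s T P) = conf s T P" for u
    by (induction u) (auto simp: idle)
  moreover have "m = (m - t) + t" using t assms by simp
  ultimately show ?thesis unfolding tm_run_def by (metis comp_apply funpow_add t(2))
qed

lemma decides:
  defines "n \<equiv> \<lambda>w. (2 * length w + 8) ^ (r + 2)"
  shows "\<exists>T P. tm_run M w (n w) =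
     conf (if \<exists>c. (\<forall>i<r. c i \<le> length w) \<and> found w c then Rej else Acc) T P"
proof -
  let ?B = "(2 * length w + 8) ^ Suc r"
  have bound: "2 * length w + 3 + (?B + 1) \<le> n w"
  proof -
    have "2 * length w + 3 + (B + 1) \<le> (2 * length w + 8) * B" if "2 * length w + 8 \<le> B" for B
      using that by (simp add: algebra_simps)
    from this[of ?B] have "2 * length w + 3 + (?B + 1) \<le> (2 * length w + 8) * ?B"
      using self_le_power[of "2 * length w + 8" "Suc r"] by linarith
    then show ?thesis by (simp only: n_def add_2_eq_Suc' power_Suc)
  qed
  \<comment> \<open>Only the first \<open>r\<close> marks influence a scan, whereas the odometer
    produces tuples that are 0 beyond them.\<close>
  have same: "found w c = found w c'" if "\<And>i. i < r \<Longrightarrow> c i = c' i" for c c'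
  proof -
    have "letter r w c t = letter r w c' t" for t
      using that by (auto simp: letter_def fun_eq_iff)
    then have "scan \<delta> s0 r w c t = scan \<delta> s0 r w c' t" for t by (induction t) auto
    then show ?thesis by (simp add: found_def)
  qed
  have eq: "(\<exists>c'\<in>tuples_above w r (\<lambda>_. 0). found w c') \<longleftrightarrow>
        (\<exists>c. (\<forall>i<r. c i \<le> length w) \<and> found w c)" (is "_ \<longleftrightarrow> ?ex")
  proof
    assume ?ex
    then obtain c where c: "\<forall>i<r. c i \<le> length w" "found w c" by blast
    let ?c = "\<lambda>i. if i < r then c i else 0"
    have "?c \<in> tuples_above w r (\<lambda>_. 0)" "found w ?c"
      using c same[of c ?c] by (auto simp: tuples_above_def)
    then show "\<exists>c'\<in>tuples_above w r (\<lambda>_. 0). found w c'" by blast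
  qed (auto simp: tuples_above_def)
  note od = odometer[of r "\<lambda>_. 0" w, unfolded eq]
  show ?thesis
  proof (cases ?ex)
    case True
    then obtain T P where "takes (conf_at w (Scan s0) (\<lambda>_. 0) 0) ?B (conf Rej T P)"
      using od by (auto simp: rejects_def)
    from takes_trans[OF setup_steps this order_refl]
    have "tm_run M w (n w) = conf Rej T P"
      by (rule run_from_takes) (use bound in auto)
    then show ?thesis using True by auto
  next
    case False
    have "tm_step M (conf_at w (Inc r) (\<lambda>_. 0) 0) = conf_at w Acc (\<lambda>_. 0) 0"
      by (rule step_conf_move) auto
    from takes_trans[OF setup_steps takes_trans[OF _ takes_step[OF this] order_refl] order_refl]
    have "takes (tm_init M w) (2 * length w + 3 + (?B + 1)) (conf_at w Acc (\<lambda>_. 0) 0)"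
      using od False by auto
    then have "tm_run M w (n w) = conf_at w Acc (\<lambda>_. 0) 0"
      by (rule run_from_takes) (use bound in auto)
    then show ?thesis using False by auto
  qed
qed

text \<open>A tuple satisfying \<open>F\<close> is a certificate against the input: the machine
  rejects when the sweep meets one and accepts otherwise. With \<open>r\<close> fixed there are
  polynomially many tuples, and each costs one scan.\<close>

lemma promise_P_I:
  assumes "\<And>w c. w \<in> Yes \<Longrightarrow> (\<And>i. i < r \<Longrightarrow> c i \<le> length w) \<Longrightarrow> \<not> F (scan \<delta> s0 r w c (length w))"
    and "\<And>w. w \<in> No \<Longrightarrow> \<exists>c. (\<forall>i<r. c i \<le> length w) \<and> F (scan \<delta> s0 r w c (length w))"
  shows "(Yes, No) \<in> promise_P"
proof -
  define p :: "nat poly" where "p = [:8, 2:] ^ (r + 2)"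
  have p: "poly p (length w) = (2 * length w + 8) ^ (r + 2)" for w :: "bool list"
    by (simp add: p_def poly_power algebra_simps)
  show ?thesis unfolding promise_P_def
  proof (clarsimp, intro exI[of _ M] exI[of _ p] conjI allI ballI wf_M)
    fix w
    obtain T P where "tm_run M w (poly p (length w)) =
        conf (if \<exists>c. (\<forall>i<r. c i \<le> length w) \<and> found w c then Rej else Acc) T P"
      using decides[of w] unfolding p by blast
    then show "halted M (tm_run M w (poly p (length w)))"
      by (simp only: halted_def conf_def M_def fst_conv turing_machine.simps split: if_split) blast
  next
    fix w assume "w \<in> Yes"
    then have ex: "\<not> (\<exists>c. (\<forall>i<r. c i \<le> length w) \<and> found w c)"
      using assms(1)[of w] by (auto simp: found_def)
    obtain T P where "tm_run M w (poly p (length w)) = conf Acc T P"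
      using decides[of w] unfolding p if_not_P[OF ex] by blast
    then show "fst (tm_run M w (poly p (length w))) = accept_state M"
      by (simp add: conf_def M_def)
  next
    fix w assume "w \<in> No"
    then have ex: "\<exists>c. (\<forall>i<r. c i \<le> length w) \<and> found w c"
      using assms(2)[of w] by (simp add: found_def)
    obtain T P where "tm_run M w (poly p (length w)) = conf Rej T P"
      using decides[of w] unfolding p if_P[OF ex] by blast
    then show "fst (tm_run M w (poly p (length w))) = reject_state M"
      by (simp add: conf_def M_def)
  qed
qed

end


section \<open>Predicates decided by one scan\<close>

text \<open>Finite automata over the letters of a scan. All predicates that are to be combined share
  the same \<open>r\<close> marks, so their automata can run side by side on one scan.\<close>

definition scan_regular :: "nat \<Rightarrow> (bool list \<Rightarrow> (nat \<Rightarrow> nat) \<Rightarrow> bool) \<Rightarrow> bool" where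
  "scan_regular r P \<longleftrightarrow> (\<exists>(N :: nat) \<delta> s0 F. s0 < N \<and> (\<forall>s<N. \<forall>l. \<delta> s l < N) \<and>
     (\<forall>w c. P w c = F (scan \<delta> s0 r w c (length w))))"

lemma scan_regularI:
  fixes \<delta> :: "'s \<Rightarrow> (nat \<Rightarrow> nat) \<Rightarrow> 's"
  assumes "finite Q" "s0 \<in> Q" "\<And>s l. s \<in> Q \<Longrightarrow> \<delta> s l \<in> Q"
    and P: "\<And>w c. P w c = F (scan \<delta> s0 r w c (length w))"
  shows "scan_regular r P"
proof -
  obtain h where h: "bij_betw h Q {..<card Q}"
    using ex_bij_betw_finite_nat[OF assms(1)] by (auto simp: lessThan_atLeast0)
  define g where "g = inv_into Q h"
  have gh: "g (h s) = s" "h s < card Q" if "s \<in> Q" for s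
    using h that by (auto simp: g_def bij_betw_def inv_into_f_f)
  have gQ: "g n \<in> Q" if "n < card Q" for n
    using h that inv_into_into[of n h Q] by (simp add: g_def bij_betw_def)
  have inQ: "scan \<delta> s0 r w c t \<in> Q" for w c t
    by (induction t) (use assms in auto)
  have "scan (\<lambda>n l. h (\<delta> (g n) l)) (h s0) r w c t = h (scan \<delta> s0 r w c t)" for w c t
    by (induction t) (simp_all add: gh inQ)
  then have "P w c = (F \<circ> g) (scan (\<lambda>n l. h (\<delta> (g n) l)) (h s0) r w c (length w))" for w c
    by (simp add: gh inQ P)
  moreover have "h s0 < card Q" "\<forall>n<card Q. \<forall>l. h (\<delta> (g n) l) < card Q"
    using gh gQ assms by auto
  ultimately show ?thesis unfolding scan_regular_def
    by (intro exI[of _ "card Q"] exI[of _ "\<lambda>n l. h (\<delta> (g n) l)"] exI[of _ "h s0"] exI[of _ "F \<circ> g"])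
      auto
qed

lemma scan_regular_const [simp]: "scan_regular r (\<lambda>w c. b)"
  by (rule scan_regularI[of "{()}" "()" "\<lambda>_ _. ()" _ "\<lambda>_. b"]) auto

lemma scan_regular_not:
  assumes "scan_regular r P"
  shows "scan_regular r (\<lambda>w c. \<not> P w c)"
proof -
  obtain N :: nat and \<delta> s0 F where *: "s0 < N" "\<forall>s<N. \<forall>l. \<delta> s l < N"
    "\<forall>w c. P w c = F (scan \<delta> s0 r w c (length w))"
    using assms unfolding scan_regular_def by blast
  show ?thesis by (rule scan_regularI[of "{..<N}" s0 \<delta> _ "\<lambda>s. \<not> F s"]) (use * in auto)
qed

lemma scan_regular_conj:
  assumes "scan_regular r P1" "scan_regular r P2"
  shows "scan_regular r (\<lambda>w c. P1 w c \<and> P2 w c)"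
proof -
  obtain N1 :: nat and \<delta>1 s1 F1 where 1: "s1 < N1" "\<forall>s<N1. \<forall>l. \<delta>1 s l < N1"
    "\<forall>w c. P1 w c = F1 (scan \<delta>1 s1 r w c (length w))"
    using assms(1) unfolding scan_regular_def by blast
  obtain N2 :: nat and \<delta>2 s2 F2 where 2: "s2 < N2" "\<forall>s<N2. \<forall>l. \<delta>2 s l < N2"
    "\<forall>w c. P2 w c = F2 (scan \<delta>2 s2 r w c (length w))"
    using assms(2) unfolding scan_regular_def by blast
  let ?\<delta> = "\<lambda>(s, s') l. (\<delta>1 s l, \<delta>2 s' l)"
  have "scan ?\<delta> (s1, s2) r w c t = (scan \<delta>1 s1 r w c t, scan \<delta>2 s2 r w c t)" for w c t
    by (induction t) auto
  then show ?thesis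
    by (intro scan_regularI[of "{..<N1} \<times> {..<N2}" "(s1, s2)" ?\<delta> _ "\<lambda>(s, s'). F1 s \<and> F2 s'"])
      (use 1 2 in auto)
qed

lemma scan_regular_disj:
  assumes "scan_regular r P1" "scan_regular r P2"
  shows "scan_regular r (\<lambda>w c. P1 w c \<or> P2 w c)"
  using scan_regular_not[OF scan_regular_conj[OF scan_regular_not[OF assms(1)] scan_regular_not[OF assms(2)]]]
  by simp

text \<open>Case distinction on one predicate after the other. As \<open>G\<close> is arbitrary, a
  criterion that depends on finitely many tests needs no automaton of its own, however complicated
  it is.\<close>

lemma scan_regular_boolean:
  assumes "finite X" "\<And>x. x \<in> X \<Longrightarrow> scan_regular r (P x)"
  shows "scan_regular r (\<lambda>w c. G {x \<in> X. P x w c})"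
  using assms
proof (induction X arbitrary: G)
  case (insert x X)
  have "{y \<in> insert x X. P y w c} =
    (if P x w c then insert x {y \<in> X. P y w c} else {y \<in> X. P y w c})" for w c
    using insert.hyps by auto
  then have eq: "(\<lambda>w c. G {y \<in> insert x X. P y w c}) = (\<lambda>w c. P x w c \<and> G (insert x {y \<in> X. P y w c}) \<or>
      \<not> P x w c \<and> G {y \<in> X. P y w c})"
    by (auto simp: fun_eq_iff)
  have "scan_regular r (\<lambda>w c. P x w c \<and> G (insert x {y \<in> X. P y w c}) \<or> \<not> P x w c \<and> G {y \<in> X. P y w c})"
    using insert by (intro scan_regular_disj scan_regular_conj scan_regular_not
        insert.IH[of "\<lambda>Y. G (insert x Y)"] insert.IH[of G]) auto
  then show ?case unfolding eq .
qed simp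

lemma scan_regular_promise_P:
  assumes "scan_regular r P"
    and "\<And>w c. w \<in> Yes \<Longrightarrow> (\<And>i. i < r \<Longrightarrow> c i \<le> length w) \<Longrightarrow> \<not> P w c"
    and "\<And>w. w \<in> No \<Longrightarrow> \<exists>c. (\<forall>i<r. c i \<le> length w) \<and> P w c"
  shows "(Yes, No) \<in> promise_P"
proof -
  obtain N :: nat and \<delta> s0 F where *: "s0 < N" "\<forall>s<N. \<forall>l. \<delta> s l < N"
    "\<forall>w c. P w c = F (scan \<delta> s0 r w c (length w))"
    using assms(1) unfolding scan_regular_def by blast
  interpret scanner r N \<delta> s0 F by standard (use * in auto)
  show ?thesis by (rule promise_P_I) (use assms * in auto)
qed


section \<open>Reading and comparing items at marked positions\<close>

definition starts_at :: "bool list \<Rightarrow> nat \<Rightarrow> bool list \<Rightarrow> bool" where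
  "starts_at w p u \<longleftrightarrow> (\<exists>v. drop p w = u @ v)"

lemma starts_at_cell:
  assumes "starts_at w p u" "t < length u"
  shows "cell w (p + t) = (if u ! t then 2 else 1)"
proof -
  obtain v where v: "drop p w = u @ v" using assms by (auto simp: starts_at_def)
  then have "length u + length v = length w - p" by (metis length_append length_drop)
  then have "p + t < length w" "drop p w ! t = u ! t" using assms(2) v by (auto simp: nth_append)
  then show ?thesis by (simp add: cell_def)
qed

lemma starts_at_length:
  assumes "starts_at w p u"
  shows "length u \<le> length w"
proof -
  obtain v where "drop p w = u @ v" using assms by (auto simp: starts_at_def)
  then have "length u + length v = length w - p" by (metis length_append length_drop)
  then show ?thesis by simp
qed

definition bit_at :: "nat \<Rightarrow> bool list \<Rightarrow> (nat \<Rightarrow> nat) \<Rightarrow> bool" where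
  "bit_at i w c \<longleftrightarrow> cell w (c i) = 2"

lemma scan_regular_bit_at:
  assumes "i < r"
  shows "scan_regular r (bit_at i)"
proof -
  let ?\<delta> = "\<lambda>s l. if s = None then Some (l (Suc i) = 2) else s"
  have "scan ?\<delta> None r w c (Suc t) = Some (cell w (c i) = 2)" for w c t
    by (induction t) (use assms in \<open>auto simp: letter_def\<close>)
  then have "bit_at i w c = (scan ?\<delta> None r w c (length w) = Some True)" for w c
    by (cases "length w") (auto simp: bit_at_def cell_def simp del: scan.simps(2))
  then show ?thesis
    by (intro scan_regularI[of UNIV None ?\<delta> _ "\<lambda>s. s = Some True"]) auto
qed

text \<open>Both heads run through their blocks of True in lockstep, and \<open>None\<close> means
  that neither block has ended. The first time at which not both read True decides.\<close>

definition eq_step :: "nat \<Rightarrow> nat \<Rightarrow> bool option \<Rightarrow> (nat \<Rightarrow> nat) \<Rightarrow> bool option" where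
  "eq_step i j s l = (if s \<noteq> None then s
     else if l (Suc i) = 2 \<and> l (Suc j) = 2 then None
     else Some (l (Suc i) = l (Suc j)))"

definition same_unary :: "nat \<Rightarrow> nat \<Rightarrow> nat \<Rightarrow> bool list \<Rightarrow> (nat \<Rightarrow> nat) \<Rightarrow> bool" where
  "same_unary r i j w c \<longleftrightarrow> scan (eq_step i j) None r w c (length w) = Some True"

lemma scan_regular_same_unary: "scan_regular r (same_unary r i j)"
  by (rule scan_regularI[of UNIV None "eq_step i j" _ "\<lambda>s. s = Some True"]) (auto simp: same_unary_def)

lemma encode_unary_nth: "t \<le> u \<Longrightarrow> encode_unary u ! t \<longleftrightarrow> t < u"
  by (auto simp: encode_unary_def nth_append)

lemma length_encode_unary: "length (encode_unary u) = Suc u"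
  by (simp add: encode_unary_def)

lemma same_unary_iff:
  assumes "i < r" "j < r" "starts_at w (c i) (encode_unary u)" "starts_at w (c j) (encode_unary v)"
  shows "same_unary r i j w c \<longleftrightarrow> u = v"
proof -
  let ?s = "scan (eq_step i j) None r w c"
  have i: "letter r w c t (Suc i) = (if t < u then 2 else 1)" if "t \<le> u" for t
    using assms starts_at_cell[of w "c i" "encode_unary u" t] that
    by (simp add: letter_def length_encode_unary encode_unary_nth)
  have j: "letter r w c t (Suc j) = (if t < v then 2 else 1)" if "t \<le> v" for t
    using assms starts_at_cell[of w "c j" "encode_unary v" t] that
    by (simp add: letter_def length_encode_unary encode_unary_nth)
  have step: "?s (Suc t) = (if ?s t \<noteq> None then ?s t
      else if letter r w c t (Suc i) = 2 \<and> letter r w c t (Suc j) = 2 then None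
      else Some (letter r w c t (Suc i) = letter r w c t (Suc j)))" for t
    by (simp add: eq_step_def)
  have run: "?s t = None" if "t \<le> min u v" for t
    using that by (induction t) (auto simp: i j step simp del: scan.simps(2))
  have stop: "?s (Suc (min u v)) = Some (u = v)"
    by (subst step, subst run[OF order_refl], cases u v rule: linorder_cases) (auto simp: i j)
  have "?s (Suc (min u v) + t) = Some (u = v)" for t
  proof (induction t)
    case (Suc t)
    then show ?case using step[of "Suc (min u v) + t"] by simp
  qed (use stop in simp)
  moreover have "Suc (min u v) \<le> length w"
    using starts_at_length[OF assms(3)] by (simp add: length_encode_unary)
  ultimately have "?s (length w) = Some (u = v)" by (metis le_add_diff_inverse)
  then show ?thesis by (simp add: same_unary_def)
qed


lemma binary_digits_0 [simp]: "binary_digits 0 = []"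
  by (simp add: binary_digits.simps)

lemma binary_digits_nth: "s < length (binary_digits n) \<Longrightarrow> binary_digits n ! s \<longleftrightarrow> odd (n div 2 ^ s)"
proof (induction n arbitrary: s rule: binary_digits.induct)
  case (1 n)
  then have "n \<noteq> 0" by (cases "n = 0") auto
  then have "binary_digits n = odd n # binary_digits (n div 2)" by (subst binary_digits.simps) simp
  then show ?case using 1 \<open>n \<noteq> 0\<close> by (cases s) (auto simp: div_mult2_eq)
qed

lemma less_power_length_binary_digits:
  assumes "length (binary_digits n) \<le> s"
  shows "n < 2 ^ s"
proof -
  have "n < 2 ^ length (binary_digits n)"
  proof (induction n rule: binary_digits.induct)
    case (1 n)
    show ?case
    proof (cases "n = 0")
      case False
      then have "binary_digits n = odd n # binary_digits (n div 2)" by (subst binary_digits.simps) simp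
      then show ?thesis using 1 False by simp
    qed simp
  qed
  also have "(2 :: nat) ^ length (binary_digits n) \<le> 2 ^ s"
    by (rule power_increasing) (use assms in auto)
  finally show ?thesis .
qed

lemma length_encode_binary: "length (encode_binary n) = Suc (2 * length (binary_digits n))"
proof -
  have "length (concat (map (\<lambda>b. [True, b]) bs)) = 2 * length bs" for bs :: "bool list"
    by (induction bs) auto
  then show ?thesis by (simp add: encode_binary_def)
qed

lemma encode_binary_nth:
  defines "l n \<equiv> length (binary_digits n)"
  shows "s \<le> l n \<Longrightarrow> encode_binary n ! (2 * s) \<longleftrightarrow> s < l n"
    and "s < l n \<Longrightarrow> encode_binary n ! Suc (2 * s) \<longleftrightarrow> odd (n div 2 ^ s)"
proof -
  have *: "s < length bs \<Longrightarrow> concat (map (\<lambda>b. [True, b]) bs) ! (2 * s) \<and>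
      concat (map (\<lambda>b. [True, b]) bs) ! Suc (2 * s) = bs ! s" for bs s
  proof (induction bs arbitrary: s)
    case (Cons b bs)
    then show ?case by (cases s) auto
  qed simp
  have len: "length (concat (map (\<lambda>b. [True, b]) (binary_digits n))) = 2 * l n"
    using length_encode_binary[of n] by (simp add: encode_binary_def l_def)
  show "s \<le> l n \<Longrightarrow> encode_binary n ! (2 * s) \<longleftrightarrow> s < l n"
    using * len by (auto simp: encode_binary_def nth_append l_def)
  show "s < l n \<Longrightarrow> encode_binary n ! Suc (2 * s) \<longleftrightarrow> odd (n div 2 ^ s)"
    using * len by (auto simp: encode_binary_def nth_append l_def binary_digits_nth)
qed

text \<open>Subtraction of \<open>J * b\<close> from \<open>K * a\<close>, low bits first. After
  \<open>s\<close> digits \<open>z\<close> is the floor of the partial difference divided by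
  \<open>2 ^ s\<close>; this carry never leaves the interval from \<open>-J\<close> to
  \<open>K\<close>, so finitely many states suffice. Even times read markers, odd times digits. A
  number that has ended contributes zeros: its flag stays set while its head moves on over unrelated
  bits.\<close>

definition geq_step :: "nat \<Rightarrow> nat \<Rightarrow> int \<Rightarrow> int \<Rightarrow> bool \<times> bool \<times> bool \<times> int \<Rightarrow> (nat \<Rightarrow> nat) \<Rightarrow> bool \<times> bool \<times> bool \<times> int" where
  "geq_step i j K J s l = (case s of (odd_time, end_i, end_j, z) \<Rightarrow>
     if odd_time then (False, end_i, end_j,
       (z + K * of_bool (\<not> end_i \<and> l (Suc i) = 2) - J * of_bool (\<not> end_j \<and> l (Suc j) = 2)) div 2)
     else (True, end_i \<or> l (Suc i) = 1, end_j \<or> l (Suc j) = 1, z))"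

definition geq_scaled :: "nat \<Rightarrow> nat \<Rightarrow> nat \<Rightarrow> int \<Rightarrow> int \<Rightarrow> bool list \<Rightarrow> (nat \<Rightarrow> nat) \<Rightarrow> bool" where
  "geq_scaled r i j K J w c \<longleftrightarrow>
     0 \<le> snd (snd (snd (scan (geq_step i j K J) (False, False, False, 0) r w c (length w))))"

lemma scan_regular_geq_scaled:
  assumes "0 \<le> K" "0 \<le> J"
  shows "scan_regular r (geq_scaled r i j K J)"
proof (rule scan_regularI[of "UNIV \<times> UNIV \<times> UNIV \<times> {-J..K}" "(False, False, False, 0)"
      "geq_step i j K J" _ "\<lambda>s. 0 \<le> snd (snd (snd s))"])
  fix s l assume "s \<in> (UNIV :: bool set) \<times> (UNIV :: bool set) \<times> (UNIV :: bool set) \<times> {-J..K}"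
  then show "geq_step i j K J s l \<in> UNIV \<times> UNIV \<times> UNIV \<times> {-J..K}"
    using assms by (cases s) (auto simp: geq_step_def of_bool_def)
qed (use assms in \<open>auto simp: geq_scaled_def\<close>)

text \<open>One more digit adds a multiple of \<open>2 ^ s\<close> to the partial difference, and
  nested floor divisions compose; so nothing but the carry has to be remembered of the earlier
  digits.\<close>

lemma carry_step:
  fixes a b s :: nat and K J :: int
  defines "Z \<equiv> \<lambda>s. (K * int (a mod 2 ^ s) - J * int (b mod 2 ^ s)) div 2 ^ s"
  shows "(Z s + K * of_bool (odd (a div 2 ^ s)) - J * of_bool (odd (b div 2 ^ s))) div 2 = Z (Suc s)"
proof -
  have m: "int (n mod 2 ^ Suc s) = int (n mod 2 ^ s) + 2 ^ s * of_bool (odd (n div 2 ^ s))" for n :: nat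
    using mod_mult2_eq[of n "2 ^ s" 2] by (simp add: mult.commute mod2_eq_if)
  let ?X = "K * int (a mod 2 ^ s) - J * int (b mod 2 ^ s)"
  let ?y = "K * of_bool (odd (a div 2 ^ s)) - J * of_bool (odd (b div 2 ^ s))"
  have "Z (Suc s) = (?X + ?y * 2 ^ s) div (2 ^ s * 2)"
    unfolding Z_def m by (simp add: algebra_simps)
  also have "\<dots> = (?X + ?y * 2 ^ s) div 2 ^ s div 2"
    by (rule zdiv_zmult2_eq) simp
  also have "(?X + ?y * 2 ^ s) div 2 ^ s = Z s + ?y" by (simp add: Z_def)
  finally show ?thesis by (simp add: algebra_simps)
qed

lemma geq_scaled_iff:
  assumes "i < r" "j < r" "starts_at w (c i) (encode_binary a)" "starts_at w (c j) (encode_binary b)"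
  shows "geq_scaled r i j K J w c \<longleftrightarrow> J * int b \<le> K * int a"
proof -
  define l where "l n = length (binary_digits n)" for n
  define Z where "Z s = (K * int (a mod 2 ^ s) - J * int (b mod 2 ^ s)) div 2 ^ s" for s :: nat
  let ?s = "scan (geq_step i j K J) (False, False, False, 0) r w c"
  have marker: "s \<le> l n \<Longrightarrow> cell w (c i + 2 * s) = (if s < l n then 2 else 1)"
    and digit: "s < l n \<Longrightarrow> cell w (c i + Suc (2 * s)) = (if odd (n div 2 ^ s) then 2 else 1)"
    if "starts_at w (c i) (encode_binary n)" for n i s
    using starts_at_cell[OF that, of "2 * s"] starts_at_cell[OF that, of "Suc (2 * s)"]
    by (auto simp: length_encode_binary encode_binary_nth l_def)
  have zero: "\<not> odd (n div 2 ^ s)" if "l n \<le> s" for n s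
  proof -
    have "n < 2 ^ s" using less_power_length_binary_digits that unfolding l_def by blast
    then show ?thesis by simp
  qed
  have let_i: "letter r w c t (Suc i) = cell w (c i + t)" and let_j: "letter r w c t (Suc j) = cell w (c j + t)" for t
    using assms by (auto simp: letter_def)
  \<comment> \<open>The closing False of a number with \<open>l a\<close> digits has offset
    \<open>2 * l a\<close>, so the marker read at time \<open>2 * s\<close> turns
    \<open>l a < s\<close> into \<open>l a \<le> s\<close>.\<close>
  have odd_step: "?s (Suc (2 * s)) = (True, l a \<le> s, l b \<le> s, Z s)"
    if "?s (2 * s) = (False, l a < s, l b < s, Z s)" for s
  proof -
    have "(l a < s \<or> cell w (c i + 2 * s) = 1) = (l a \<le> s)"
      using marker[OF assms(3), of s] by (cases s "l a" rule: linorder_cases) auto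
    moreover have "(l b < s \<or> cell w (c j + 2 * s) = 1) = (l b \<le> s)"
      using marker[OF assms(4), of s] by (cases s "l b" rule: linorder_cases) auto
    ultimately show ?thesis using that by (simp add: geq_step_def let_i let_j)
  qed
  have even: "?s (2 * s) = (False, l a < s, l b < s, Z s)" for s
  proof (induction s)
    case 0
    then show ?case by (simp add: Z_def)
  next
    case (Suc s)
    have da: "(\<not> l a \<le> s \<and> cell w (c i + Suc (2 * s)) = 2) = odd (a div 2 ^ s)"
      using digit[OF assms(3), of s] zero[of a s] by (cases "l a \<le> s") (auto simp: not_le split: if_splits)
    have db: "(\<not> l b \<le> s \<and> cell w (c j + Suc (2 * s)) = 2) = odd (b div 2 ^ s)"
      using digit[OF assms(4), of s] zero[of b s] by (cases "l b \<le> s") (auto simp: not_le split: if_splits)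
    have st: "?s (2 * Suc s) = geq_step i j K J (True, l a \<le> s, l b \<le> s, Z s) (letter r w c (Suc (2 * s)))"
      using odd_step[OF Suc] by simp
    have "\<dots> = (False, l a < Suc s, l b < Suc s, Z (Suc s))"
      unfolding geq_step_def prod.case if_True let_i let_j da db
      using carry_step[of K a s J b] by (simp only: Z_def less_Suc_eq_le)
    with st show ?case by (rule trans)
  qed
  \<comment> \<open>A code with \<open>l\<close> digits has \<open>2 * l + 1\<close> bits and fits
    into the input, so by then all digits are processed. The remaining floor is nonnegative exactly
    if the whole difference is.\<close>
  define s where "s = length w div 2"
  have "length w = 2 * s \<or> length w = Suc (2 * s)" unfolding s_def by presburger
  then have "snd (snd (snd (?s (length w)))) = Z s"
    using even[of s] odd_step[OF even, of s] by (elim disjE) (simp_all only: snd_conv)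
  moreover have "l a \<le> s" "l b \<le> s"
    using starts_at_length[OF assms(3)] starts_at_length[OF assms(4)]
    by (auto simp: length_encode_binary l_def s_def)
  then have "a < 2 ^ s" "b < 2 ^ s"
    using less_power_length_binary_digits unfolding l_def by blast+
  then have "Z s = (K * int a - J * int b) div 2 ^ s" by (simp add: Z_def)
  ultimately show ?thesis
    by (simp add: geq_scaled_def pos_imp_zdiv_nonneg_iff)
qed


section \<open>Parsing an encoded instance\<close>

datatype item = Unary | Bit | Binary

fun is_item :: "item \<Rightarrow> bool list \<Rightarrow> bool" where
  "is_item Unary u \<longleftrightarrow> (\<exists>n. u = encode_unary n)"
| "is_item Bit u \<longleftrightarrow> length u = 1"
| "is_item Binary u \<longleftrightarrow> (\<exists>n. u = encode_binary n)"

text \<open>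
  The second component of a parser state is 0 exactly at the first bit of an item. The first
  component is the index of the current item; it runs through 0 and 1 (the header) and then cycles
  through the \<open>C\<close> items of a term, which have the indices 2 to \<open>C + 1\<close>.
\<close>

locale parser =
  fixes C :: nat and kind :: "nat \<Rightarrow> item"
  assumes C: "0 < C"
begin

definition index :: "nat \<Rightarrow> nat" where
  "index g = (if g < 2 then g else 2 + (g - 2) mod C)"

definition succ_index :: "nat \<Rightarrow> nat" where
  "succ_index e = index (Suc e)"

definition item_kind :: "nat \<Rightarrow> item" where
  "item_kind e = (if e < 2 then Unary else kind (e - 2))"

text \<open>Within a binary number 1 announces a digit and 2 a marker; 0 acts like 2 there but is
  reserved for the first bit.\<close>

fun parse :: "nat \<times> nat \<Rightarrow> bool \<Rightarrow> nat \<times> nat" where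
  "parse (e, p) b =
    (case item_kind e of
       Unary \<Rightarrow> if b then (e, 1) else (succ_index e, 0)
     | Bit \<Rightarrow> (succ_index e, 0)
     | Binary \<Rightarrow> if p = 1 then (e, 2) else if b then (e, 1) else (succ_index e, 0))"

lemma parse_unary:
  assumes "item_kind e = Unary"
  shows "foldl parse (e, p) (encode_unary n) = (succ_index e, 0)"
    and "0 < t \<Longrightarrow> t \<le> n \<Longrightarrow> foldl parse (e, p) (take t (encode_unary n)) = (e, 1)"
proof -
  have *: "foldl parse (e, p) (replicate n True) = (e, if n = 0 then p else 1)" for n p
    by (induction n arbitrary: p) (auto simp: assms)
  show "foldl parse (e, p) (encode_unary n) = (succ_index e, 0)"
    by (simp add: encode_unary_def * assms)
  show "0 < t \<Longrightarrow> t \<le> n \<Longrightarrow> foldl parse (e, p) (take t (encode_unary n)) = (e, 1)"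
    by (simp add: encode_unary_def *)
qed

lemma parse_binary:
  assumes "item_kind e = Binary" "p \<noteq> 1"
  defines "enc \<equiv> \<lambda>bs. concat (map (\<lambda>b. [True, b]) bs) @ [False]"
  shows "foldl parse (e, p) (enc bs) = (succ_index e, 0)"
    and "0 < t \<Longrightarrow> t < length (enc bs) \<Longrightarrow> snd (foldl parse (e, p) (take t (enc bs))) \<noteq> 0"
proof -
  show "foldl parse (e, p) (enc bs) = (succ_index e, 0)"
    using assms(2) by (induction bs arbitrary: p) (auto simp: assms(1) enc_def)
  show "0 < t \<Longrightarrow> t < length (enc bs) \<Longrightarrow> snd (foldl parse (e, p) (take t (enc bs))) \<noteq> 0"
    using assms(2)
  proof (induction bs arbitrary: p t)
    case Nil
    then show ?case by (simp add: enc_def)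
  next
    case (Cons b bs)
    have enc: "enc (b # bs) = True # b # enc bs" by (simp add: enc_def)
    consider "t = 1" | "t = 2" | t' where "t = Suc (Suc t')" "0 < t'"
      using Cons.prems(1) by (metis One_nat_def Suc_1 gr0_conv_Suc not0_implies_Suc)
    then show ?case
    proof cases
      case 3
      then have "snd (foldl parse (e, 2) (take t' (enc bs))) \<noteq> 0"
        using Cons.prems enc by (intro Cons.IH) auto
      then show ?thesis using 3 enc assms(1) Cons.prems by simp
    qed (use enc assms(1) Cons.prems in \<open>auto simp: numeral_2_eq_2\<close>)
  qed
qed

lemma parse_item:
  assumes "is_item (item_kind e) u"
  shows "foldl parse (e, 0) u = (succ_index e, 0)"
    and "0 < t \<Longrightarrow> t < length u \<Longrightarrow> snd (foldl parse (e, 0) (take t u)) \<noteq> 0"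
    and "u \<noteq> []"
proof -
  consider n where "item_kind e = Unary" "u = encode_unary n" | b where "item_kind e = Bit" "u = [b]"
    | n where "item_kind e = Binary" "u = encode_binary n"
    using assms by (cases "item_kind e") (auto simp: length_Suc_conv)
  then have "foldl parse (e, 0) u = (succ_index e, 0) \<and> u \<noteq> [] \<and>
    (0 < t \<longrightarrow> t < length u \<longrightarrow> snd (foldl parse (e, 0) (take t u)) \<noteq> 0)"
  proof cases
    case 1
    have "encode_unary n \<noteq> []" by (simp add: encode_unary_def)
    then show ?thesis using parse_unary(1)[OF 1(1), of 0 n] parse_unary(2)[OF 1(1), of t n 0] 1
      by (simp add: length_encode_unary)
  next
    case 2
    then show ?thesis by auto
  next
    case 3
    then show ?thesis
      using parse_binary(1)[OF 3(1), of 0 "binary_digits n"] parse_binary(2)[OF 3(1), of 0 t "binary_digits n"]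
      by (simp add: encode_binary_def)
  qed
  then show "foldl parse (e, 0) u = (succ_index e, 0)" "u \<noteq> []"
    "0 < t \<Longrightarrow> t < length u \<Longrightarrow> snd (foldl parse (e, 0) (take t u)) \<noteq> 0" by auto
qed

lemma succ_index_index: "succ_index (index g) = index (Suc g)"
proof (cases "g < 2")
  case False
  then obtain h where g: "g = 2 + h" by (metis le_add_diff_inverse not_less)
  have "Suc (h mod C) mod C = Suc h mod C" by (rule mod_Suc_eq)
  then show ?thesis by (simp add: succ_index_def index_def g)
qed (simp add: succ_index_def index_def)

lemma index_less: "index g < C + 2"
  using C by (simp add: index_def)

text \<open>
  The first Boolean records whether the current term starts at mark \<open>i0\<close>, the second whether item
  \<open>j\<close> of such a term has been seen to start at mark \<open>i\<close>.
\<close>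

definition mark_step ::
    "nat \<Rightarrow> nat \<Rightarrow> nat \<Rightarrow> nat \<Rightarrow> (nat \<times> nat) \<times> bool \<times> bool \<Rightarrow> (nat \<Rightarrow> nat) \<Rightarrow> (nat \<times> nat) \<times> bool \<times> bool" where
  "mark_step r i0 i j s l = (case s of (st, b, f) \<Rightarrow>
     let b' = (if st = (2, 0) then l (Suc (r + i0)) = 1 else b) in
     (parse st (l 0 = 2), b', f \<or> st = (2 + j, 0) \<and> b' \<and> l (Suc (r + i)) = 1))"

definition marked :: "nat \<Rightarrow> nat \<Rightarrow> nat \<Rightarrow> nat \<Rightarrow> bool list \<Rightarrow> (nat \<Rightarrow> nat) \<Rightarrow> bool" where
  "marked r i0 i j w c \<longleftrightarrow> snd (snd (scan (mark_step r i0 i j) ((0, 0), False, False) r w c (length w)))"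

lemma parse_range: "st \<in> {..<C + 2} \<times> {..<3} \<Longrightarrow> parse st b \<in> {..<C + 2} \<times> {..<3}"
  using index_less by (cases st) (auto split: item.splits simp: succ_index_def)

lemma scan_regular_marked: "scan_regular r (marked r i0 i j)"
proof (rule scan_regularI[of "({..<C + 2} \<times> {..<3}) \<times> UNIV \<times> UNIV" "((0, 0), False, False)"
      "mark_step r i0 i j" _ "\<lambda>s. snd (snd s)"])
  fix s :: "(nat \<times> nat) \<times> bool \<times> bool" and l :: "nat \<Rightarrow> nat"
  assume "s \<in> ({..<C + 2} \<times> {..<3}) \<times> (UNIV :: bool set) \<times> (UNIV :: bool set)"
  then obtain st b f where "s = (st, b, f)" "st \<in> {..<C + 2} \<times> {..<3}" by auto
  then show "mark_step r i0 i j s l \<in> ({..<C + 2} \<times> {..<3}) \<times> UNIV \<times> UNIV"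
    using parse_range by (simp add: mark_step_def Let_def del: parse.simps)
qed (auto simp: marked_def)

definition parse_at :: "bool list \<Rightarrow> nat \<Rightarrow> nat \<times> nat" where
  "parse_at w t = foldl parse (0, 0) (take t w)"

text \<open>The flag for \<open>i0\<close> is renewed at every term start, so it speaks about the
  latest one. It is renewed before the test for item \<open>j\<close>, which lets item 0 of a term
  see the mark on its own first bit.\<close>

lemma marked_iff_parse:
  assumes "i0 < r" "i < r"
  shows "marked r i0 i j w c \<longleftrightarrow> (\<exists>t<length w. c i = t \<and> parse_at w t = (2 + j, 0) \<and>
    (\<exists>t'\<le>t. c i0 = t' \<and> parse_at w t' = (2, 0) \<and> (\<forall>t''. t' < t'' \<and> t'' \<le> t \<longrightarrow> parse_at w t'' \<noteq> (2, 0))))"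
proof -
  let ?s = "scan (mark_step r i0 i j) ((0, 0), False, False) r w c"
  define b where "b t \<longleftrightarrow> (\<exists>t'<t. c i0 = t' \<and> parse_at w t' = (2, 0) \<and> (\<forall>t''. t' < t'' \<and> t'' < t \<longrightarrow> parse_at w t'' \<noteq> (2, 0)))" for t
  define f where "f t \<longleftrightarrow> (\<exists>u<t. c i = u \<and> parse_at w u = (2 + j, 0) \<and> b (Suc u))" for t
  have bS: "b (Suc t) = (if parse_at w t = (2, 0) then c i0 = t else b t)" for t
    by (auto simp: b_def less_Suc_eq)
  have let0: "(letter r w c t 0 = 2) = w ! t" if "t < length w" for t
    using that by (simp add: letter_def cell_def)
  have let_mark: "(letter r w c t (Suc (r + i)) = 1) = (c i = t)" if "i < r" for t i
    using that by (simp add: letter_def)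
  have "?s t = (parse_at w t, b t, f t)" if "t \<le> length w" for t
    using that
  proof (induction t)
    case 0
    then show ?case by (simp add: parse_at_def b_def f_def)
  next
    case (Suc t)
    then have st: "?s (Suc t) = mark_step r i0 i j (parse_at w t, b t, f t) (letter r w c t)" by simp
    have p: "parse_at w (Suc t) = parse (parse_at w t) (w ! t)"
      using Suc.prems by (simp add: parse_at_def take_Suc_conv_app_nth)
    have fS: "f (Suc t) = (f t \<or> parse_at w t = (2 + j, 0) \<and> b (Suc t) \<and> c i = t)"
      unfolding f_def using less_Suc_eq by blast
    have "mark_step r i0 i j (parse_at w t, b t, f t) (letter r w c t) = (parse_at w (Suc t), b (Suc t), f (Suc t))"
      unfolding mark_step_def prod.case Let_def let0[OF Suc_le_lessD[OF Suc.prems]] let_mark[OF assms(1)]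
        let_mark[OF assms(2)] bS[symmetric] p fS ..
    then show ?case unfolding st .
  qed
  from this[of "length w"] show ?thesis 
    by (simp add: marked_def f_def b_def less_Suc_eq_le)
qed

section \<open>Positions of the items in an encoded word\<close>

context
  fixes str :: "nat \<Rightarrow> bool list" and G :: nat and w :: "bool list"
  assumes items: "\<And>g. g < G \<Longrightarrow> is_item (item_kind (index g)) (str g)"
    and w: "w = concat (map str [0..<G])"
begin

definition start :: "nat \<Rightarrow> nat" where
  "start g = length (concat (map str [0..<g]))"

lemma start_Suc: "start (Suc g) = start g + length (str g)"
  by (simp add: start_def)

lemma word_split:
  assumes "g < G"
  shows "w = concat (map str [0..<g]) @ str g @ concat (map str [Suc g..<G])"
proof -
  have "[0..<G] = [0..<g] @ [g..<G]" using assms upt_add_eq_append[of 0 g "G - g"] by simp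
  then show ?thesis using assms by (simp add: w upt_conv_Cons)
qed

lemma starts_at_start: "g < G \<Longrightarrow> starts_at w (start g) (str g)"
  unfolding starts_at_def by (subst word_split) (auto simp: start_def)

lemma start_less: "g < G \<Longrightarrow> start g < start (Suc g)"
  using parse_item(3)[OF items] by (simp add: start_Suc)

lemma start_mono: "g < g' \<Longrightarrow> g' \<le> G \<Longrightarrow> start g < start g'"
proof (induction g')
  case (Suc g')
  then show ?case using start_less[of g'] by (cases "g = g'") auto
qed simp

lemma start_G: "start G = length w"
  by (simp add: start_def w)

lemma parse_within:
  assumes "g < G" "t \<le> length (str g)"
  shows "parse_at w (start g + t) = foldl parse (parse_at w (start g)) (take t (str g))"
  unfolding parse_at_def by (subst (1 2) word_split[OF assms(1)]) (use assms in \<open>simp add: start_def\<close>)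

lemma parse_start: "g \<le> G \<Longrightarrow> parse_at w (start g) = (index g, 0)"
proof (induction g)
  case 0
  then show ?case by (simp add: parse_at_def start_def index_def)
next
  case (Suc g)
  then show ?case
    using parse_within[of g "length (str g)"] parse_item(1)[OF items, of g]
    by (simp add: start_Suc succ_index_index)
qed

text \<open>By \<open>parse_item\<close> the middle of an item never looks like a start, so a mark
  that is misplaced inside an item cannot pass for a correct one.\<close>

lemma parse_fresh:
  assumes "t < length w" "snd (parse_at w t) = 0"
  obtains g where "g < G" "t = start g"
proof -
  have "\<exists>g<G. start g \<le> t \<and> t < start (Suc g)"
  proof -
    have "t < start h \<Longrightarrow> h \<le> G \<Longrightarrow> \<exists>g<h. start g \<le> t \<and> t < start (Suc g)" for h
    proof (induction h)
      case 0
      then show ?case by (simp add: start_def)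
    next
      case (Suc h)
      then show ?case by (cases "t < start h") (auto simp: less_Suc_eq)
    qed
    from this[of G] show ?thesis using assms start_G by simp
  qed
  then obtain g where g: "g < G" "start g \<le> t" "t < start (Suc g)" by blast
  have "t = start g"
  proof (rule ccontr)
    assume "t \<noteq> start g"
    then have t: "0 < t - start g" "t - start g < length (str g)" "t = start g + (t - start g)"
      using g by (auto simp: start_Suc)
    then have "snd (parse_at w t) \<noteq> 0"
      using parse_within[of g "t - start g"] parse_start[of g] parse_item(2)[OF items[OF g(1)] t(1,2)] g
      by simp
    then show False using assms by simp
  qed
  then show ?thesis using g that by blast
qed

text \<open>This ties item \<open>j\<close> to the term marked by \<open>i0\<close>: the start of a
  later term before mark \<open>i\<close> would have renewed the flag, so both marks belong to the
  same \<tau>.\<close>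

lemma marked_iff:
  assumes "i0 < r" "i < r" "j < C" "G = 2 + m * C"
  shows "marked r i0 i j w c \<longleftrightarrow>
    (\<exists>\<tau><m. c i0 = start (2 + \<tau> * C) \<and> c i = start (2 + \<tau> * C + j))"
proof
  assume "marked r i0 i j w c"
  then obtain t t' where t: "t < length w" "c i = t" "parse_at w t = (2 + j, 0)"
    "t' \<le> t" "c i0 = t'" "parse_at w t' = (2, 0)"
    and no: "\<And>t''. t' < t'' \<Longrightarrow> t'' \<le> t \<Longrightarrow> parse_at w t'' \<noteq> (2, 0)"
    unfolding marked_iff_parse[OF assms(1,2)] by blast
  obtain g where g: "g < G" "t = start g" by (rule parse_fresh[of t]) (use t in auto)
  obtain g' where g': "g' < G" "t' = start g'" by (rule parse_fresh[of t']) (use t in auto)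
  have "index g = 2 + j" "index g' = 2" using g g' t parse_start[of g] parse_start[of g'] by auto
  then have ge: "g \<ge> 2" "(g - 2) mod C = j" "g' \<ge> 2" "(g' - 2) mod C = 0"
    by (auto simp: index_def split: if_splits)
  define \<tau> where "\<tau> = (g - 2) div C"
  define \<tau>' where "\<tau>' = (g' - 2) div C"
  have geq: "g = 2 + \<tau> * C + j" "g' = 2 + \<tau>' * C"
    using ge div_mult_mod_eq[of "g - 2" C] div_mult_mod_eq[of "g' - 2" C] by (auto simp: \<tau>_def \<tau>'_def)
  have "g' \<le> g" using start_mono[of g g'] g g' t by (cases "g < g'") auto
  have "\<tau>' = \<tau>"
  proof (rule antisym)
    have "\<tau>' * C < Suc \<tau> * C" using \<open>g' \<le> g\<close> geq assms(3) by simp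
    then show "\<tau>' \<le> \<tau>" using C by (simp only: mult_less_cancel2 less_Suc_eq_le)
  next
    show "\<tau> \<le> \<tau>'"
    proof (rule ccontr)
      assume "\<not> \<tau> \<le> \<tau>'"
      then have lt: "\<tau>' * C < \<tau> * C" using C by simp
      let ?h = "2 + \<tau> * C"
      have h: "g' < ?h" "?h \<le> g" "?h < G" using lt geq g by auto
      then have "t' < start ?h" "start ?h \<le> t"
        using start_mono[of g' ?h] start_mono[of ?h g] g g' by (cases "?h = g"; auto)+
      moreover have "parse_at w (start ?h) = (2, 0)" using parse_start[of ?h] h by (simp add: index_def)
      ultimately show False using no by blast
    qed
  qed
  moreover have "\<tau> < m"
  proof -
    have "\<tau> * C + j < m * C" using g(1) unfolding geq(1) assms(4) by simp
    then have "\<tau> * C < m * C" by (rule add_lessD1)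
    then show ?thesis by (simp only: mult_less_cancel2)
  qed
  ultimately show "\<exists>\<tau><m. c i0 = start (2 + \<tau> * C) \<and> c i = start (2 + \<tau> * C + j)"
    using geq g g' t by auto
next
  assume "\<exists>\<tau><m. c i0 = start (2 + \<tau> * C) \<and> c i = start (2 + \<tau> * C + j)"
  then obtain \<tau> where \<tau>: "\<tau> < m" "c i0 = start (2 + \<tau> * C)" "c i = start (2 + \<tau> * C + j)" by blast
  let ?g' = "2 + \<tau> * C" and ?g = "2 + \<tau> * C + j"
  have "Suc \<tau> * C \<le> m * C" using \<tau>(1) by (intro mult_le_mono1) simp
  then have g: "?g < G" using assms by simp
  have "start ?g < length w" using start_mono[of ?g G] g start_G by simp
  moreover have "parse_at w (start ?g) = (2 + j, 0)"
    using parse_start[of ?g] g assms(3) by (simp add: index_def)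
  moreover have "parse_at w (start ?g') = (2, 0)"
    using parse_start[of ?g'] g by (simp add: index_def)
  moreover have "start ?g' \<le> start ?g" using start_mono[of ?g' ?g] g by (cases "j = 0") auto
  moreover have "parse_at w t \<noteq> (2, 0)" if t: "start ?g' < t" "t \<le> start ?g" for t
  proof
    assume p: "parse_at w t = (2, 0)"
    obtain h where h: "h < G" "t = start h"
      by (rule parse_fresh[of t]) (use p t \<open>start ?g < length w\<close> in auto)
    have "?g' < h" using start_mono[of h ?g'] h t g by (cases h ?g' rule: linorder_cases) auto
    moreover have "h \<le> ?g" using start_mono[of ?g h] h t by (cases "?g < h") auto
    ultimately obtain j' where j': "h = 2 + \<tau> * C + j'" "0 < j'" "j' \<le> j"
      by (metis add_le_cancel_left less_imp_add_positive)
    then have "index h = 2 + j'" using assms(3) by (simp add: index_def)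
    then show False using parse_start[of h] h p j' by simp
  qed
  ultimately show "marked r i0 i j w c"
    unfolding marked_iff_parse[OF assms(1,2)] using \<tau> by blast
qed

end

end


section \<open>Tests on tuples of terms\<close>

lemma concat_map_upt_mult:
  "concat (map f [0..<n * c]) = concat (map (\<lambda>i. concat (map (\<lambda>j. f (i * c + j)) [0..<c])) [0..<n])"
proof (induction n)
  case (Suc n)
  have "[0..<Suc n * c] = [0..<n * c] @ map (\<lambda>j. n * c + j) [0..<c]"
    using upt_add_eq_append[of 0 "n * c" c] by (simp add: map_add_upt add.commute[of "n * c"])
  then show ?case using Suc by (simp add: comp_def)
qed simp

lemma map_conv_nth: "map f xs = map (\<lambda>i. f (xs ! i)) [0..<length xs]"
  by (rule nth_equalityI) auto

text \<open>For \<open>\<bar>v\<bar> \<le> 1\<close> this is \<open>K * v\<close> rounded towards 0; larger values are cut off.\<close>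

definition level :: "nat \<Rightarrow> rat \<Rightarrow> int" where
  "level K v = (if v < 0 then - 1 else 1) * int (card {J \<in> {1..K}. of_nat J \<le> of_nat K * \<bar>v\<bar>})"

definition rat_item :: "rat \<Rightarrow> nat \<Rightarrow> bool list" where
  "rat_item v s = (if s = 0 then [fst (quotient_of v) < 0]
     else if s = 1 then encode_binary (nat \<bar>fst (quotient_of v)\<bar>)
     else encode_binary (nat (snd (quotient_of v))))"

lemma encode_rat_items: "encode_rat v = concat (map (rat_item v) [0..<3])"
  by (simp add: encode_rat_def rat_item_def upt_rec split: prod.split)

lemma quotient_of_less_0: "fst (quotient_of v) < 0 \<longleftrightarrow> v < 0"
proof -
  obtain a b where ab: "quotient_of v = (a, b)" by fastforce
  then have "b > 0" and v: "v = of_int a / of_int b" by (auto simp: quotient_of_denom_pos quotient_of_div)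
  then have "v < 0 \<longleftrightarrow> a < 0" unfolding v by (simp add: divide_less_0_iff)
  then show ?thesis by (simp add: ab)
qed

text \<open>Comparing an absolute value with \<open>J / K\<close> becomes a comparison of scaled
  numerator and denominator, which is what \<open>geq_scaled\<close> can do without multiplying long
  numbers.\<close>

lemma quotient_of_ge:
  "int J * int (nat (snd (quotient_of v))) \<le> int K * int (nat \<bar>fst (quotient_of v)\<bar>) \<longleftrightarrow>
    of_nat J \<le> of_nat K * \<bar>v\<bar>"
proof -
  obtain a b where ab: "quotient_of v = (a, b)" by fastforce
  then have b: "b > 0" and v: "v = of_int a / of_int b"
    by (auto simp: quotient_of_denom_pos quotient_of_div)
  have "of_nat J \<le> of_nat K * \<bar>v\<bar> \<longleftrightarrow> (of_nat J :: rat) * of_int b \<le> of_nat K * of_int \<bar>a\<bar>"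
    unfolding v using b by (simp add: abs_divide pos_le_divide_eq)
  also have "\<dots> \<longleftrightarrow> (of_int (int J * b) :: rat) \<le> of_int (int K * \<bar>a\<bar>)" by simp
  also have "\<dots> \<longleftrightarrow> int J * b \<le> int K * \<bar>a\<bar>" by (rule of_int_le_iff)
  finally show ?thesis using b by (simp add: ab)
qed

text \<open>The first argument is a slot of the tuple of terms. \<open>Starts\<close> binds the
  marks of a slot to the items of a single term. \<open>Negative\<close> and \<open>At_least\<close>
  report the sign of entry \<open>e\<close> and whether its absolute value reaches
  \<open>J / K\<close>, which together determine its \<open>level\<close>.\<close>

datatype test = Starts nat nat | Same nat nat nat nat | Negative nat nat | At_least nat nat nat

locale encoding =
  fixes q k K N :: nat
  assumes q: "q \<ge> 1"
begin

abbreviation strings :: "nat list list" where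
  "strings \<equiv> List.n_lists k [0..<q]"

definition Q :: nat where
  "Q = length strings"

definition C :: nat where
  "C = k + Q * Q * 3"

definition kind :: "nat \<Rightarrow> item" where
  "kind j = (if j < k then Unary else if (j - k) mod 3 = 0 then Bit else Binary)"

definition entry :: "local_term \<Rightarrow> nat \<Rightarrow> rat" where
  "entry h e = term_matrix h (strings ! (e div Q)) (strings ! (e mod Q))"

definition term_item :: "local_term \<Rightarrow> nat \<Rightarrow> bool list" where
  "term_item h j = (if j < k then encode_unary (term_qudits h ! j)
     else rat_item (entry h ((j - k) div 3)) ((j - k) mod 3))"

definition instance_item :: "hamiltonian_instance \<Rightarrow> nat \<Rightarrow> bool list" where
  "instance_item I g = (if g = 0 then encode_unary (num_qudits I)
     else if g = 1 then encode_unary (length (ham_terms I))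
     else term_item (ham_terms I ! ((g - 2) div C)) ((g - 2) mod C))"

lemma Q: "Q = q ^ k" "0 < Q"
  using q by (simp_all add: Q_def length_n_lists)

lemma C: "0 < C"
  using Q by (simp add: C_def)

sublocale parser C kind
  by standard (rule C)

lemma set_strings: "set strings = qstrings q k"
  by (auto simp: qstrings_def set_n_lists)

lemma encode_term_items:
  assumes "length (term_qudits h) = k"
  shows "encode_term q k h = concat (map (term_item h) [0..<C])"
proof -
  have split: "[0..<C] = [0..<k] @ map (\<lambda>j. k + j) [0..<Q * Q * 3]"
    using upt_add_eq_append[of 0 k "Q * Q * 3"] by (simp add: C_def map_add_upt add.commute[of k])
  have 1: "concat (map encode_unary (term_qudits h)) = concat (map (term_item h) [0..<k])"
    by (subst map_conv_nth, rule arg_cong[of _ _ concat]) (simp add: assms term_item_def)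
  have "concat (map (\<lambda>x. concat (map (\<lambda>y. encode_rat (term_matrix h x y)) strings)) strings) =
     concat (map (\<lambda>a. concat (map (\<lambda>b. encode_rat (term_matrix h (strings ! a) (strings ! b))) [0..<Q])) [0..<Q])"
    by (subst (1 2) map_conv_nth) (simp add: Q_def)
  also have "\<dots> = concat (map (\<lambda>a. concat (map (\<lambda>b. encode_rat (entry h (a * Q + b))) [0..<Q])) [0..<Q])"
    using Q by (intro arg_cong[of _ _ concat] map_cong refl) (simp add: entry_def)
  also have "\<dots> = concat (map (\<lambda>e. encode_rat (entry h e)) [0..<Q * Q])"
    by (rule concat_map_upt_mult[symmetric])
  also have "\<dots> = concat (map (\<lambda>e. concat (map (\<lambda>s. rat_item (entry h ((e * 3 + s) div 3)) ((e * 3 + s) mod 3)) [0..<3])) [0..<Q * Q])"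
    unfolding encode_rat_items by (intro arg_cong[of _ _ concat] map_cong refl) simp
  also have "\<dots> = concat (map (\<lambda>j. rat_item (entry h (j div 3)) (j mod 3)) [0..<Q * Q * 3])"
    by (rule concat_map_upt_mult[symmetric])
  also have "\<dots> = concat (map (term_item h) (map (\<lambda>j. k + j) [0..<Q * Q * 3]))"
    by (simp add: comp_def term_item_def)
  finally show ?thesis by (simp add: encode_term_def 1 split)
qed

abbreviation item_start :: "hamiltonian_instance \<Rightarrow> nat \<Rightarrow> nat \<Rightarrow> nat" where
  "item_start I \<tau> j \<equiv> start (instance_item I) (2 + \<tau> * C + j)"

context
  fixes I :: hamiltonian_instance
  assumes qudits: "\<And>h. h \<in> set (ham_terms I) \<Longrightarrow> length (term_qudits h) = k"
begin

abbreviation m :: nat where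
  "m \<equiv> length (ham_terms I)"

abbreviation w :: "bool list" where
  "w \<equiv> encode_instance q k I"

lemma encode_instance_items: "w = concat (map (instance_item I) [0..<2 + m * C])"
proof -
  have split: "[0..<2 + m * C] = [0, 1] @ map (\<lambda>j. 2 + j) [0..<m * C]"
  proof -
    have "[0..<2 + m * C] = [0..<2] @ [2..<2 + m * C]" by (rule upt_add_eq_append) simp
    moreover have "[0..<2] = [0, 1 :: nat]" by (simp add: numeral_2_eq_2)
    moreover have "map (\<lambda>j. 2 + j) [0..<m * C] = [2..<2 + m * C]"
      using map_add_upt[of 2 "m * C"] by (simp add: add.commute)
    ultimately show ?thesis by simp
  qed
  have "concat (map (encode_term q k) (ham_terms I)) =
    concat (map (\<lambda>i. concat (map (term_item (ham_terms I ! i)) [0..<C])) [0..<m])"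
    by (subst map_conv_nth) (auto intro!: arg_cong[of _ _ concat] simp: encode_term_items qudits)
  also have "\<dots> = concat (map (\<lambda>i. concat (map (\<lambda>j. instance_item I (2 + (i * C + j))) [0..<C])) [0..<m])"
    using C by (intro arg_cong[of _ _ concat] map_cong refl) (simp add: instance_item_def)
  also have "\<dots> = concat (map (\<lambda>j. instance_item I (2 + j)) [0..<m * C])"
    by (rule concat_map_upt_mult[symmetric])
  finally show ?thesis unfolding encode_instance_def split
    by (simp add: instance_item_def comp_def)
qed

lemma instance_item_kind: "is_item (item_kind (index g)) (instance_item I g)"
proof (cases "g < 2")
  case True
  then have "g = 0 \<or> g = 1" by auto
  then show ?thesis by (auto simp: item_kind_def index_def instance_item_def)
next
  case False
  let ?j = "(g - 2) mod C"
  have "item_kind (index g) = kind ?j" using False by (simp add: item_kind_def index_def)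
  moreover have "instance_item I g = term_item (ham_terms I ! ((g - 2) div C)) ?j"
    using False by (simp add: instance_item_def)
  ultimately show ?thesis by (auto simp: kind_def term_item_def rat_item_def)
qed

lemma starts_at_item:
  assumes "\<tau> < m" "j < C"
  shows "starts_at w (item_start I \<tau> j) (term_item (ham_terms I ! \<tau>) j)"
proof -
  have "Suc \<tau> * C \<le> m * C" using assms by (intro mult_le_mono1) simp
  then have "2 + \<tau> * C + j < 2 + m * C" using assms by simp
  from starts_at_start[OF instance_item_kind encode_instance_items this]
  show ?thesis using assms by (simp add: instance_item_def)
qed

lemma item_start_le:
  assumes "\<tau> < m" "j < C"
  shows "item_start I \<tau> j \<le> length w"
proof -
  have "Suc \<tau> * C \<le> m * C" using assms by (intro mult_le_mono1) simp
  then have less: "2 + \<tau> * C + j < 2 + m * C" using assms by simp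
  show ?thesis
    using start_mono[OF instance_item_kind encode_instance_items less order_refl]
      start_G[OF instance_item_kind encode_instance_items] by simp
qed

end

text \<open>Each of the \<open>N\<close> slots owns one mark for every item of a term, so all its
  items are read during the same scan.\<close>

definition mark :: "nat \<Rightarrow> nat \<Rightarrow> nat" where
  "mark a j = a * C + j"

lemma mark_less: "a < N \<Longrightarrow> j < C \<Longrightarrow> mark a j < N * C"
proof -
  assume "a < N" "j < C"
  then have "Suc a * C \<le> N * C" by (intro mult_le_mono1) simp
  then show ?thesis using \<open>j < C\<close> by (simp add: mark_def)
qed

definition passes :: "test \<Rightarrow> bool list \<Rightarrow> (nat \<Rightarrow> nat) \<Rightarrow> bool" where
  "passes t = (case t of
     Starts a j \<Rightarrow> marked (N * C) (mark a 0) (mark a j) j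
   | Same a j a' j' \<Rightarrow> same_unary (N * C) (mark a j) (mark a' j')
   | Negative a e \<Rightarrow> bit_at (mark a (k + e * 3))
   | At_least a e J \<Rightarrow> geq_scaled (N * C) (mark a (k + e * 3 + 1)) (mark a (k + e * 3 + 2)) (int K) (int J))"

definition tests :: "test set" where
  "tests = (\<lambda>(a, j). Starts a j) ` ({..<N} \<times> {..<C}) \<union>
     (\<lambda>(a, j, a', j'). Same a j a' j') ` ({..<N} \<times> {..<k} \<times> {..<N} \<times> {..<k}) \<union>
     (\<lambda>(a, e). Negative a e) ` ({..<N} \<times> {..<Q * Q}) \<union>
     (\<lambda>(a, e, J). At_least a e J) ` ({..<N} \<times> {..<Q * Q} \<times> {1..K})"

lemma finite_tests: "finite tests"
  by (simp add: tests_def)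

lemma tests_iff [simp]:
  "Starts a j \<in> tests \<longleftrightarrow> a < N \<and> j < C"
  "Same a j a' j' \<in> tests \<longleftrightarrow> a < N \<and> j < k \<and> a' < N \<and> j' < k"
  "Negative a e \<in> tests \<longleftrightarrow> a < N \<and> e < Q * Q"
  "At_least a e J \<in> tests \<longleftrightarrow> a < N \<and> e < Q * Q \<and> J \<in> {1..K}"
  unfolding tests_def by (auto simp: image_iff)

lemma entry_item_less: "e < Q * Q \<Longrightarrow> s < 3 \<Longrightarrow> k + e * 3 + s < C"
  by (simp add: C_def)

lemma scan_regular_passes:
  assumes "t \<in> tests"
  shows "scan_regular (N * C) (passes t)"
  using assms mark_less[OF _ entry_item_less[of _ 0]]
  by (auto simp: tests_def passes_def intro!: scan_regular_marked scan_regular_same_unary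
      scan_regular_bit_at scan_regular_geq_scaled)

definition string_index :: "nat list \<Rightarrow> nat" where
  "string_index x = (SOME a. a < Q \<and> strings ! a = x)"

lemma string_index:
  assumes "x \<in> qstrings q k"
  shows "string_index x < Q" "strings ! string_index x = x"
proof -
  have "\<exists>a. a < Q \<and> strings ! a = x"
    using assms by (metis set_strings in_set_conv_nth Q_def)
  then have "string_index x < Q \<and> strings ! string_index x = x"
    unfolding string_index_def by (rule someI_ex)
  then show "string_index x < Q" "strings ! string_index x = x" by auto
qed

definition entry_index :: "nat list \<Rightarrow> nat list \<Rightarrow> nat" where
  "entry_index x y = string_index x * Q + string_index y"

lemma entry_index:
  assumes "x \<in> qstrings q k" "y \<in> qstrings q k"
  shows "entry_index x y < Q * Q" "entry h (entry_index x y) = term_matrix h x y"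
proof -
  note * = string_index[OF assms(1)] string_index[OF assms(2)]
  have "Suc (string_index x) * Q \<le> Q * Q" using * by (intro mult_le_mono1) simp
  then show "entry_index x y < Q * Q" using * by (simp add: entry_index_def)
  show "entry h (entry_index x y) = term_matrix h x y" using * by (simp add: entry_def entry_index_def)
qed

text \<open>Cut off outside the slots and positions in use, so that the data recovered from the
  tests equal it as a function and \<open>G\<close> may be applied to either. The same holds for
  \<open>rounded_matrix\<close>.\<close>

definition same_qudit :: "(nat \<Rightarrow> local_term) \<Rightarrow> nat \<Rightarrow> nat \<Rightarrow> nat \<Rightarrow> nat \<Rightarrow> bool" where
  "same_qudit hs a j a' j' \<longleftrightarrow> a < N \<and> j < k \<and> a' < N \<and> j' < k \<and>
     term_qudits (hs a) ! j = term_qudits (hs a') ! j'"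

definition rounded_matrix :: "(nat \<Rightarrow> local_term) \<Rightarrow> nat \<Rightarrow> nat list \<Rightarrow> nat list \<Rightarrow> int" where
  "rounded_matrix hs a x y = (if a < N \<and> x \<in> qstrings q k \<and> y \<in> qstrings q k
     then level K (term_matrix (hs a) x y) else 0)"

definition read_same :: "test set \<Rightarrow> nat \<Rightarrow> nat \<Rightarrow> nat \<Rightarrow> nat \<Rightarrow> bool" where
  "read_same X a j a' j' \<longleftrightarrow> Same a j a' j' \<in> X"

definition read_matrix :: "test set \<Rightarrow> nat \<Rightarrow> nat list \<Rightarrow> nat list \<Rightarrow> int" where
  "read_matrix X a x y = (if a < N \<and> x \<in> qstrings q k \<and> y \<in> qstrings q k
     then (if Negative a (entry_index x y) \<in> X then - 1 else 1) *
       int (card {J \<in> {1..K}. At_least a (entry_index x y) J \<in> X}) else 0)"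

lemma passes_data:
  assumes qudits: "\<And>h. h \<in> set (ham_terms I) \<Longrightarrow> length (term_qudits h) = k"
    and \<tau>: "\<And>a. a < N \<Longrightarrow> \<tau> a < length (ham_terms I)"
    and c: "\<And>a j. a < N \<Longrightarrow> j < C \<Longrightarrow> c (mark a j) = item_start I (\<tau> a) j"
  defines "X \<equiv> {t \<in> tests. passes t (encode_instance q k I) c}"
    and "hs \<equiv> \<lambda>a. ham_terms I ! \<tau> a"
  shows "read_same X = same_qudit hs" "read_matrix X = rounded_matrix hs"
proof -
  let ?w = "encode_instance q k I"
  have at: "starts_at ?w (c (mark a j)) (term_item (hs a) j)" if "a < N" "j < C" for a j
    using starts_at_item[OF qudits \<tau>[OF that(1)] that(2)] c[OF that] by (simp add: hs_def)
  have kC: "j < C" if "j < k" for j using that by (simp add: C_def)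
  have same: "Same a j a' j' \<in> X \<longleftrightarrow> same_qudit hs a j a' j'" for a j a' j'
  proof (cases "a < N \<and> j < k \<and> a' < N \<and> j' < k")
    case True
    then have "passes (Same a j a' j') ?w c \<longleftrightarrow> term_qudits (hs a) ! j = term_qudits (hs a') ! j'"
      unfolding passes_def test.case using at[of a j] at[of a' j']
      by (intro same_unary_iff) (auto simp: mark_less kC term_item_def)
    then show ?thesis using True by (auto simp: X_def same_qudit_def)
  qed (auto simp: X_def same_qudit_def)
  then show "read_same X = same_qudit hs" by (simp add: fun_eq_iff read_same_def)
  have item: "starts_at ?w (c (mark a (k + e * 3 + s))) (rat_item (entry (hs a) e) s)"
    if "a < N" "e < Q * Q" "s < 3" for a e s
    using at[of a "k + e * 3 + s"] entry_item_less[OF that(2,3)] that by (simp add: term_item_def)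
  have neg: "Negative a e \<in> X \<longleftrightarrow> entry (hs a) e < 0" if "a < N" "e < Q * Q" for a e
    using starts_at_cell[OF item[OF that, of 0], of 0] that
    by (auto simp: X_def passes_def bit_at_def rat_item_def quotient_of_less_0)
  have ge: "At_least a e J \<in> X \<longleftrightarrow> of_nat J \<le> of_nat K * \<bar>entry (hs a) e\<bar>"
    if "a < N" "e < Q * Q" "J \<in> {1..K}" for a e J
  proof -
    have "starts_at ?w (c (mark a (k + e * 3 + 1))) (encode_binary (nat \<bar>fst (quotient_of (entry (hs a) e))\<bar>))"
      "starts_at ?w (c (mark a (k + e * 3 + 2))) (encode_binary (nat (snd (quotient_of (entry (hs a) e)))))"
      using item[OF that(1,2), of 1] item[OF that(1,2), of 2] by (auto simp: rat_item_def)
    from geq_scaled_iff[OF mark_less[OF that(1)] mark_less[OF that(1)] this, of "int K" "int J", unfolded quotient_of_ge]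
      entry_item_less[OF that(2), of 1] entry_item_less[OF that(2), of 2]
    have "passes (At_least a e J) ?w c \<longleftrightarrow> of_nat J \<le> of_nat K * \<bar>entry (hs a) e\<bar>"
      by (simp add: passes_def)
    then show ?thesis using that by (simp add: X_def)
  qed
  have "read_matrix X a x y = rounded_matrix hs a x y" for a x y
  proof (cases "a < N \<and> x \<in> qstrings q k \<and> y \<in> qstrings q k")
    case True
    then have e: "entry_index x y < Q * Q" "entry (hs a) (entry_index x y) = term_matrix (hs a) x y"
      using entry_index by auto
    have "{J \<in> {1..K}. At_least a (entry_index x y) J \<in> X} =
      {J \<in> {1..K}. of_nat J \<le> of_nat K * \<bar>term_matrix (hs a) x y\<bar>}"
      using ge[of a "entry_index x y"] e True by auto
    then show ?thesis using neg[of a "entry_index x y"] e True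
      by (simp add: read_matrix_def rounded_matrix_def level_def)
  qed (auto simp: read_matrix_def rounded_matrix_def)
  then show "read_matrix X = rounded_matrix hs" by (simp add: fun_eq_iff)
qed

lemma passes_Starts:
  assumes qudits: "\<And>h. h \<in> set (ham_terms I) \<Longrightarrow> length (term_qudits h) = k" and "a < N" "j < C"
  shows "passes (Starts a j) (encode_instance q k I) c \<longleftrightarrow>
    (\<exists>\<tau><length (ham_terms I). c (mark a 0) = start (instance_item I) (2 + \<tau> * C) \<and>
      c (mark a j) = item_start I \<tau> j)"
  unfolding passes_def test.case
  by (rule marked_iff[OF instance_item_kind encode_instance_items])
    (use assms mark_less C in auto)

text \<open>A tuple of \<open>N\<close> terms with \<open>G\<close> refutes an instance. Since
  \<open>G\<close> sees only coincidences of qudits and rounded entries, it is a function of the set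
  of passed tests. For a No instance the marks are put on the items of the refuting terms; for a Yes
  instance the \<open>Starts\<close> tests force every choice of marks that could be accepted to
  come from terms of the instance.\<close>

theorem local_checks:
  assumes qudits: "\<And>I h. I \<in> Yes \<union> No \<Longrightarrow> h \<in> set (ham_terms I) \<Longrightarrow> length (term_qudits h) = k"
    and yes: "\<And>I hs. I \<in> Yes \<Longrightarrow> (\<And>a. a < N \<Longrightarrow> hs a \<in> set (ham_terms I)) \<Longrightarrow>
      \<not> G (same_qudit hs) (rounded_matrix hs)"
    and no: "\<And>I. I \<in> No \<Longrightarrow> \<exists>hs. (\<forall>a<N. hs a \<in> set (ham_terms I)) \<and> G (same_qudit hs) (rounded_matrix hs)"
  shows "(encode_instance q k ` Yes, encode_instance q k ` No) \<in> promise_P"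
proof -
  define accept where "accept X \<longleftrightarrow> (\<forall>a<N. \<forall>j<C. Starts a j \<in> X) \<and> G (read_same X) (read_matrix X)" for X
  show ?thesis
  proof (rule scan_regular_promise_P)
    show "scan_regular (N * C) (\<lambda>w c. accept {t \<in> tests. passes t w c})"
      by (intro scan_regular_boolean finite_tests scan_regular_passes)
  next
    fix w c assume "w \<in> encode_instance q k ` Yes"
    then obtain I where I: "I \<in> Yes" and w: "w = encode_instance q k I" by blast
    have len: "\<And>h. h \<in> set (ham_terms I) \<Longrightarrow> length (term_qudits h) = k" using qudits I by blast
    show "\<not> accept {t \<in> tests. passes t w c}"
    proof
      assume acc: "accept {t \<in> tests. passes t w c}"
      have st: "passes (Starts a j) w c" if "a < N" "j < C" for a j
        using acc that by (simp add: accept_def)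
      have "\<exists>\<tau><length (ham_terms I). \<forall>j<C. c (mark a j) = item_start I \<tau> j" if a: "a < N" for a
      proof -
        obtain \<tau> where \<tau>: "\<tau> < length (ham_terms I)" "c (mark a 0) = start (instance_item I) (2 + \<tau> * C)"
          using st[OF a C] passes_Starts[OF len a C] unfolding w by auto
        have "c (mark a j) = item_start I \<tau> j" if j: "j < C" for j
        proof -
          obtain \<tau>' where \<tau>': "\<tau>' < length (ham_terms I)" "c (mark a 0) = start (instance_item I) (2 + \<tau>' * C)"
            "c (mark a j) = item_start I \<tau>' j"
            using st[OF a j] passes_Starts[OF len a j] unfolding w by auto
          \<comment> \<open>Items are nonempty, so different items start at different cells. Hence
            the term found for item \<open>j\<close> is the one found for item 0.\<close>
          have inj: "start (instance_item I) g \<noteq> start (instance_item I) g'" if "g < g'" "g' < 2 + length (ham_terms I) * C" for g g'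
            using start_mono[OF instance_item_kind[of I] encode_instance_items[OF len], of g g'] that len by simp
          have lt: "2 + t * C < 2 + length (ham_terms I) * C" if "t < length (ham_terms I)" for t
            using that C by simp
          have "\<not> 2 + \<tau> * C < 2 + \<tau>' * C" "\<not> 2 + \<tau>' * C < 2 + \<tau> * C"
            using inj[OF _ lt[OF \<tau>'(1)], of "2 + \<tau> * C"] inj[OF _ lt[OF \<tau>(1)], of "2 + \<tau>' * C"] \<tau>(2) \<tau>'(2)
            by auto
          then have "\<tau> = \<tau>'" using C by simp
          then show ?thesis using \<tau>' by simp
        qed
        then show ?thesis using \<tau> by blast
      qed
      then obtain \<tau> where \<tau>: "\<And>a. a < N \<Longrightarrow> \<tau> a < length (ham_terms I)"
        "\<And>a j. a < N \<Longrightarrow> j < C \<Longrightarrow> c (mark a j) = item_start I (\<tau> a) j"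
        by metis
      have "G (same_qudit (\<lambda>a. ham_terms I ! \<tau> a)) (rounded_matrix (\<lambda>a. ham_terms I ! \<tau> a))"
        using acc passes_data[OF len \<tau>] by (simp add: accept_def w)
      moreover have "ham_terms I ! \<tau> a \<in> set (ham_terms I)" if "a < N" for a using \<tau> that by simp
      ultimately show False using yes[OF I, of "\<lambda>a. ham_terms I ! \<tau> a"] by blast
    qed
  next
    fix w assume "w \<in> encode_instance q k ` No"
    then obtain I where I: "I \<in> No" and w: "w = encode_instance q k I" by blast
    have len: "\<And>h. h \<in> set (ham_terms I) \<Longrightarrow> length (term_qudits h) = k" using qudits I by blast
    obtain hs where hs: "\<And>a. a < N \<Longrightarrow> hs a \<in> set (ham_terms I)" "G (same_qudit hs) (rounded_matrix hs)"
      using no[OF I] by blast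
    then have "\<forall>a. \<exists>\<tau>. a < N \<longrightarrow> \<tau> < length (ham_terms I) \<and> ham_terms I ! \<tau> = hs a"
      by (metis in_set_conv_nth)
    then obtain \<tau> where \<tau>: "\<And>a. a < N \<Longrightarrow> \<tau> a < length (ham_terms I)" "\<And>a. a < N \<Longrightarrow> ham_terms I ! \<tau> a = hs a"
      by metis
    define c where "c x = start (instance_item I) (2 + \<tau> (x div C) * C + x mod C)" for x
    have c: "c (mark a j) = item_start I (\<tau> a) j" if "j < C" for a j
      using that by (simp add: c_def mark_def)
    have "c i \<le> length w" if "i < N * C" for i
      unfolding c_def w using that C \<tau>(1)[of "i div C"]
      by (intro item_start_le[OF len]) (auto simp: less_mult_imp_div_less)
    moreover have "passes (Starts a j) w c" if "a < N" "j < C" for a j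
      using passes_Starts[OF len that, where c = c] \<tau>(1)[OF that(1)] c[of 0 a] c[of j a] C that unfolding w by auto
    moreover have "same_qudit (\<lambda>a. ham_terms I ! \<tau> a) = same_qudit hs"
      "rounded_matrix (\<lambda>a. ham_terms I ! \<tau> a) = rounded_matrix hs"
      using \<tau>(2) by (auto simp: fun_eq_iff same_qudit_def rounded_matrix_def)
    ultimately show "\<exists>c. (\<forall>i<N * C. c i \<le> length w) \<and> accept {t \<in> tests. passes t w c}"
      using passes_data[OF len \<tau>(1) c] hs(2)
      by (intro exI[of _ c]) (simp add: accept_def w)
  qed
qed

end


section \<open>Expansion of good sets of strings\<close>

text \<open>The number of moves charged to one watched qudit after \<open>t\<close> layers: at most
  one move of the last layer touches it, which accounts for the 1 and brings in at most
  \<open>k\<close> more qudits to be watched through the earlier layers.\<close>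

fun cone :: "nat \<Rightarrow> nat \<Rightarrow> nat" where
  "cone k 0 = 0"
| "cone k (Suc t) = Suc k * cone k t + 1"

lemma cone_mono: "s \<le> t \<Longrightarrow> cone k s \<le> cone k t"
proof (induction t)
  case (Suc t)
  have "cone k t \<le> cone k (Suc t)" by simp
  then show ?case using Suc by (cases "s = Suc t") auto
qed simp

definition agree :: "nat set \<Rightarrow> nat list \<Rightarrow> nat list \<Rightarrow> bool" where
  "agree A x y \<longleftrightarrow> (\<forall>b\<in>A. x ! b = y ! b)"

lemma agree_mono: "agree B x y \<Longrightarrow> A \<subseteq> B \<Longrightarrow> agree A x y"
  by (auto simp: agree_def)

lemma agree_trans: "agree A x y \<Longrightarrow> agree A y z \<Longrightarrow> agree A x z"
  by (auto simp: agree_def)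

lemma agree_sym: "agree A x y \<Longrightarrow> agree A y x"
  by (auto simp: agree_def)

lemma finite_qstrings [simp]: "finite (qstrings q n)"
proof -
  have "qstrings q n = set (List.n_lists n [0..<q])" by (auto simp: qstrings_def set_n_lists)
  then show ?thesis by simp
qed

text \<open>\<open>D\<close> bounds the number of strings from which one term leads to a given
  string, and thereby how many boundary strings a single new string can account for. Both moves and
  badness are decided by the letters on the support, so that a walk can be replayed from a string
  that agrees with the original only on a few qudits.\<close>

locale move_system =
  fixes m n q k d D :: nat and supp :: "nat \<Rightarrow> nat set"
    and edge :: "nat \<Rightarrow> nat list \<Rightarrow> nat list \<Rightarrow> bool" and bad :: "nat \<Rightarrow> nat list \<Rightarrow> bool"
  assumes q: "1 \<le> q" and m: "1 \<le> m"
    and supp: "i < m \<Longrightarrow> supp i \<subseteq> {..<n}" and card_supp: "i < m \<Longrightarrow> card (supp i) \<le> k"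
    and degree: "b < n \<Longrightarrow> card {i. i < m \<and> b \<in> supp i} \<le> d"
    and edge_strings: "i < m \<Longrightarrow> edge i x y \<Longrightarrow> x \<in> qstrings q n \<and> y \<in> qstrings q n"
    and edge_off: "i < m \<Longrightarrow> edge i x y \<Longrightarrow> agree ({..<n} - supp i) x y"
    and edge_count: "i < m \<Longrightarrow> card {x. edge i x y} \<le> D"
    and edge_local: "i < m \<Longrightarrow> edge i x y \<Longrightarrow> x' \<in> qstrings q n \<Longrightarrow> agree (supp i) x x' \<Longrightarrow>
      \<exists>y'. edge i x' y' \<and> agree (supp i) y y'"
    and bad_local: "i < m \<Longrightarrow> bad i x \<Longrightarrow> x \<in> qstrings q n \<Longrightarrow> x' \<in> qstrings q n \<Longrightarrow>
      agree (supp i) x x' \<Longrightarrow> bad i x'"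
begin

abbreviation strings :: "nat list set" where
  "strings \<equiv> qstrings q n"

text \<open>A move may be idle, so \<open>r\<close> is an upper bound and walks can be padded to a
  common length.\<close>

fun reach :: "nat \<Rightarrow> nat list \<Rightarrow> nat list \<Rightarrow> bool" where
  "reach 0 x y \<longleftrightarrow> y = x"
| "reach (Suc r) x y \<longleftrightarrow> (\<exists>z. reach r x z \<and> (y = z \<or> (\<exists>i<m. edge i z y)))"

lemma reach_Suc_mono: "reach r x y \<Longrightarrow> reach (Suc r) x y"
  by auto

lemma reach_mono: "reach r x y \<Longrightarrow> r \<le> r' \<Longrightarrow> reach r' x y"
proof (induction r')
  case (Suc r')
  then show ?case using reach_Suc_mono by (cases "r = Suc r'") auto
qed simp

lemma reach_trans: "reach r x y \<Longrightarrow> reach s y z \<Longrightarrow> reach (r + s) x z"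
  by (induction s arbitrary: z) auto

lemma reach_strings: "reach r x y \<Longrightarrow> x \<in> strings \<Longrightarrow> y \<in> strings"
  by (induction r arbitrary: y) (auto dest: edge_strings)

definition expand :: "nat \<Rightarrow> nat list set \<Rightarrow> nat list set" where
  "expand i S = S \<union> {y. \<exists>x\<in>S. edge i x y}"

lemma expand_iff: "y \<in> expand i S \<longleftrightarrow> y \<in> S \<or> (\<exists>x\<in>S. edge i x y)"
  by (auto simp: expand_def)

definition layer :: "nat list \<Rightarrow> bool" where
  "layer L \<longleftrightarrow> set L \<subseteq> {..<m} \<and> sorted_wrt (\<lambda>i j. supp i \<inter> supp j = {}) L"

lemma expand_strings: "i < m \<Longrightarrow> S \<subseteq> strings \<Longrightarrow> expand i S \<subseteq> strings"
  by (auto simp: expand_iff dest: edge_strings)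

lemma fold_expand_strings: "set L \<subseteq> {..<m} \<Longrightarrow> S \<subseteq> strings \<Longrightarrow> fold expand L S \<subseteq> strings"
proof (induction L arbitrary: S)
  case (Cons i L)
  then show ?case using expand_strings[of i S] by simp
qed simp

definition hits :: "nat set \<Rightarrow> nat list \<Rightarrow> nat list" where
  "hits A L = filter (\<lambda>j. supp j \<inter> A \<noteq> {}) L"

abbreviation touched :: "nat set \<Rightarrow> nat list \<Rightarrow> nat set" where
  "touched A L \<equiv> A \<union> \<Union> (supp ` set (hits A L))"

text \<open>The supports in a layer are disjoint, so every hit uses up an element of
  \<open>A\<close> of its own.\<close>

lemma length_hits:
  assumes "layer L" "finite A"
  shows "length (hits A L) \<le> card A"
  using assms
proof (induction L arbitrary: A)
  case (Cons i L)
  then have L: "layer L" and disj: "\<And>j. j \<in> set L \<Longrightarrow> supp i \<inter> supp j = {}" by (auto simp: layer_def)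
  show ?case
  proof (cases "supp i \<inter> A = {}")
    case True
    then show ?thesis using Cons.IH[OF L Cons.prems(2)] by (simp add: hits_def)
  next
    case False
    have "hits A L = hits (A - supp i) L"
      unfolding hits_def using disj by (intro filter_cong refl) blast
    then have "length (hits A L) \<le> card (A - supp i)" using Cons.IH[OF L, of "A - supp i"] Cons.prems by simp
    moreover have "card (A - supp i) < card A" using False Cons.prems by (intro psubset_card_mono) auto
    ultimately show ?thesis using False by (simp add: hits_def)
  qed
qed (simp add: hits_def)

text \<open>
  Whether a string of a layer's expansion has prescribed letters on \<open>A\<close> depends only on the moves
  that touch \<open>A\<close>, because the other moves of the layer do not touch those either.
\<close>

lemma layer_trace:
  assumes "layer L" "S \<subseteq> strings" "A \<subseteq> {..<n}" "x \<in> fold expand L S"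
  shows "\<exists>x0\<in>S. \<forall>y0\<in>strings. agree (touched A L) x0 y0 \<longrightarrow>
    (\<exists>y. reach (length (hits A L)) y0 y \<and> agree A x y)"
  using assms
proof (induction L arbitrary: x A rule: rev_induct)
  case Nil
  then show ?case by (intro bexI[of _ x]) (auto simp: hits_def)
next
  case (snoc i L)
  let ?S = "fold expand L S"
  have L: "layer L" and i: "i < m" and disj: "\<And>j. j \<in> set L \<Longrightarrow> supp j \<inter> supp i = {}"
    using snoc.prems(1) by (auto simp: layer_def sorted_wrt_append)
  have hits_snoc: "hits A (L @ [i]) = hits A L @ (if supp i \<inter> A = {} then [] else [i])"
    by (simp add: hits_def)
  show ?case
  proof (cases "supp i \<inter> A = {} \<or> x \<in> ?S")
    case True
    have "\<exists>x1\<in>?S. agree A x x1"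
    proof (cases "x \<in> ?S")
      case False
      then obtain x1 where "x1 \<in> ?S" "edge i x1 x" using snoc.prems by (auto simp: expand_iff)
      moreover have "A \<subseteq> {..<n} - supp i" using snoc.prems True False by auto
      ultimately show ?thesis using edge_off[OF i] agree_mono agree_sym by blast
    qed (auto simp: agree_def)
    then obtain x1 where x1: "x1 \<in> ?S" "agree A x x1" by blast
    from snoc.IH[OF L snoc.prems(2,3) x1(1)] obtain x0 where x0: "x0 \<in> S"
      "\<And>y0. y0 \<in> strings \<Longrightarrow> agree (touched A L) x0 y0 \<Longrightarrow>
        \<exists>y. reach (length (hits A L)) y0 y \<and> agree A x1 y" by blast
    show ?thesis
    proof (intro bexI[of _ x0] ballI impI)
      fix y0 assume y0: "y0 \<in> strings" "agree (touched A (L @ [i])) x0 y0"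
      then have "agree (touched A L) x0 y0"
        by (rule_tac agree_mono) (auto simp: hits_snoc)
      then obtain y where y: "reach (length (hits A L)) y0 y" "agree A x1 y" using x0(2) y0(1) by blast
      have "reach (length (hits A (L @ [i]))) y0 y" by (rule reach_mono[OF y(1)]) (simp add: hits_snoc)
      then show "\<exists>y. reach (length (hits A (L @ [i]))) y0 y \<and> agree A x y"
        using agree_trans[OF x1(2) y(2)] by blast
    qed (rule x0(1))
  next
    case False
    then obtain x1 where x1: "x1 \<in> ?S" "edge i x1 x" using snoc.prems by (auto simp: expand_iff)
    let ?A = "A \<union> supp i"
    \<comment> \<open>Watching \<open>supp i\<close> in addition costs no further moves, as the
      earlier moves of the layer are disjoint from it.\<close>
    have hits_eq: "hits ?A L = hits A L"
      unfolding hits_def using disj by (intro filter_cong refl) blast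
    have A: "?A \<subseteq> {..<n}" using snoc.prems supp[OF i] by auto
    from snoc.IH[OF L snoc.prems(2) A x1(1)] obtain x0 where x0: "x0 \<in> S"
      "\<And>y0. y0 \<in> strings \<Longrightarrow> agree (?A \<union> \<Union> (supp ` set (hits A L))) x0 y0 \<Longrightarrow>
        \<exists>y. reach (length (hits A L)) y0 y \<and> agree ?A x1 y" unfolding hits_eq by blast
    show ?thesis
    proof (intro bexI[of _ x0] ballI impI)
      fix y0 assume y0: "y0 \<in> strings" "agree (touched A (L @ [i])) x0 y0"
      then have "agree (?A \<union> \<Union> (supp ` set (hits A L))) x0 y0"
        using False by (rule_tac agree_mono) (auto simp: hits_snoc)
      then obtain y1 where y1: "reach (length (hits A L)) y0 y1" "agree ?A x1 y1" using x0(2) y0(1) by blast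
      have "y1 \<in> strings" using reach_strings[OF y1(1) y0(1)] .
      then obtain y where y: "edge i y1 y" "agree (supp i) x y"
        using edge_local[OF i x1(2)] agree_mono[OF y1(2)] by blast
      have "x ! b = y ! b" if "b \<in> A" for b
      proof (cases "b \<in> supp i")
        case True
        then show ?thesis using y(2) by (auto simp: agree_def)
      next
        case False
        then have "b \<in> {..<n} - supp i" using that snoc.prems by auto
        then have "x1 ! b = x ! b" "y1 ! b = y ! b" using edge_off[OF i x1(2)] edge_off[OF i y(1)]
          by (auto simp: agree_def)
        then show ?thesis using y1(2) that by (simp add: agree_def)
      qed
      moreover have "reach (length (hits A (L @ [i]))) y0 y"
        using False y1(1) y(1) i by (auto simp: hits_snoc)
      ultimately show "\<exists>y. reach (length (hits A (L @ [i]))) y0 y \<and> agree A x y"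
        by (auto simp: agree_def)
    qed (rule x0(1))
  qed
qed

lemma card_cone:
  assumes "layer L" "finite A"
  shows "card (touched A L) \<le> Suc k * card A"
proof -
  let ?H = "set (hits A L)"
  have H: "?H \<subseteq> {..<m}" using assms(1) by (auto simp: layer_def hits_def)
  have "card (\<Union> (supp ` ?H)) \<le> (\<Sum>j\<in>?H. card (supp j))" by (rule card_UN_le) simp
  also have "\<dots> \<le> card ?H * k" using sum_bounded_above[of ?H "\<lambda>j. card (supp j)" k] card_supp H by auto
  also have "\<dots> \<le> card A * k"
    using length_hits[OF assms] card_length[of "hits A L"] by (intro mult_le_mono1) linarith
  finally have "card (\<Union> (supp ` ?H)) \<le> card A * k" .
  then show ?thesis using card_Un_le[of A "\<Union> (supp ` ?H)"] by (simp add: algebra_simps)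
qed

definition spread :: "nat list list \<Rightarrow> nat list \<Rightarrow> nat list set" where
  "spread Ls x = fold (fold expand) Ls {x}"

lemma spread_snoc: "spread (Ls @ [L]) x = fold expand L (spread Ls x)"
  by (simp add: spread_def)

lemma spread_strings:
  assumes "x \<in> strings" "\<And>L. L \<in> set Ls \<Longrightarrow> layer L"
  shows "spread Ls x \<subseteq> strings"
  using assms(2)
proof (induction Ls rule: rev_induct)
  case (snoc L Ls)
  then show ?case unfolding spread_snoc by (intro fold_expand_strings) (auto simp: layer_def)
qed (use assms(1) in \<open>simp add: spread_def\<close>)

text \<open>The light cone, traced back from the last layer: each layer replaces the watched set by
  \<open>touched A L\<close>. In return for agreeing with \<open>x\<close> only on \<open>A\<close>,
  the string \<open>y\<close> is reached by a number of moves that does not depend on the widths of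
  the layers.\<close>

lemma spread_trace:
  assumes "x0 \<in> strings" "\<And>L. L \<in> set Ls \<Longrightarrow> layer L" "A \<subseteq> {..<n}" "x \<in> spread Ls x0"
  shows "\<exists>y. reach (card A * cone k (length Ls)) x0 y \<and> agree A x y"
  using assms(2-)
proof (induction Ls arbitrary: x A rule: rev_induct)
  case Nil
  then show ?case by (auto simp: spread_def agree_def)
next
  case (snoc L Ls)
  have L: "layer L" "\<And>L. L \<in> set Ls \<Longrightarrow> layer L" using snoc.prems by auto
  have fin: "finite A" using snoc.prems(2) finite_subset by blast
  let ?A = "touched A L"
  obtain x1 where x1: "x1 \<in> spread Ls x0" "\<And>y0. y0 \<in> strings \<Longrightarrow> agree ?A x1 y0 \<Longrightarrow>
      \<exists>y. reach (length (hits A L)) y0 y \<and> agree A x y"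
    using layer_trace[OF L(1) spread_strings[OF assms(1) L(2)] snoc.prems(2)] snoc.prems(3)
    unfolding spread_snoc by blast
  have "?A \<subseteq> {..<n}" using snoc.prems(2) supp L(1) by (fastforce simp: layer_def hits_def)
  from snoc.IH[OF L(2) this x1(1)] obtain y0 where
    y0: "reach (card ?A * cone k (length Ls)) x0 y0" "agree ?A x1 y0" by auto
  then obtain y where y: "reach (length (hits A L)) y0 y" "agree A x y"
    using x1(2) reach_strings[OF _ assms(1)] by blast
  have "card ?A * cone k (length Ls) + length (hits A L) \<le> Suc k * card A * cone k (length Ls) + card A"
    using card_cone[OF L(1) fin] length_hits[OF L(1) fin] by (intro add_mono mult_le_mono1)
  also have "\<dots> = card A * cone k (length (Ls @ [L]))" by (simp add: algebra_simps)
  finally have "reach (card A * cone k (length (Ls @ [L]))) x0 y"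
    by (rule reach_mono[OF reach_trans[OF y0(1) y(1)]])
  then show ?case using y(2) by blast
qed

section \<open>Growth of the expanded sets\<close>

definition boundary :: "nat \<Rightarrow> nat list set \<Rightarrow> nat list set" where
  "boundary i S = {x \<in> S. \<exists>y. y \<notin> S \<and> edge i x y}"

text \<open>Every boundary string has an edge to a new string, and a new string receives at most
  \<open>D\<close> edges of one term.\<close>

lemma card_expand:
  assumes "i < m" "S \<subseteq> strings"
  shows "card (boundary i S) + D * card S \<le> D * card (expand i S)"
proof -
  have fin: "finite S" "finite (expand i S)"
    using finite_subset[OF assms(2)] finite_subset[OF expand_strings[OF assms]] by simp_all
  let ?N = "expand i S - S"
  have finE: "finite {x. edge i x y}" for y
    by (rule finite_subset[of _ strings]) (use assms edge_strings in auto)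
  have "boundary i S \<subseteq> (\<Union>y\<in>?N. {x. edge i x y})" by (auto simp: boundary_def expand_def)
  then have "card (boundary i S) \<le> card (\<Union>y\<in>?N. {x. edge i x y})"
    using fin finE by (intro card_mono) auto
  also have "\<dots> \<le> (\<Sum>y\<in>?N. card {x. edge i x y})" using fin by (intro card_UN_le) auto
  also have "\<dots> \<le> card ?N * D" using sum_bounded_above[of ?N "\<lambda>y. card {x. edge i x y}" D] edge_count assms by auto
  also have "card ?N = card (expand i S) - card S"
    using fin by (intro card_Diff_subset) (auto simp: expand_iff)
  finally have "card (boundary i S) \<le> (card (expand i S) - card S) * D" .
  moreover have "card S \<le> card (expand i S)" using fin by (intro card_mono) (auto simp: expand_iff)
  then have "D * card S \<le> D * card (expand i S)" by (rule mult_le_mono2)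
  ultimately show ?thesis unfolding diff_mult_distrib by (simp only: mult.commute[of _ D])
qed

text \<open>A support has at most \<open>k\<close> qudits, and each of them lies in at most
  \<open>d\<close> supports.\<close>

lemma card_overlap:
  assumes "layer L"
  shows "card {i. i < m \<and> (\<exists>j\<in>set L. supp i \<inter> supp j \<noteq> {})} \<le> length L * (k * d)"
proof -
  have eq: "{i. i < m \<and> (\<exists>j\<in>set L. supp i \<inter> supp j \<noteq> {})} =
      (\<Union>j\<in>set L. \<Union>b\<in>supp j. {i. i < m \<and> b \<in> supp i})" by auto
  have 1: "card (\<Union>j\<in>set L. \<Union>b\<in>supp j. {i. i < m \<and> b \<in> supp i}) \<le>
      (\<Sum>j\<in>set L. card (\<Union>b\<in>supp j. {i. i < m \<and> b \<in> supp i}))" by (rule card_UN_le) simp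
  have "card (\<Union>b\<in>supp j. {i. i < m \<and> b \<in> supp i}) \<le> k * d" if "j \<in> set L" for j
  proof -
    have j: "j < m" using that assms by (auto simp: layer_def)
    have "finite (supp j)" using supp[OF j] finite_subset by blast
    then have "card (\<Union>b\<in>supp j. {i. i < m \<and> b \<in> supp i}) \<le> (\<Sum>b\<in>supp j. card {i. i < m \<and> b \<in> supp i})"
      by (rule card_UN_le)
    also have "\<dots> \<le> card (supp j) * d"
      using sum_bounded_above[of "supp j" "\<lambda>b. card {i. i < m \<and> b \<in> supp i}" d] degree supp[OF j] by auto
    also have "\<dots> \<le> k * d" using card_supp[OF j] by (rule mult_le_mono1)
    finally show ?thesis .
  qed
  then have 2: "(\<Sum>j\<in>set L. card (\<Union>b\<in>supp j. {i. i < m \<and> b \<in> supp i})) \<le> card (set L) * (k * d)"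
    using sum_bounded_above[of "set L" _ "k * d"] by auto
  have "card (set L) * (k * d) \<le> length L * (k * d)" by (intro mult_le_mono1 card_length)
  then show ?thesis unfolding eq using 1 2 by (blast intro: order.trans)
qed

context
  fixes \<eta> :: real and x0 :: "nat list"
  assumes \<eta>: "0 < \<eta>" and x0: "x0 \<in> strings"
    and boundary: "\<And>S. S \<noteq> {} \<Longrightarrow> S \<subseteq> strings \<Longrightarrow> (\<And>i x. i < m \<Longrightarrow> x \<in> S \<Longrightarrow> \<not> bad i x) \<Longrightarrow>
      \<eta> * m * card S \<le> (\<Sum>i<m. real (card (boundary i S)))"
begin

text \<open>As long as the layer is short, at most \<open>\<eta> * m / 2\<close> terms overlap it,
  and these carry at most half of the boundary. The other half is spread over at most
  \<open>m\<close> terms, so one of them has its average share.\<close>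

lemma large_boundary:
  assumes "S \<noteq> {}" "S \<subseteq> strings" "\<And>i x. i < m \<Longrightarrow> x \<in> S \<Longrightarrow> \<not> bad i x"
    and L: "layer L" "real (length L) * (k * d) \<le> \<eta> * m / 2"
  shows "\<exists>i. layer (L @ [i]) \<and> \<eta> / 2 * card S \<le> card (boundary i S)"
proof -
  define V where "V = {i. i < m \<and> (\<exists>j\<in>set L. supp i \<inter> supp j \<noteq> {})}"
  define f where "f i = real (card (boundary i S))" for i
  have fin: "finite S" using assms(2) finite_subset finite_qstrings by blast
  have f: "f i \<le> card S" for i
    unfolding f_def using fin by (simp add: card_mono boundary_def)
  have "V \<subseteq> {..<m}" "finite V" by (auto simp: V_def)
  then have split: "(\<Sum>i<m. f i) = (\<Sum>i\<in>{..<m} - V. f i) + (\<Sum>i\<in>V. f i)"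
    by (intro sum.subset_diff) auto
  have "(\<Sum>i\<in>V. f i) \<le> card V * real (card S)" using sum_bounded_above[of V f] f by simp
  also have "\<dots> \<le> \<eta> * m / 2 * card S"
  proof (intro mult_right_mono)
    have "real (card V) \<le> real (length L * (k * d))" using card_overlap[OF L(1)] unfolding V_def of_nat_le_iff .
    then show "card V \<le> \<eta> * m / 2" using L(2) by simp
  qed simp
  finally have rest: "\<eta> * m / 2 * card S \<le> (\<Sum>i\<in>{..<m} - V. f i)"
    using boundary[OF assms(1-3)] split unfolding f_def[symmetric] by (simp add: algebra_simps)
  have "\<exists>i\<in>{..<m} - V. \<eta> / 2 * card S \<le> f i"
  proof (rule ccontr)
    assume "\<not> ?thesis"
    then have less: "f i < \<eta> / 2 * card S" if "i \<in> {..<m} - V" for i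
      using that not_le by blast
    have pos: "0 < \<eta> / 2 * card S" using \<eta> assms(1) fin by (simp add: card_gt_0_iff)
    have "0 < \<eta> / 2 * card S * m" by (rule mult_pos_pos[OF pos]) (use m in simp)
    moreover have "\<eta> * m / 2 * card S \<le> 0" if "{..<m} - V = {}" using rest unfolding that by simp
    ultimately have ne: "{..<m} - V \<noteq> {}" by (auto simp: mult.commute mult.left_commute)
    have "(\<Sum>i\<in>{..<m} - V. f i) < card ({..<m} - V) * (\<eta> / 2 * card S)"
      using ne less by (intro sum_bounded_above_strict) (auto simp: card_gt_0_iff)
    also have "\<dots> \<le> m * (\<eta> / 2 * card S)"
      using pos card_mono[of "{..<m}" "{..<m} - V"] by (intro mult_right_mono) auto
    finally show False using rest by (simp add: mult.commute mult.left_commute)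
  qed
  then obtain i where i: "i < m" "i \<notin> V" "\<eta> / 2 * card S \<le> f i" by blast
  then have "layer (L @ [i])" using L(1) by (auto simp: layer_def sorted_wrt_append V_def)
  then show ?thesis using i(3) f_def by auto
qed

text \<open>The number of moves in a layer, proportional to \<open>m\<close> and small enough for
  \<open>large_boundary\<close> to apply whenever a move is added. The 1 in the denominator covers
  \<open>k * d = 0\<close>; the 1 outside makes up for rounding down.\<close>

definition width :: nat where
  "width = nat \<lfloor>\<eta> * m / (2 * (k * d + 1))\<rfloor> + 1"

lemma width: "\<eta> * m / (2 * (k * d + 1)) \<le> width"
  "j < width \<Longrightarrow> real j * (k * d) \<le> \<eta> * m / 2"
proof -
  let ?v = "\<eta> * m / (2 * (k * d + 1))"
  have v: "0 \<le> ?v" using \<eta> by simp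
  show "?v \<le> width" using v unfolding width_def by linarith
  assume "j < width"
  then have "real j \<le> ?v" using v unfolding width_def by linarith
  then have "real j * (k * d) \<le> ?v * (k * d)" by (intro mult_right_mono) auto
  also have "\<dots> \<le> ?v * (k * d + 1)" using v by (intro mult_left_mono) auto
  also have "\<dots> = \<eta> * m / 2"
  proof -
    have "\<eta> * m / (2 * u) * u = \<eta> * m / 2" if "u \<noteq> 0" for u :: real using that by simp
    from this[of "k * d + 1"] show ?thesis by (simp add: add_nonneg_eq_0_iff)
  qed
  finally show "real j * (k * d) \<le> \<eta> * m / 2" .
qed

abbreviation growth :: real where
  "growth \<equiv> 1 + \<eta> / (2 * D)"

context
  fixes T :: nat
  assumes good: "\<And>i y. i < m \<Longrightarrow> reach (k * cone k T) x0 y \<Longrightarrow> \<not> bad i y"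
begin

text \<open>Badness for a term shows on the at most \<open>k\<close> qudits of its support. The
  light cone of these qudits turns a bad string anywhere in the spread into one reachable by
  \<open>k * cone k T\<close> moves.\<close>

lemma spread_good:
  assumes "\<And>L. L \<in> set Ls \<Longrightarrow> layer L" "length Ls \<le> T" "i < m" "x \<in> spread Ls x0"
  shows "\<not> bad i x"
proof
  assume bad: "bad i x"
  obtain y where y: "reach (card (supp i) * cone k (length Ls)) x0 y" "agree (supp i) x y"
    using spread_trace[OF x0 assms(1) supp[OF assms(3)] assms(4)] by auto
  have "card (supp i) * cone k (length Ls) \<le> k * cone k T"
    by (intro mult_le_mono card_supp[OF assms(3)] cone_mono assms(2))
  then have r: "reach (k * cone k T) x0 y" using reach_mono[OF y(1)] by blast
  have "x \<in> strings" using spread_strings[OF x0 assms(1)] assms(4) by blast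
  moreover have "y \<in> strings" using reach_strings[OF r x0] .
  ultimately have "bad i y" using bad_local[OF assms(3) bad] y(2) by blast
  then show False using good[OF assms(3) r] by blast
qed

text \<open>The bound on \<open>length Ls\<close> is strict because the layer under construction is
  itself one of the \<open>T\<close> layers within which all strings are good.\<close>

lemma grow:
  assumes Ls: "\<And>L. L \<in> set Ls \<Longrightarrow> layer L" "length Ls < T" and "j \<le> width" "1 \<le> D"
  shows "\<exists>L. layer L \<and> length L = j \<and>
    growth ^ j * card (spread Ls x0) \<le> card (spread (Ls @ [L]) x0)"
  using assms(3)
proof (induction j)
  case 0
  then show ?case by (intro exI[of _ "[]"]) (simp add: layer_def spread_snoc)
next
  case (Suc j)
  then obtain L where L: "layer L" "length L = j"
    "growth ^ j * card (spread Ls x0) \<le> card (spread (Ls @ [L]) x0)" by auto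
  let ?S = "spread (Ls @ [L]) x0"
  have lay: "\<And>L'. L' \<in> set (Ls @ [L]) \<Longrightarrow> layer L'" using Ls L by auto
  have S: "?S \<subseteq> strings" using spread_strings[OF x0 lay] .
  have ne: "?S \<noteq> {}"
  proof -
    have sub: "S \<subseteq> fold expand L S" for L S
    proof (induction L arbitrary: S)
      case (Cons i L)
      have "S \<subseteq> expand i S" by (auto simp: expand_iff)
      then show ?case using Cons[of "expand i S"] by auto
    qed simp
    have "x0 \<in> spread Ls x0" for Ls
    proof (induction Ls rule: rev_induct)
      case (snoc L Ls)
      then show ?case using sub[of "spread Ls x0" L] unfolding spread_snoc by blast
    qed (simp add: spread_def)
    then show ?thesis by blast
  qed
  have "real (length L) * (k * d) \<le> \<eta> * m / 2" using width(2)[of j] Suc.prems L(2) by simp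
  moreover have "\<not> bad i x" if "i < m" "x \<in> ?S" for i x
    using spread_good[OF lay _ that] Ls(2) by simp
  ultimately obtain i where i: "layer (L @ [i])" "\<eta> / 2 * card ?S \<le> card (boundary i ?S)"
    using large_boundary[OF ne S _ L(1)] by blast
  then have "i < m" by (auto simp: layer_def)
  from card_expand[OF this S] have "real (card (boundary i ?S)) + D * card ?S \<le> D * card (expand i ?S)"
    unfolding of_nat_mult[symmetric] of_nat_add[symmetric] of_nat_le_iff .
  then have "\<eta> / 2 * card ?S + D * card ?S \<le> D * card (expand i ?S)" using i(2) by linarith
  then have step: "growth * card ?S \<le> card (expand i ?S)"
    using assms(4) by (simp add: field_simps)
  have "growth ^ Suc j * card (spread Ls x0) =
      growth * (growth ^ j * card (spread Ls x0))" by simp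
  also have "\<dots> \<le> growth * card ?S"
    using L(3) \<eta> by (intro mult_left_mono) auto
  also have "\<dots> \<le> card (spread (Ls @ [L @ [i]]) x0)" using step by (simp add: spread_snoc)
  finally show ?case using i(1) L(2) by (intro exI[of _ "L @ [i]"]) simp
qed

lemma grow_layers:
  assumes "t \<le> T" "1 \<le> D"
  shows "\<exists>Ls. (\<forall>L\<in>set Ls. layer L) \<and> length Ls = t \<and>
    growth ^ (t * width) \<le> card (spread Ls x0)"
  using assms(1)
proof (induction t)
  case 0
  then show ?case by (intro exI[of _ "[]"]) (simp add: spread_def)
next
  case (Suc t)
  then obtain Ls where Ls: "\<forall>L\<in>set Ls. layer L" "length Ls = t"
    "growth ^ (t * width) \<le> card (spread Ls x0)" by auto
  obtain L where L: "layer L"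
    "growth ^ width * card (spread Ls x0) \<le> card (spread (Ls @ [L]) x0)"
    using grow[of Ls width] Ls Suc.prems assms(2) by auto
  have "growth ^ (Suc t * width) = growth ^ width * growth ^ (t * width)"
    by (simp add: power_add)
  also have "\<dots> \<le> growth ^ width * card (spread Ls x0)"
    using Ls(3) \<eta> by (intro mult_left_mono) auto
  finally show ?case using L Ls by (intro exI[of _ "Ls @ [L]"]) auto
qed

end

lemma spread_off:
  assumes "\<And>L. L \<in> set Ls \<Longrightarrow> layer L" "x \<in> spread Ls x0"
  shows "agree ({..<n} - (\<Union>i<m. supp i)) x0 x"
proof -
  let ?U = "{..<n} - (\<Union>i<m. supp i)"
  have layer: "x \<in> fold expand L S \<Longrightarrow> set L \<subseteq> {..<m} \<Longrightarrow> (\<And>y. y \<in> S \<Longrightarrow> agree ?U x0 y) \<Longrightarrow> agree ?U x0 x" for L S x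
  proof (induction L arbitrary: S)
    case (Cons i L)
    have "agree ?U x0 y" if y: "y \<in> expand i S" for y
    proof (cases "y \<in> S")
      case False
      then obtain z where z: "z \<in> S" "edge i z y" using y by (auto simp: expand_iff)
      have "agree ({..<n} - supp i) z y" using edge_off z Cons.prems by simp
      then have "agree ?U z y" using Cons.prems by (rule_tac agree_mono) auto
      then show ?thesis using Cons.prems(3)[OF z(1)] agree_trans by blast
    qed (use Cons.prems in auto)
    then show ?case using Cons by simp
  qed simp
  show ?thesis using assms
  proof (induction Ls arbitrary: x rule: rev_induct)
    case (snoc L Ls)
    then show ?case using layer[of x L "spread Ls x0"] unfolding spread_snoc by (auto simp: layer_def)
  qed (simp add: spread_def agree_def)
qed

text \<open>Moves change only the at most \<open>k * m\<close> qudits lying in some support. A bound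
  in terms of \<open>n\<close> would not do: the expansion is exponential in \<open>m\<close>, and
  \<open>n\<close> may be much larger.\<close>

lemma card_spread:
  assumes "\<And>L. L \<in> set Ls \<Longrightarrow> layer L"
  shows "card (spread Ls x0) \<le> q ^ (k * m)"
proof -
  let ?U = "\<Union>i<m. supp i" and ?S = "spread Ls x0"
  have U: "?U \<subseteq> {..<n}" "finite ?U" using supp finite_subset[of "supp _" "{..<n}"] by fastforce+
  have S: "?S \<subseteq> strings" using spread_strings[OF x0 assms] .
  let ?h = "\<lambda>x. restrict (\<lambda>b. x ! b) ?U"
  have "inj_on ?h ?S"
  proof (rule inj_onI)
    fix x y assume xy: "x \<in> ?S" "y \<in> ?S" "?h x = ?h y"
    then have len: "length x = n" "length y = n" using S by (auto simp: qstrings_def)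
    have "x ! b = y ! b" if "b < n" for b
    proof (cases "b \<in> ?U")
      case True
      then show ?thesis using fun_cong[OF xy(3), of b] by (auto simp: restrict_def split: if_splits)
    next
      case False
      then have "b \<in> {..<n} - ?U" using that by blast
      then show ?thesis using spread_off[OF assms xy(1)] spread_off[OF assms xy(2)] unfolding agree_def by metis
    qed
    then show "x = y" using len by (intro nth_equalityI) auto
  qed
  moreover have "?h ` ?S \<subseteq> ?U \<rightarrow>\<^sub>E {..<q}"
  proof
    fix f assume "f \<in> ?h ` ?S"
    then obtain x where x: "x \<in> strings" "f = ?h x" using S by blast
    have "x ! b < q" if "b \<in> ?U" for b
      using x(1) U(1) that nth_mem[of b x] by (fastforce simp: qstrings_def)
    then show "f \<in> ?U \<rightarrow>\<^sub>E {..<q}" unfolding x(2) by auto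
  qed
  moreover have "finite (?U \<rightarrow>\<^sub>E {..<q})" using U(2) by (intro finite_PiE) auto
  ultimately have "card ?S \<le> card (?U \<rightarrow>\<^sub>E {..<q})" by (rule card_inj_on_le)
  also have "\<dots> = q ^ card ?U" using U(2) by (simp add: card_PiE)
  also have "\<dots> \<le> q ^ (k * m)"
  proof (rule power_increasing[OF _ q])
    have "card ?U \<le> (\<Sum>i<m. card (supp i))" by (rule card_UN_le) simp
    also have "\<dots> \<le> k * m" using sum_bounded_above[of "{..<m}" "\<lambda>i. card (supp i)" k] card_supp by (simp add: mult.commute)
    finally show "card ?U \<le> k * m" .
  qed
  finally show ?thesis .
qed

text \<open>
  Otherwise \<open>T\<close> layers of \<open>width\<close> moves, each expanding by the factor \<open>1 + \<eta> / (2 * D)\<close>, would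
  yield more strings than there are on the qudits in some support.
\<close>

theorem bad_reachable:
  assumes T: "k * ln q < T * (\<eta> / (2 * (k * d + 1))) * ln (1 + \<eta> / (2 * D))" and D: "1 \<le> D"
  shows "\<exists>i y. i < m \<and> reach (k * cone k T) x0 y \<and> bad i y"
proof (rule ccontr)
  assume "\<not> ?thesis"
  then have good: "\<And>i y. i < m \<Longrightarrow> reach (k * cone k T) x0 y \<Longrightarrow> \<not> bad i y" by blast
  let ?c = "1 + \<eta> / (2 * D)"
  have c: "1 < ?c" using \<eta> D by simp
  obtain Ls where Ls: "\<forall>L\<in>set Ls. layer L" "?c ^ (T * width) \<le> card (spread Ls x0)"
    using grow_layers[OF good order_refl D] by blast
  have "real (card (spread Ls x0)) \<le> real (q ^ (k * m))" unfolding of_nat_le_iff by (rule card_spread) (use Ls in auto)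
  then have "?c ^ (T * width) \<le> real q ^ (k * m)" using Ls(2) unfolding of_nat_power by (rule order.trans[rotated])
  then have "ln (?c ^ (T * width)) \<le> ln (real q ^ (k * m))" using c by (intro ln_mono) auto
  then have "real (T * width) * ln ?c \<le> real (k * m) * ln q"
    using c q by (simp add: ln_realpow)
  \<comment> \<open>Here \<open>m\<close> cancels against the factor \<open>m\<close> in
    \<open>width\<close>, so that \<open>T\<close> can be chosen independently of the
    instance.\<close>
  moreover have "real m * (k * ln q) < real (T * width) * ln ?c"
  proof -
    have "real m * (k * ln q) < real m * (T * (\<eta> / (2 * (k * d + 1))) * ln ?c)"
      using m by (intro mult_strict_left_mono T) auto
    also have "\<dots> = T * (\<eta> * m / (2 * (k * d + 1))) * ln ?c" by (simp add: field_simps)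
    also have "\<dots> \<le> T * width * ln ?c"
      using mult_right_mono[OF mult_left_mono[OF width(1), of T], of "ln ?c"] c by simp
    finally show ?thesis by simp
  qed
  ultimately show False by (simp add: algebra_simps)
qed

end

end


section \<open>Terms embedded into all qudits\<close>

lemma of_real_of_rat: "of_real (of_rat r) = (of_rat r :: complex)"
  by (cases r) (simp add: of_rat_rat)

lemma level_0 [simp]: "level K 0 = 0"
  by (auto simp: level_def)

text \<open>For absolute values up to 1 the cut-off at \<open>K\<close> has no effect, and counting
  the multiples of \<open>1 / K\<close> below a number is a floor.\<close>

lemma level_error:
  assumes "\<bar>of_rat v :: real\<bar> \<le> 1"
  shows "\<bar>of_int (level K v) - real K * of_rat v\<bar> < 1"
proof -
  let ?u = "real K * \<bar>of_rat v\<bar>"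
  have u: "0 \<le> ?u" "?u \<le> K" using assms mult_left_mono[of "\<bar>of_rat v\<bar>" 1 "real K"] by auto
  have iff: "of_nat J \<le> of_nat K * \<bar>v\<bar> \<longleftrightarrow> real J \<le> ?u" for J
  proof -
    have "of_nat J \<le> of_nat K * \<bar>v\<bar> \<longleftrightarrow> (of_rat (of_nat J) :: real) \<le> of_rat (of_nat K * \<bar>v\<bar>)"
      by (simp only: of_rat_less_eq)
    also have "(of_rat (of_nat K * \<bar>v\<bar>) :: real) = ?u"
      by (simp add: of_rat_mult abs_if of_rat_minus of_rat_less)
    finally show ?thesis by simp
  qed
  have "{J \<in> {1..K}. of_nat J \<le> of_nat K * \<bar>v\<bar>} = {1..nat \<lfloor>?u\<rfloor>}"
  proof -
    have 1: "real J \<le> ?u \<longleftrightarrow> J \<le> nat \<lfloor>?u\<rfloor>" for J using u(1) by (simp add: le_nat_iff le_floor_iff)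
    have "nat \<lfloor>?u\<rfloor> \<le> K" using floor_mono[OF u(2)] by (simp add: nat_le_iff)
    then have "J \<in> {1..K} \<and> J \<le> nat \<lfloor>?u\<rfloor> \<longleftrightarrow> J \<in> {1..nat \<lfloor>?u\<rfloor>}" for J by auto
    then show ?thesis unfolding iff 1 by blast
  qed
  then have "int (card {J \<in> {1..K}. of_nat J \<le> of_nat K * \<bar>v\<bar>}) = \<lfloor>?u\<rfloor>" using u(1) by simp
  then have lev: "level K v = (if v < 0 then - \<lfloor>?u\<rfloor> else \<lfloor>?u\<rfloor>)" unfolding level_def by simp
  have val: "real K * of_rat v = (if v < 0 then - ?u else ?u)" by (simp add: abs_if of_rat_less_0_iff)
  have "\<bar>of_int \<lfloor>?u\<rfloor> - ?u\<bar> < 1" by linarith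
  then show ?thesis unfolding lev val by (cases "v < 0") simp_all
qed

lemma qstrings_update: "x \<in> qstrings q n \<Longrightarrow> v < q \<Longrightarrow> x[b := v] \<in> qstrings q n"
  using set_update_subset_insert[of x b v] by (auto simp: qstrings_def)

lemma qstrings_nth: "x \<in> qstrings q n \<Longrightarrow> b < n \<Longrightarrow> x ! b < q"
  using nth_mem[of b x] by (auto simp: qstrings_def subset_eq)

lemma card_qstrings: "card (qstrings q n) = q ^ n"
proof -
  have "card {x. set x \<subseteq> {..<q} \<and> length x = n} = q ^ n" using card_lists_length_eq[of "{..<q}" n] by simp
  then show ?thesis by (simp add: qstrings_def conj_commute)
qed

definition put :: "nat list \<Rightarrow> nat list \<Rightarrow> nat list \<Rightarrow> nat list" where
  "put bs z x = map (\<lambda>b. case map_of (zip bs z) b of None \<Rightarrow> x ! b | Some v \<Rightarrow> v) [0..<length x]"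

lemma length_put [simp]: "length (put bs z x) = length x"
  by (simp add: put_def)

lemma put_nth_in:
  assumes "distinct bs" "length z = length bs" "j < length bs" "bs ! j < length x"
  shows "put bs z x ! (bs ! j) = z ! j"
  using assms by (simp add: put_def map_of_zip_nth)

lemma put_nth_notin:
  assumes "b \<notin> set bs" "b < length x"
  shows "put bs z x ! b = x ! b"
proof -
  have "map_of (zip bs z) b = None"
    using assms(1) set_zip_leftD[of b _ bs z] by (auto simp: map_of_eq_None_iff)
  then show ?thesis using assms(2) by (simp add: put_def)
qed

text \<open>The embedded operator with rational values, so that \<open>level\<close> applies to its
  entries.\<close>

definition rat_embed :: "nat \<Rightarrow> local_term \<Rightarrow> nat list \<Rightarrow> nat list \<Rightarrow> rat" where
  "rat_embed n h x y = (if \<forall>b<n. b \<notin> set (term_qudits h) \<longrightarrow> x ! b = y ! b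
     then term_matrix h (restrict_string x (term_qudits h)) (restrict_string y (term_qudits h)) else 0)"

lemma embedded_operator_rat: "embedded_operator n h x y = of_rat (rat_embed n h x y)"
  by (auto simp: embedded_operator_def rat_embed_def local_operator_def)

locale valid_local_term =
  fixes q k n :: nat and h :: local_term
  assumes q: "1 \<le> q" and valid: "valid_term q k n h"
begin

abbreviation bs :: "nat list" where "bs \<equiv> term_qudits h"
abbreviation X :: "nat list set" where "X \<equiv> qstrings q n"
abbreviation Z :: "nat list set" where "Z \<equiv> qstrings q k"
abbreviation a :: "nat list \<Rightarrow> nat list \<Rightarrow> real" where "a x y \<equiv> of_rat (term_matrix h x y)"

lemma bs: "length bs = k" "distinct bs" "set bs \<subseteq> {..<n}"
  using valid by (auto simp: valid_term_def)

lemma bs_nth: "j < k \<Longrightarrow> bs ! j < n"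
  using bs(3) nth_mem[of j bs] unfolding bs(1) by blast

lemma restrict_in: "x \<in> X \<Longrightarrow> restrict_string x bs \<in> Z"
  using bs(1) subsetD[OF bs(3)] qstrings_nth[of x q n]
  by (auto simp: restrict_string_def qstrings_def[of q k])

lemma put_in: "x \<in> X \<Longrightarrow> z \<in> Z \<Longrightarrow> put bs z x \<in> X"
proof -
  assume x: "x \<in> X" and z: "z \<in> Z"
  have len: "length x = n" "length z = k" using x z by (auto simp: qstrings_def)
  have "put bs z x ! b < q" if "b < n" for b
  proof (cases "b \<in> set bs")
    case True
    then obtain j where "j < k" "b = bs ! j" using bs(1) by (auto simp: in_set_conv_nth)
    then show ?thesis using put_nth_in[OF bs(2), of z j x] len bs(1) that qstrings_nth[OF z] by simp
  next
    case False
    then show ?thesis using put_nth_notin[OF False, of x z] len that qstrings_nth[OF x] by simp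
  qed
  then show ?thesis using len by (auto simp: qstrings_def in_set_conv_nth)
qed

lemma restrict_put: "x \<in> X \<Longrightarrow> z \<in> Z \<Longrightarrow> restrict_string (put bs z x) bs = z"
  using bs bs_nth by (intro nth_equalityI) (auto simp: restrict_string_def qstrings_def put_nth_in)

lemma put_eqI:
  assumes "x \<in> X" "y \<in> X" "z \<in> Z" "\<And>b. b < n \<Longrightarrow> b \<notin> set bs \<Longrightarrow> y ! b = x ! b" "restrict_string y bs = z"
  shows "put bs z x = y"
proof (rule nth_equalityI)
  have len: "length x = n" "length y = n" "length z = k" using assms by (auto simp: qstrings_def)
  then show "length (put bs z x) = length y" by simp
  fix b assume "b < length (put bs z x)"
  then have b: "b < n" using len by simp
  show "put bs z x ! b = y ! b"
  proof (cases "b \<in> set bs")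
    case True
    then obtain j where j: "j < k" "b = bs ! j" using bs(1) by (auto simp: in_set_conv_nth)
    then have "y ! b = z ! j" using assms(5) bs(1) by (auto simp: restrict_string_def)
    then show ?thesis using put_nth_in[OF bs(2), of z j x] j len bs(1) b by simp
  next
    case False
    then show ?thesis using put_nth_notin[OF False, of x z] len b assms(4) by simp
  qed
qed

lemma put_restrict: "x \<in> X \<Longrightarrow> put bs (restrict_string x bs) x = x"
  by (rule put_eqI) (auto intro: restrict_in)

lemma put_nth_off: "x \<in> X \<Longrightarrow> b < n \<Longrightarrow> b \<notin> set bs \<Longrightarrow> put bs z x ! b = x ! b"
  by (rule put_nth_notin) (auto simp: qstrings_def)

lemma put_put:
  assumes "x \<in> X" "z \<in> Z" "z' \<in> Z"
  shows "put bs z (put bs z' x) = put bs z x"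
  by (rule put_eqI[OF put_in[OF assms(1,3)] put_in[OF assms(1,2)] assms(2)])
    (simp_all add: put_nth_off restrict_put assms)

lemma rat_embed_put: "x \<in> X \<Longrightarrow> z \<in> Z \<Longrightarrow> rat_embed n h x (put bs z x) = term_matrix h (restrict_string x bs) z"
  by (auto simp: rat_embed_def restrict_put put_nth_off)

lemma rat_embed_nonzero_put:
  assumes "x \<in> X" "y \<in> X" "rat_embed n h x y \<noteq> 0"
  shows "put bs (restrict_string y bs) x = y"
  using assms by (intro put_eqI restrict_in) (auto simp: rat_embed_def split: if_splits)

text \<open>In row \<open>x\<close> only the strings \<open>put bs z x\<close> can have nonzero
  entries. This turns sums over all strings into sums of \<open>q ^ k\<close> summands.\<close>

lemma sum_rat_embed:
  fixes g :: "nat list \<Rightarrow> 'b :: comm_monoid_add"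
  assumes x: "x \<in> X" and g: "\<And>y. y \<in> X \<Longrightarrow> rat_embed n h x y = 0 \<Longrightarrow> g y = 0"
  shows "(\<Sum>y\<in>X. g y) = (\<Sum>z\<in>Z. g (put bs z x))"
proof -
  let ?Y = "(\<lambda>z. put bs z x) ` Z"
  have inj: "inj_on (\<lambda>z. put bs z x) Z" 
    by (rule inj_on_inverseI[of _ "\<lambda>y. restrict_string y bs"]) (rule restrict_put[OF x])
  have "(\<Sum>y\<in>X. g y) = (\<Sum>y\<in>?Y. g y)"
  proof (rule sum.mono_neutral_right)
    show "\<forall>y\<in>X - ?Y. g y = 0"
    proof (intro ballI g)
      fix y assume y: "y \<in> X - ?Y"
      show "rat_embed n h x y = 0"
      proof (rule ccontr)
        assume "rat_embed n h x y \<noteq> 0"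
        then have "y = put bs (restrict_string y bs) x" using rat_embed_nonzero_put[OF x] y by simp
        then have "y \<in> ?Y" using restrict_in[of y] y by (intro image_eqI) auto
        then show False using y by blast
      qed
    qed blast
  qed (use put_in[OF x] in auto)
  then show ?thesis using sum.reindex[OF inj] by simp
qed

lemma local_operator_real: "local_operator h x y = complex_of_real (a x y)"
  by (simp add: local_operator_def of_real_of_rat)

lemma a_sym: "x \<in> Z \<Longrightarrow> y \<in> Z \<Longrightarrow> a y x = a x y"
  using valid unfolding valid_term_def between_0_and_I_def hermitian_def local_operator_real by auto

lemma a_offdiag: "x \<in> Z \<Longrightarrow> y \<in> Z \<Longrightarrow> x \<noteq> y \<Longrightarrow> a x y \<le> 0"
  using valid unfolding valid_term_def stoquastic_def local_operator_real by auto

lemma expectation_bounds: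
  assumes "v \<in> qspace q k"
  shows "0 \<le> Re (expectation q k (local_operator h) v)"
    "Re (expectation q k (local_operator h) v) \<le> Re (braket q k v v)"
  using valid assms unfolding valid_term_def between_0_and_I_def by auto

lemma real_form_bounds:
  assumes "W \<subseteq> Z"
  shows "0 \<le> (\<Sum>x\<in>W. \<Sum>y\<in>W. f x * a x y * f y)" "(\<Sum>x\<in>W. \<Sum>y\<in>W. f x * a x y * f y) \<le> (\<Sum>x\<in>W. f x * f x)"
proof -
  define v where "v x = complex_of_real (if x \<in> W then f x else 0)" for x
  have v: "v \<in> qspace q k" using assms by (auto simp: qspace_def v_def)
  have restrict: "(\<Sum>x\<in>Z. if x \<in> W then g x else 0) = (\<Sum>x\<in>W. g x)" for g :: "nat list \<Rightarrow> real"
    using assms by (simp add: sum.inter_restrict[symmetric] Int_absorb1)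
  have "expectation q k (local_operator h) v =
      complex_of_real (\<Sum>x\<in>Z. if x \<in> W then \<Sum>y\<in>Z. if y \<in> W then f x * a x y * f y else 0 else 0)"
    unfolding expectation_def braket_def qapply_def local_operator_real v_def of_real_sum
    by (intro sum.cong refl) (auto simp: sum_distrib_left intro!: sum.cong)
  then have 1: "Re (expectation q k (local_operator h) v) = (\<Sum>x\<in>W. \<Sum>y\<in>W. f x * a x y * f y)"
    unfolding restrict by simp
  have "braket q k v v = complex_of_real (\<Sum>x\<in>Z. if x \<in> W then f x * f x else 0)"
    unfolding braket_def v_def of_real_sum by (intro sum.cong) auto
  then have 2: "Re (braket q k v v) = (\<Sum>x\<in>W. f x * f x)" unfolding restrict by simp
  show "0 \<le> (\<Sum>x\<in>W. \<Sum>y\<in>W. f x * a x y * f y)" "(\<Sum>x\<in>W. \<Sum>y\<in>W. f x * a x y * f y) \<le> (\<Sum>x\<in>W. f x * f x)"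
    using expectation_bounds[OF v] unfolding 1 2 by auto
qed

lemma a_bound:
  assumes "x \<in> Z" "y \<in> Z"
  shows "\<bar>a x y\<bar> \<le> 1"
proof (cases "x = y")
  case True
  then show ?thesis using real_form_bounds[of "{x}" "\<lambda>_. 1"] assms by simp
next
  case False
  have s: "a y x = a x y" using a_sym assms by blast
  have "0 \<le> a x x" "0 \<le> a y y" using real_form_bounds(1)[of "{x}" "\<lambda>_. 1"] real_form_bounds(1)[of "{y}" "\<lambda>_. 1"] assms by simp_all
  \<comment> \<open>The sum and the difference of two basis vectors have squared norm 2; with
    nonnegative diagonal entries this bounds \<open>a x y\<close> from both sides.\<close>
  moreover have "a x x + a y y + 2 * a x y \<le> 2"
    using real_form_bounds(2)[of "{x, y}" "\<lambda>_. 1"] assms False s by simp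
  moreover have "a x x + a y y - 2 * a x y \<le> 2"
    using real_form_bounds(2)[of "{x, y}" "\<lambda>z. if z = x then 1 else - 1"] assms False s by simp
  ultimately show ?thesis by linarith
qed

lemma rat_embed_bound:
  assumes "x \<in> X" "y \<in> X"
  shows "\<bar>of_rat (rat_embed n h x y) :: real\<bar> \<le> 1"
  using a_bound[OF restrict_in[OF assms(1)] restrict_in[OF assms(2)]] by (simp add: rat_embed_def)

end


section \<open>Zero energy\<close>

lemma braket_self: "braket q n u u = complex_of_real (\<Sum>x\<in>qstrings q n. (cmod (u x))\<^sup>2)"
  unfolding braket_def of_real_sum by (intro sum.cong refl) (simp only: complex_norm_square mult.commute)

lemma braket_self_zero:
  assumes "u \<in> qspace q n" "Re (braket q n u u) \<le> 0"
  shows "u = (\<lambda>_. 0)"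
proof
  fix x
  have "(\<Sum>x\<in>qstrings q n. (cmod (u x))\<^sup>2) = 0"
    using assms(2) sum_nonneg[of "qstrings q n" "\<lambda>x. (cmod (u x))\<^sup>2"] by (simp add: braket_self)
  then show "u x = 0"
    using assms(1) by (cases "x \<in> qstrings q n") (auto simp: sum_nonneg_eq_0_iff qspace_def)
qed

lemma qapply_in: "qapply q n A v \<in> qspace q n"
  by (simp add: qapply_def qspace_def)

lemma subset_ket_alt:
  assumes "finite T"
  shows "subset_ket T y = (if y \<in> T then complex_of_real (1 / sqrt (card T)) else 0)"
  using assms by (simp add: subset_ket_def ket_def sum.delta)

lemma projector_entry:
  assumes "finite \<T>" "disjoint \<T>" "\<And>T. T \<in> \<T> \<Longrightarrow> finite T" "T \<in> \<T>" "x \<in> T"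
  shows "(\<Sum>T\<in>\<T>. ketbra (subset_ket T) (subset_ket T) x y) = (if y \<in> T then 1 / of_nat (card T) else 0)"
proof -
  have "ketbra (subset_ket T') (subset_ket T') x y = 0" if "T' \<in> \<T> - {T}" for T'
  proof -
    have "x \<notin> T'" using that assms disjointD[of \<T> T T'] by blast
    then show ?thesis using that assms by (simp add: ketbra_def subset_ket_alt)
  qed
  then have "(\<Sum>T\<in>\<T>. ketbra (subset_ket T) (subset_ket T) x y) = ketbra (subset_ket T) (subset_ket T) x y"
    using assms(1,4) by (subst sum.remove[of \<T> T]) (auto intro!: sum.neutral)
  moreover have "complex_of_real (1 / sqrt (card T)) * complex_of_real (1 / sqrt (card T)) = 1 / of_nat (card T)"
    unfolding of_real_mult[symmetric] by simp
  ultimately show ?thesis using assms by (simp add: ketbra_def subset_ket_alt)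
qed

context valid_local_term
begin

abbreviation A :: qoperator where "A \<equiv> local_operator h"

lemma braket_qapply_commute: "braket q k v (qapply q k A u) = braket q k (qapply q k A v) u"
proof -
  have "braket q k v (qapply q k A u) = (\<Sum>x\<in>Z. \<Sum>y\<in>Z. cnj (v x) * (a x y * u y))"
    unfolding braket_def by (intro sum.cong refl) (simp add: qapply_def sum_distrib_left local_operator_real)
  also have "\<dots> = (\<Sum>y\<in>Z. \<Sum>x\<in>Z. cnj (v x) * (a x y * u y))" by (rule sum.swap)
  also have "\<dots> = (\<Sum>y\<in>Z. \<Sum>x\<in>Z. cnj (a y x * v x) * u y)"
    by (intro sum.cong refl) (simp add: a_sym mult_ac)
  also have "\<dots> = braket q k (qapply q k A v) u"
    unfolding braket_def by (intro sum.cong refl) (simp add: qapply_def sum_distrib_right cnj_sum local_operator_real)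
  finally show ?thesis .
qed

text \<open>With \<open>u = A v\<close>, the vector \<open>v - u\<close> has energy
  \<open><v|A|v> - 2 <u|u> + <u|A|u>\<close>. This is at most \<open>- <u|u>\<close> because of
  \<open>A \<le> I\<close>, and positivity forces \<open>u = 0\<close>.\<close>

lemma kernel:
  assumes v: "v \<in> qspace q k" and "Re (expectation q k A v) = 0"
  shows "qapply q k A v = (\<lambda>_. 0)"
proof (rule braket_self_zero)
  define u where "u = qapply q k A v"
  define w where "w x = v x - u x" for x
  have u: "u \<in> qspace q k" unfolding u_def by (rule qapply_in)
  then have w: "w \<in> qspace q k" using v by (simp add: qspace_def w_def)
  have "qapply q k A w = (\<lambda>x. u x - qapply q k A u x)"
    by (auto simp: u_def qapply_def w_def fun_eq_iff algebra_simps sum_subtractf)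
  then have "expectation q k A w = braket q k v u - braket q k v (qapply q k A u) - braket q k u u + expectation q k A u"
    by (simp add: expectation_def braket_def w_def algebra_simps sum_subtractf sum.distrib)
  also have "braket q k v (qapply q k A u) = braket q k u u" by (simp add: braket_qapply_commute u_def)
  finally have "Re (expectation q k A w) = Re (expectation q k A v) - 2 * Re (braket q k u u) + Re (expectation q k A u)"
    by (simp add: expectation_def u_def)
  then show "Re (braket q k (qapply q k A v) (qapply q k A v)) \<le> 0"
    using expectation_bounds(1)[OF w] expectation_bounds(2)[OF u] assms(2) unfolding u_def[symmetric] by linarith
qed (rule qapply_in)

text \<open>Since no eigenvalue is negative, a single vector of zero energy identifies the
  groundspace in \<open>uniform_term\<close> with the kernel.\<close>

lemma ground_energy_zero:
  assumes v: "v \<in> qspace q k" "v \<noteq> (\<lambda>_. 0)" "qapply q k A v = (\<lambda>_. 0)"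
  shows "ground_energy q k A = 0"
  unfolding ground_energy_def
proof (rule Least_equality)
  show "is_eigenvalue q k A 0" unfolding is_eigenvalue_def using v by (intro bexI[of _ v]) auto
next
  fix \<mu> assume "is_eigenvalue q k A \<mu>"
  then obtain u where u: "u \<in> qspace q k" "u \<noteq> (\<lambda>_. 0)" "qapply q k A u = (\<lambda>x. complex_of_real \<mu> * u x)"
    unfolding is_eigenvalue_def by blast
  have "expectation q k A u = complex_of_real \<mu> * braket q k u u"
    by (simp add: expectation_def u(3) braket_def sum_distrib_left mult_ac)
  then have "0 \<le> \<mu> * Re (braket q k u u)" using expectation_bounds(1)[OF u(1)] by simp
  moreover have "0 < Re (braket q k u u)" using braket_self_zero[OF u(1)] u(2) by (meson not_le)
  ultimately show "0 \<le> \<mu>" by (simp add: zero_le_mult_iff)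
qed

text \<open>The projector of \<open>uniform_term\<close> averages a vector over each
  \<open>T\<close> and annihilates it elsewhere. It fixes \<open>v\<close>, so \<open>v\<close> is
  constant on the set \<open>T\<close> that contains \<open>z0\<close>. It also fixes the indicator
  of \<open>T\<close>, which therefore lies in the kernel; this is the claim about row sums over
  \<open>T\<close>.\<close>

lemma kernel_component:
  assumes v: "v \<in> qspace q k" "Re (expectation q k A v) = 0" and z0: "v z0 \<noteq> 0"
  shows "\<exists>T\<subseteq>Z. z0 \<in> T \<and> (\<forall>z\<in>T. v z = v z0) \<and> (\<forall>z\<in>Z. (\<Sum>y\<in>T. a z y) = 0)"
proof -
  have Av: "qapply q k A v = (\<lambda>_. 0)" by (rule kernel[OF v])
  have "v \<noteq> (\<lambda>_. 0)" using z0 by auto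
  from ground_energy_zero[OF v(1) this Av]
  have ground: "u \<in> groundspace q k A \<longleftrightarrow> u \<in> qspace q k \<and> qapply q k A u = (\<lambda>_. 0)" for u
    by (simp add: groundspace_def)
  define P where "P \<T> x y = (\<Sum>T\<in>\<T>. ketbra (subset_ket T) (subset_ket T) x y)" for \<T> x y
  have "uniform_term q k A" using valid by (simp add: valid_term_def)
  then obtain \<T> where \<T>': "\<forall>T\<in>\<T>. T \<noteq> {} \<and> T \<subseteq> Z" "disjoint \<T>"
    "is_projector_onto q k (\<lambda>x y. \<Sum>T\<in>\<T>. ketbra (subset_ket T) (subset_ket T) x y) (groundspace q k A)"
    unfolding uniform_term_def by (elim exE conjE)
  have \<T>: "\<And>T. T \<in> \<T> \<Longrightarrow> T \<noteq> {} \<and> T \<subseteq> Z" "disjoint \<T>" using \<T>'(1,2) by blast+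
  have proj: "is_projector_onto q k (P \<T>) (groundspace q k A)"
    unfolding P_def[abs_def] by (rule \<T>'(3))
  have fin: "finite T" if "T \<in> \<T>" for T
    by (rule finite_subset[of _ Z]) (use \<T>(1)[OF that] in auto)
  have "\<T> \<subseteq> Pow Z" using \<T>(1) by blast
  then have fin\<T>: "finite \<T>" by (rule finite_subset) simp
  have image: "qapply q k (P \<T>) ` qspace q k = groundspace q k A"
    and idem: "\<And>u. u \<in> qspace q k \<Longrightarrow> qapply q k (P \<T>) (qapply q k (P \<T>) u) = qapply q k (P \<T>) u"
    using proj unfolding is_projector_onto_def by auto
  have P_in: "qapply q k (P \<T>) u x = (\<Sum>y\<in>T. u y) / of_nat (card T)" if "T \<in> \<T>" "x \<in> T" for u T x
  proof -
    have "x \<in> Z" "T \<subseteq> Z" using \<T>(1) that by auto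
    then have "qapply q k (P \<T>) u x = (\<Sum>y\<in>Z. if y \<in> T then u y / of_nat (card T) else 0)"
      unfolding qapply_def P_def using projector_entry[OF fin\<T> \<T>(2) fin that]
      by (auto intro!: sum.cong)
    also have "\<dots> = (\<Sum>y\<in>T. u y / of_nat (card T))"
      using \<open>T \<subseteq> Z\<close> by (simp add: sum.inter_restrict[symmetric] Int_absorb1)
    finally show ?thesis by (simp add: sum_divide_distrib)
  qed
  have P_out: "qapply q k (P \<T>) u x = 0" if "\<And>T. T \<in> \<T> \<Longrightarrow> x \<notin> T" for u x
    using that fin by (simp add: qapply_def P_def ketbra_def subset_ket_alt)
  have "v \<in> qapply q k (P \<T>) ` qspace q k" unfolding image ground using v(1) Av by simp
  then have Pv: "qapply q k (P \<T>) v = v" using idem by auto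
  obtain T where T: "T \<in> \<T>" "z0 \<in> T" using P_out[of z0 v] Pv z0 by auto
  have TZ: "T \<subseteq> Z" using \<T>(1) T by blast
  have const: "v z = v z0" if "z \<in> T" for z
    using P_in[OF T(1) that, of v] P_in[OF T, of v] Pv by simp
  define t where "t y = (if y \<in> T then 1 else 0 :: complex)" for y
  have t: "t \<in> qspace q k" using TZ by (auto simp: qspace_def t_def)
  have "qapply q k (P \<T>) t x = t x" for x
  proof (cases "\<exists>T'\<in>\<T>. x \<in> T'")
    case True
    then obtain T' where T': "T' \<in> \<T>" "x \<in> T'" by blast
    show ?thesis
    proof (cases "T' = T")
      case True
      have "card T \<noteq> 0" using T fin by auto
      then show ?thesis using P_in[OF T', of t] T' True by (simp add: t_def)
    next
      case False
      then have disj: "T' \<inter> T = {}" using disjointD[OF \<T>(2) T'(1) T(1)] by blast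
      then have "(\<Sum>y\<in>T'. t y) = 0" by (intro sum.neutral) (auto simp: t_def)
      then show ?thesis using P_in[OF T', of t] T' disj by (auto simp: t_def)
    qed
  next
    case False
    then show ?thesis using P_out[of x t] T by (auto simp: t_def)
  qed
  then have "t = qapply q k (P \<T>) t" by auto
  then have "t \<in> groundspace q k A" unfolding image[symmetric] using t by (rule image_eqI)
  then have At: "qapply q k A t = (\<lambda>_. 0)" unfolding ground by blast
  have "(\<Sum>y\<in>T. a z y) = 0" if "z \<in> Z" for z
  proof -
    have "0 = (\<Sum>y\<in>Z. complex_of_real (a z y) * t y)"
      using fun_cong[OF At, of z] that by (simp add: qapply_def local_operator_real)
    also have "\<dots> = (\<Sum>y\<in>Z. if y \<in> T then complex_of_real (a z y) else 0)"
      by (intro sum.cong) (auto simp: t_def)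
    also have "\<dots> = complex_of_real (\<Sum>y\<in>T. a z y)"
      using TZ by (simp add: sum.inter_restrict[symmetric] Int_absorb1)
    finally show ?thesis by (metis of_real_eq_0_iff)
  qed
  then show ?thesis using TZ T const by blast
qed

text \<open>Stoquasticity isolates \<open>T\<close>: for \<open>y\<close> outside it the entries
  \<open>a y x\<close> with \<open>x\<close> in \<open>T\<close> are nonpositive and sum to 0, so
  all of them vanish. Hence row \<open>z0\<close> lives on \<open>T\<close>, where \<open>v\<close>
  is constant.\<close>

lemma kernel_row:
  assumes v: "v \<in> qspace q k" "Re (expectation q k A v) = 0" and z0: "v z0 \<noteq> 0"
  shows "(\<Sum>y\<in>Z. a z0 y) = 0" "\<And>y. y \<in> Z \<Longrightarrow> a z0 y \<noteq> 0 \<Longrightarrow> v y = v z0"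
proof -
  obtain T where T: "T \<subseteq> Z" "z0 \<in> T" "\<forall>z\<in>T. v z = v z0" "\<forall>z\<in>Z. (\<Sum>y\<in>T. a z y) = 0"
    using kernel_component[OF assms] by blast
  have fin: "finite T" by (rule finite_subset[OF T(1)]) simp
  have out: "a z0 y = 0" if y: "y \<in> Z" "y \<notin> T" for y
  proof -
    have "\<forall>x\<in>T. - a y x = 0"
    proof (subst sum_nonneg_eq_0_iff[symmetric])
      show "\<And>x. x \<in> T \<Longrightarrow> 0 \<le> - a y x" using a_offdiag[OF y(1)] T(1) y(2) by fastforce
      show "(\<Sum>x\<in>T. - a y x) = 0" using T(4) y(1) by (simp add: sum_negf)
    qed (rule fin)
    then show ?thesis using T(1,2) a_sym[of z0 y] y(1) by auto
  qed
  have "(\<Sum>y\<in>Z. a z0 y) = (\<Sum>y\<in>T. a z0 y)" by (rule sum.mono_neutral_right) (use T out in auto)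
  then show "(\<Sum>y\<in>Z. a z0 y) = 0" using T by auto
  show "\<And>y. y \<in> Z \<Longrightarrow> a z0 y \<noteq> 0 \<Longrightarrow> v y = v z0" using out T(3) by blast
qed

abbreviation slice :: "qvector \<Rightarrow> nat list \<Rightarrow> qvector" where
  "slice \<psi> x \<equiv> (\<lambda>z. if z \<in> Z then \<psi> (put bs z x) else 0)"

text \<open>The energy splits over the slices of \<psi> obtained by fixing the letters off
  \<open>bs\<close>. Summing over all strings \<open>x\<close> counts each slice once for every
  choice of letters on \<open>bs\<close>, hence the factor.\<close>

lemma embedded_expectation:
  "of_nat (card Z) * expectation q n (embedded_operator n h) \<psi> = (\<Sum>x\<in>X. expectation q k A (slice \<psi> x))"
proof -
  define F where "F x = cnj (\<psi> x) * (\<Sum>z\<in>Z. a (restrict_string x bs) z * \<psi> (put bs z x))" for x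
  have "(\<Sum>y\<in>X. embedded_operator n h x y * \<psi> y) = (\<Sum>z\<in>Z. a (restrict_string x bs) z * \<psi> (put bs z x))"
    if "x \<in> X" for x
    using sum_rat_embed[OF that, of "\<lambda>y. embedded_operator n h x y * \<psi> y"] that
    by (simp add: embedded_operator_rat rat_embed_put of_real_of_rat)
  then have 1: "expectation q n (embedded_operator n h) \<psi> = (\<Sum>x\<in>X. F x)"
    unfolding expectation_def braket_def F_def by (intro sum.cong refl) (simp add: qapply_def)
  have 2: "expectation q k A (slice \<psi> x) = (\<Sum>z'\<in>Z. F (put bs z' x))" if "x \<in> X" for x
    unfolding expectation_def braket_def F_def
    by (intro sum.cong refl)
      (simp add: qapply_def local_operator_real restrict_put put_put that cong: sum.cong)
  have "(\<Sum>x\<in>X. \<Sum>z'\<in>Z. F (put bs z' x)) = (\<Sum>(x, z')\<in>X \<times> Z. F (put bs z' x))"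
    by (rule sum.cartesian_product)
  \<comment> \<open>The reindexing is an involution: it exchanges the letters of the string on
    \<open>bs\<close> with the second component.\<close>
  also have "\<dots> = (\<Sum>(y, z)\<in>X \<times> Z. F y)"
    by (rule sum.reindex_bij_witness[of _ "\<lambda>(y, z). (put bs z y, restrict_string y bs)"
          "\<lambda>(y, z). (put bs z y, restrict_string y bs)"])
      (auto simp: restrict_put put_put put_restrict put_in restrict_in)
  also have "\<dots> = of_nat (card Z) * (\<Sum>x\<in>X. F x)"
    by (simp add: sum.cartesian_product[symmetric] sum_distrib_left)
  finally show ?thesis unfolding 1 using 2 by simp
qed

lemma slice_in: "slice \<psi> x \<in> qspace q k"
  by (simp add: qspace_def)

lemma card_Z: "card Z = q ^ k" "0 < card Z"
  using q by (auto simp: card_qstrings)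

lemma embedded_nonneg: "0 \<le> Re (expectation q n (embedded_operator n h) \<psi>)"
proof -
  have "real (card Z) * Re (expectation q n (embedded_operator n h) \<psi>) =
      (\<Sum>x\<in>X. Re (expectation q k A (slice \<psi> x)))"
    using arg_cong[OF embedded_expectation[of \<psi>], of Re] by simp
  moreover have "0 \<le> (\<Sum>x\<in>X. Re (expectation q k A (slice \<psi> x)))"
    by (intro sum_nonneg expectation_bounds(1) slice_in)
  ultimately have "0 \<le> real (card Z) * Re (expectation q n (embedded_operator n h) \<psi>)" by simp
  then show ?thesis using card_Z(2) by (auto simp: zero_le_mult_iff)
qed

text \<open>All slices have nonnegative energy, so zero energy passes to the slice through
  \<open>x\<close>, to which \<open>kernel_row\<close> applies.\<close>

lemma embedded_kernel:
  assumes "Re (expectation q n (embedded_operator n h) \<psi>) = 0" "x \<in> X" "\<psi> x \<noteq> 0"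
  shows "(\<Sum>y\<in>X. of_rat (rat_embed n h x y) :: real) = 0"
    "\<And>y. y \<in> X \<Longrightarrow> rat_embed n h x y \<noteq> 0 \<Longrightarrow> \<psi> y = \<psi> x"
proof -
  have "(\<Sum>x\<in>X. Re (expectation q k A (slice \<psi> x))) = 0"
    using arg_cong[OF embedded_expectation[of \<psi>], of Re] assms(1) by simp
  then have zero: "Re (expectation q k A (slice \<psi> x)) = 0"
    using assms(2) expectation_bounds(1)[OF slice_in] by (simp add: sum_nonneg_eq_0_iff)
  let ?z = "restrict_string x bs"
  have z: "?z \<in> Z" "slice \<psi> x ?z = \<psi> x" using restrict_in[OF assms(2)] put_restrict[OF assms(2)] by auto
  note row = kernel_row[OF slice_in zero, of ?z, unfolded z(2), OF assms(3)]
  have "(\<Sum>y\<in>X. of_rat (rat_embed n h x y) :: real) = (\<Sum>y\<in>Z. a ?z y)"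
    using sum_rat_embed[OF assms(2), of "\<lambda>y. of_rat (rat_embed n h x y) :: real"] assms(2)
    by (simp add: rat_embed_put)
  then show "(\<Sum>y\<in>X. of_rat (rat_embed n h x y) :: real) = 0" using row(1) by simp
  fix y assume y: "y \<in> X" "rat_embed n h x y \<noteq> 0"
  let ?y = "restrict_string y bs"
  have "put bs ?y x = y" by (rule rat_embed_nonzero_put[OF assms(2) y])
  moreover have "a ?z ?y \<noteq> 0" using y(2) by (auto simp: rat_embed_def split: if_splits)
  ultimately show "\<psi> y = \<psi> x" using row(2)[OF restrict_in[OF y(1)]] restrict_in[OF y(1)] by simp
qed

end


section \<open>Rounded rows and their locality\<close>

definition mix :: "nat set \<Rightarrow> nat list \<Rightarrow> nat list \<Rightarrow> nat list" where
  "mix B x u = map (\<lambda>b. if b \<in> B then u ! b else x ! b) [0..<length x]"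

lemma mix_in: "x \<in> qstrings q n \<Longrightarrow> u \<in> qstrings q n \<Longrightarrow> mix B x u \<in> qstrings q n"
  using qstrings_nth[of x q n] qstrings_nth[of u q n] by (auto simp: mix_def qstrings_def[of q n])

lemma mix_nth: "x \<in> qstrings q n \<Longrightarrow> b < n \<Longrightarrow> mix B x u ! b = (if b \<in> B then u ! b else x ! b)"
  by (simp add: mix_def qstrings_def)

lemma qstrings_eqI: "x \<in> qstrings q n \<Longrightarrow> y \<in> qstrings q n \<Longrightarrow> (\<And>b. b < n \<Longrightarrow> x ! b = y ! b) \<Longrightarrow> x = y"
  by (auto simp: qstrings_def intro!: nth_equalityI)

lemma mix_insert: "x \<in> qstrings q n \<Longrightarrow> b < n \<Longrightarrow> mix (insert b B) x u = (mix B x u)[b := u ! b]"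
  by (rule nth_equalityI) (auto simp: mix_def nth_list_update qstrings_def)

lemma level_nonzero: "level K v \<noteq> 0 \<Longrightarrow> v \<noteq> 0"
  by auto

context valid_local_term
begin

abbreviation e :: "nat list \<Rightarrow> nat list \<Rightarrow> real" where
  "e x y \<equiv> of_rat (rat_embed n h x y)"

abbreviation lv :: "nat \<Rightarrow> nat list \<Rightarrow> nat list \<Rightarrow> int" where
  "lv K x y \<equiv> level K (rat_embed n h x y)"

text \<open>At most \<open>card Z\<close> entries of a row are nonzero, and each is rounded with an
  error below 1.\<close>

lemma level_row:
  assumes x: "x \<in> X"
  shows "\<bar>of_int (\<Sum>y\<in>X. lv K x y) - K * (\<Sum>y\<in>X. e x y)\<bar> < card Z"
proof -
  let ?l = "\<lambda>z. real_of_int (level K (rat_embed n h x (put bs z x)))" and ?e = "\<lambda>z. e x (put bs z x)"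
  have "of_int (\<Sum>y\<in>X. lv K x y) - K * (\<Sum>y\<in>X. e x y) = (\<Sum>z\<in>Z. ?l z - K * ?e z)"
    using sum_rat_embed[OF x, of "\<lambda>y. lv K x y"] sum_rat_embed[OF x, of "\<lambda>y. e x y"]
    by (simp add: sum_subtractf sum_distrib_left)
  also have "\<bar>\<dots>\<bar> \<le> (\<Sum>z\<in>Z. \<bar>?l z - K * ?e z\<bar>)" by (rule sum_abs)
  also have "\<dots> < (\<Sum>z\<in>Z. 1)"
    using card_Z(2) by (intro sum_strict_mono level_error rat_embed_bound x put_in) auto
  finally show ?thesis by simp
qed

lemma level_row_zero:
  assumes "x \<in> X" "(\<Sum>y\<in>X. e x y) = 0"
  shows "(\<Sum>y\<in>X. lv K x y) < card Z"
proof -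
  have "real_of_int (\<Sum>y\<in>X. lv K x y) < real_of_int (int (card Z))"
    using level_row[OF assms(1), of K] assms(2) by simp
  then show ?thesis by (simp only: of_int_less_iff)
qed

text \<open>The sum over \<open>S\<close> is the row sum minus the part outside \<open>S\<close>. In
  the row sum the rounded sum and the rounding error contribute \<open>card Z / K\<close> each.
  Outside \<open>S\<close> the entries rounded to 0 contribute a third such summand; if some entry
  there is not rounded to 0, the trivial bound \<open>card Z\<close> on all of them is
  added.\<close>

lemma inner_row_bound:
  assumes S: "S \<subseteq> X" and x: "x \<in> S" and K: "1 \<le> K"
    and row: "(\<Sum>y\<in>X. lv K x y) < card Z"
  shows "(\<Sum>y\<in>S. e x y) \<le> 3 * card Z / K +
    (if \<exists>y. y \<in> X \<and> y \<notin> S \<and> lv K x y \<noteq> 0 then card Z else 0)"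
    (is "_ \<le> _ + ?c")
proof -
  have xX: "x \<in> X" using S x by blast
  have ne: "Z \<noteq> {}" using card_Z(2) by auto
  have "real_of_int (\<Sum>y\<in>X. lv K x y) < card Z"
    using row by (metis of_int_less_iff of_int_of_nat_eq)
  then have "K * (\<Sum>y\<in>X. e x y) \<le> 2 * card Z" using level_row[OF xX, of K] by linarith
  then have all: "(\<Sum>y\<in>X. e x y) \<le> 2 * card Z / K" using K by (simp add: pos_le_divide_eq mult.commute)
  have "- (\<Sum>y\<in>X - S. e x y) \<le> (\<Sum>y\<in>X - S. \<bar>e x y\<bar>)"
    unfolding sum_negf[symmetric] by (intro sum_mono abs_ge_minus_self)
  also have "\<dots> = (\<Sum>y\<in>X. if y \<in> S then 0 else \<bar>e x y\<bar>)"
    by (rule sum.mono_neutral_cong_left) auto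
  also have "\<dots> = (\<Sum>z\<in>Z. if put bs z x \<in> S then 0 else \<bar>e x (put bs z x)\<bar>)"
    by (rule sum_rat_embed[OF xX]) simp
  also have "\<dots> \<le> card Z * (1 / K + ?c / card Z)"
  proof -
    have "(if put bs z x \<in> S then 0 else \<bar>e x (put bs z x)\<bar>) \<le> 1 / K + ?c / card Z" if z: "z \<in> Z" for z
    proof (cases "put bs z x \<in> S")
      case False
      let ?y = "put bs z x"
      have y: "?y \<in> X" using put_in[OF xX z] .
      show ?thesis
      proof (cases "lv K x ?y = 0")
        case True
        then have "K * \<bar>e x ?y\<bar> \<le> 1" using level_error[OF rat_embed_bound[OF xX y], of K] by (simp add: abs_mult)
        then have "\<bar>e x ?y\<bar> \<le> 1 / K" using K by (simp add: pos_le_divide_eq mult.commute)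
        then show ?thesis using False by (simp add: add_increasing2)
      next
        case nz: False
        then have "?c = card Z" using False y by auto
        then have "?c / card Z = 1" using ne by simp
        then show ?thesis using rat_embed_bound[OF xX y] False by (simp add: add_increasing)
      qed
    qed simp
    then show ?thesis using sum_bounded_above[of Z _ "1 / K + ?c / card Z"] by simp
  qed
  also have "\<dots> = card Z / K + ?c" using ne by (simp add: distrib_left)
  finally have "- (\<Sum>y\<in>X - S. e x y) \<le> card Z / K + ?c" .
  moreover have "(\<Sum>y\<in>S. e x y) = (\<Sum>y\<in>X. e x y) - (\<Sum>y\<in>X - S. e x y)"
    using sum.subset_diff[OF S, of "e x"] by simp
  ultimately show ?thesis using all by (simp add: add_divide_distrib)
qed

section \<open>Locality with respect to the qudits of nontrivial action\<close>

abbreviation trivial :: "nat \<Rightarrow> bool" where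
  "trivial b \<equiv> acts_trivially_on q n (embedded_operator n h) b"

lemma trivialE:
  assumes "trivial b"
  obtains B :: "nat list \<Rightarrow> nat list \<Rightarrow> complex" where "\<And>x y. x \<in> X \<Longrightarrow> y \<in> X \<Longrightarrow>
    of_rat (rat_embed n h x y) = (if x ! b = y ! b then B (delete_position b x) (delete_position b y) else 0)"
  using assms unfolding acts_trivially_on_def embedded_operator_rat by blast

lemma trivial_zero: "trivial b \<Longrightarrow> x \<in> X \<Longrightarrow> y \<in> X \<Longrightarrow> x ! b \<noteq> y ! b \<Longrightarrow> rat_embed n h x y = 0"
  by (elim trivialE) (metis of_rat_eq_0_iff)

lemma trivial_update:
  assumes "trivial b" "x \<in> X" "y \<in> X" "x ! b = y ! b" "v < q" "b < n"
  shows "rat_embed n h (x[b := v]) (y[b := v]) = rat_embed n h x y"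
proof -
  obtain B :: "nat list \<Rightarrow> nat list \<Rightarrow> complex" where B: "\<And>x y. x \<in> X \<Longrightarrow> y \<in> X \<Longrightarrow>
    of_rat (rat_embed n h x y) = (if x ! b = y ! b then B (delete_position b x) (delete_position b y) else 0)"
    by (rule trivialE[OF assms(1)]) blast
  have "delete_position b (x[b := v]) = delete_position b x" for x by (simp add: delete_position_def)
  moreover have "x[b := v] ! b = v" "y[b := v] ! b = v" using assms by (auto simp: qstrings_def)
  ultimately have "(of_rat (rat_embed n h (x[b := v]) (y[b := v])) :: complex) = of_rat (rat_embed n h x y)"
    using B[of "x[b := v]" "y[b := v]"] B[of x y] assms qstrings_update by simp
  then show ?thesis by (simp only: of_rat_eq_iff)
qed

lemma trivial_off_qudits:
  assumes "b < n" "b \<notin> set bs"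
  shows "trivial b"
  unfolding acts_trivially_on_def
proof (intro exI ballI)
  \<comment> \<open>The witness restores the deleted letter as 0; an entry does not change when a
    letter common to both strings is replaced at a position off \<open>bs\<close>.\<close>
  let ?ins = "\<lambda>x. take b x @ 0 # drop b x"
  fix x y assume xy: "x \<in> X" "y \<in> X"
  have ins: "?ins (delete_position b x) = x[b := 0]" if "x \<in> X" for x
    using that assms(1) by (simp add: delete_position_def upd_conv_take_nth_drop qstrings_def)
  have len: "length x = n" "length y = n" using xy by (auto simp: qstrings_def)
  have restrict: "restrict_string (x[b := 0]) bs = restrict_string x bs" for x
    using assms(2) by (auto simp: restrict_string_def intro!: nth_list_update_neq)
  have "rat_embed n h (x[b := 0]) (y[b := 0]) = rat_embed n h x y" if "x ! b = y ! b"
  proof -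
    have "(\<forall>c<n. c \<notin> set bs \<longrightarrow> x[b := 0] ! c = y[b := 0] ! c) = (\<forall>c<n. c \<notin> set bs \<longrightarrow> x ! c = y ! c)"
      using that len assms(1) by (simp add: nth_list_update) metis
    then show ?thesis by (simp only: rat_embed_def restrict)
  qed
  moreover have "rat_embed n h x y = 0" if "x ! b \<noteq> y ! b" using that assms by (auto simp: rat_embed_def)
  ultimately show "embedded_operator n h x y = (if x ! b = y ! b
      then (\<lambda>x y. embedded_operator n h (?ins x) (?ins y)) (delete_position b x) (delete_position b y) else 0)"
    using xy by (simp add: ins embedded_operator_rat)
qed

text \<open>Possibly smaller than the set of listed qudits. The degree bound speaks only about
  nontrivial action, so the locality of edges and bad strings has to be established for this
  set.\<close>

definition support :: "nat set" where
  "support = {b. b < n \<and> \<not> trivial b}"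

lemma support: "support \<subseteq> {..<n}" "card support \<le> k"
proof -
  show "support \<subseteq> {..<n}" by (auto simp: support_def)
  have "support \<subseteq> set bs" using trivial_off_qudits by (auto simp: support_def)
  then have "card support \<le> card (set bs)" by (rule card_mono[rotated]) simp
  then show "card support \<le> k" using bs by (simp add: distinct_card)
qed

lemma agree_off_support:
  assumes "x \<in> X" "y \<in> X" "rat_embed n h x y \<noteq> 0"
  shows "agree ({..<n} - support) x y"
  using assms trivial_zero by (auto simp: agree_def support_def)

text \<open>One qudit at a time: where the action is trivial, a letter common to row and column can
  be replaced in both without changing the entry.\<close>

lemma rat_embed_mix:
  assumes "B \<subseteq> {..<n} - support" "x \<in> X" "y \<in> X" "u \<in> X" "agree B x y"
  shows "rat_embed n h (mix B x u) (mix B y u) = rat_embed n h x y"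
proof -
  have "finite B" using assms(1) by (rule finite_subset) simp
  then show ?thesis using assms(1,5)
  proof (induction B)
    case empty
    have "mix {} x u = x" for x by (simp add: mix_def map_nth)
    then show ?case by simp
  next
    case (insert b B)
    then have b: "b < n" "trivial b" "agree B x y" "x ! b = y ! b" by (auto simp: support_def agree_def)
    have "mix B x u ! b = mix B y u ! b"
      using insert.hyps b assms by (simp add: mix_nth[of x q n] mix_nth[of y q n])
    then have "rat_embed n h ((mix B x u)[b := u ! b]) ((mix B y u)[b := u ! b]) = rat_embed n h (mix B x u) (mix B y u)"
      using b assms by (intro trivial_update mix_in qstrings_nth) auto
    then show ?case using insert b assms by (simp add: mix_insert[of _ q n])
  qed
qed

lemma mix_self:
  assumes "x \<in> X" "u \<in> X" "agree ({..<n} - B) x u"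
  shows "mix B x u = u"
  by (rule qstrings_eqI[OF mix_in[OF assms(1,2)] assms(2)])
    (use assms in \<open>auto simp: mix_nth[of x q n] agree_def\<close>)

text \<open>Nonzero entries of row \<open>x\<close> sit at strings that agree with \<open>x\<close>
  off the support. Replacing this common part by that of \<open>x'\<close> matches them with the
  corresponding entries of row \<open>x'\<close>.\<close>

lemma level_row_local:
  assumes x: "x \<in> X" "x' \<in> X" "agree support x x'"
  shows "(\<Sum>y\<in>X. lv K x' y) = (\<Sum>y\<in>X. lv K x y)"
proof -
  let ?B = "{..<n} - support"
  have red: "(\<Sum>y\<in>X. lv K x y) = (\<Sum>y\<in>{y \<in> X. agree ?B x y}. lv K x y)"
    if "x \<in> X" for x
    by (rule sum.mono_neutral_right) (auto intro: agree_off_support[OF that] level_nonzero)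
  have *: "mix ?B (mix ?B y x') x = y \<and> mix ?B y x' \<in> X \<and> agree ?B x' (mix ?B y x') \<and>
      rat_embed n h x' (mix ?B y x') = rat_embed n h x y"
    if "x \<in> X" "x' \<in> X" "agree support x x'" "y \<in> X" "agree ?B x y" for x x' y
  proof (intro conjI)
    have m: "mix ?B y x' \<in> X" using that by (intro mix_in)
    then show "mix ?B y x' \<in> X" .
    show "mix ?B (mix ?B y x') x = y"
      by (rule qstrings_eqI[OF mix_in[OF m that(1)] that(4)])
        (use that(5) in \<open>auto simp: mix_nth[OF m] mix_nth[OF that(4)] agree_def\<close>)
    show "agree ?B x' (mix ?B y x')" by (auto simp: agree_def mix_nth[OF that(4)])
    have "mix ?B x x' = x'"
      by (rule mix_self[OF that(1,2)]) (rule agree_mono[OF that(3)], auto)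
    then show "rat_embed n h x' (mix ?B y x') = rat_embed n h x y"
      using rat_embed_mix[of ?B x y x'] that by simp
  qed
  show ?thesis unfolding red[OF x(1)] red[OF x(2)]
    by (rule sum.reindex_bij_witness[of _ "\<lambda>y. mix ?B y x'" "\<lambda>y. mix ?B y x"])
      (use *[OF x] *[OF x(2,1) agree_sym[OF x(3)]] in auto)
qed

lemma level_edge_local:
  assumes "x \<in> X" "y \<in> X" "x' \<in> X" "agree support x x'" "x \<noteq> y" "lv K x y \<noteq> 0"
  shows "\<exists>y'\<in>X. x' \<noteq> y' \<and> lv K x' y' \<noteq> 0 \<and> agree support y y'"
proof -
  let ?B = "{..<n} - support"
  let ?y = "mix ?B y x'"
  have off: "agree ?B x y" using agree_off_support[OF assms(1,2) level_nonzero[OF assms(6)]] .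
  have y: "?y \<in> X" using assms by (intro mix_in)
  have on: "agree support y ?y" using support(1) by (auto simp: agree_def mix_nth[OF assms(2)])
  have "mix ?B x x' = x'"
    by (rule mix_self[OF assms(1,3)]) (rule agree_mono[OF assms(4)], auto)
  then have "rat_embed n h x' ?y = rat_embed n h x y"
    using rat_embed_mix[of ?B x y x'] assms off by simp
  moreover have "x' \<noteq> ?y"
  proof
    assume "x' = ?y"
    then have "agree support x y" using assms(4) on by (auto simp: agree_def)
    then have "x = y" using off by (intro qstrings_eqI[OF assms(1,2)]) (auto simp: agree_def)
    then show False using assms(5) by blast
  qed
  ultimately show ?thesis using y on assms(6) by (intro bexI[of _ ?y]) simp_all
qed

lemma card_level_edge:
  assumes "y \<in> X"
  shows "card {x \<in> X. lv K x y \<noteq> 0} \<le> q ^ k"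
proof -
  have "{x \<in> X. lv K x y \<noteq> 0} \<subseteq> (\<lambda>z. put bs z y) ` Z"
  proof
    fix x assume "x \<in> {x \<in> X. lv K x y \<noteq> 0}"
    then have x: "x \<in> X" "rat_embed n h x y \<noteq> 0" by auto
    then have "put bs (restrict_string x bs) y = x"
      using assms by (intro put_eqI restrict_in) (auto simp: rat_embed_def split: if_splits)
    then show "x \<in> (\<lambda>z. put bs z y) ` Z" using restrict_in[OF x(1)] by (metis image_eqI)
  qed
  then have "card {x \<in> X. lv K x y \<noteq> 0} \<le> card ((\<lambda>z. put bs z y) ` Z)"
    by (rule card_mono[rotated]) simp
  also have "\<dots> \<le> card Z" by (rule card_image_le) simp
  finally show ?thesis by (simp add: card_Z)
qed

end


section \<open>Instances\<close>

lemma expectation_hamiltonian: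
  "expectation q (num_qudits I) (hamiltonian I) \<psi> =
    (1 / of_nat (length (ham_terms I))) *
    (\<Sum>i<length (ham_terms I). expectation q (num_qudits I) (embedded_operator (num_qudits I) (ham_terms I ! i)) \<psi>)"
proof -
  let ?X = "qstrings q (num_qudits I)" and ?m = "length (ham_terms I)"
    and ?E = "\<lambda>i. embedded_operator (num_qudits I) (ham_terms I ! i)"
  have "expectation q (num_qudits I) (hamiltonian I) \<psi> =
      (\<Sum>x\<in>?X. \<Sum>y\<in>?X. \<Sum>i<?m. (1 / of_nat ?m) * (cnj (\<psi> x) * (?E i x y * \<psi> y)))"
    unfolding expectation_def braket_def hamiltonian_def
    by (intro sum.cong refl) (simp add: qapply_def sum_distrib_left sum_distrib_right mult_ac)
  also have "\<dots> = (\<Sum>x\<in>?X. \<Sum>i<?m. \<Sum>y\<in>?X. (1 / of_nat ?m) * (cnj (\<psi> x) * (?E i x y * \<psi> y)))"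
    by (intro sum.cong refl sum.swap)
  also have "\<dots> = (\<Sum>i<?m. \<Sum>x\<in>?X. \<Sum>y\<in>?X. (1 / of_nat ?m) * (cnj (\<psi> x) * (?E i x y * \<psi> y)))"
    by (rule sum.swap)
  also have "\<dots> = (\<Sum>i<?m. (1 / of_nat ?m) * (\<Sum>x\<in>?X. cnj (\<psi> x) * (\<Sum>y\<in>?X. ?E i x y * \<psi> y)))"
    by (simp only: sum_distrib_left)
  also have "\<dots> = (1 / of_nat ?m) * (\<Sum>i<?m. expectation q (num_qudits I) (?E i) \<psi>)"
    unfolding sum_distrib_left[symmetric] expectation_def braket_def
    by (intro arg_cong2[of _ _ _ _ "(*)"] sum.cong refl) (simp add: qapply_def)
  finally show ?thesis .
qed

text \<open>The tuple of terms does not reveal which qudits it uses, so a qudit is named by a slot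
  \<open>b\<close> and a position \<open>j\<close>. Its letter at time \<open>t\<close> is the one
  written last by an earlier slot that lists the same qudit, or 0 if there is none. For valid terms
  \<open>j'\<close> is unique, their qudits being distinct.\<close>

fun virtual_letter :: "(nat \<Rightarrow> nat \<Rightarrow> nat \<Rightarrow> nat \<Rightarrow> bool) \<Rightarrow> (nat \<Rightarrow> nat list) \<Rightarrow> nat \<Rightarrow> nat \<Rightarrow> nat \<Rightarrow> nat" where
  "virtual_letter same zs 0 b j = 0"
| "virtual_letter same zs (Suc t) b j =
    (if \<exists>j'. same t j' b j then zs t ! (SOME j'. same t j' b j) else virtual_letter same zs t b j)"

definition view :: "nat \<Rightarrow> (nat \<Rightarrow> nat \<Rightarrow> nat \<Rightarrow> nat \<Rightarrow> bool) \<Rightarrow> (nat \<Rightarrow> nat list) \<Rightarrow> nat \<Rightarrow> nat \<Rightarrow> nat list" where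
  "view k same zs t b = map (virtual_letter same zs t b) [0..<k]"

text \<open>
  The tuple of terms in slots \<open>0..R\<close> admits a walk from the all-zero string, in which the term in
  slot \<open>t\<close> makes the \<open>t\<close>-th move, to a string that is bad for the term in slot \<open>R\<close>. Only the
  coincidences among the qudits of the terms and the rounded matrices are used.
\<close>

definition refuted :: "nat \<Rightarrow> nat \<Rightarrow> nat \<Rightarrow> (nat \<Rightarrow> nat \<Rightarrow> nat \<Rightarrow> nat \<Rightarrow> bool) \<Rightarrow>
    (nat \<Rightarrow> nat list \<Rightarrow> nat list \<Rightarrow> int) \<Rightarrow> bool" where
  "refuted q k R same lv \<longleftrightarrow> (\<exists>zs.
     (\<forall>t<R. zs t \<in> qstrings q k \<and> (zs t = view k same zs t t \<or> lv t (view k same zs t t) (zs t) \<noteq> 0)) \<and>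
     int (q ^ k) \<le> (\<Sum>z\<in>qstrings q k. lv R (view k same zs R R) z))"

locale valid_hamiltonian =
  fixes q k d K :: nat and p :: "nat poly" and I :: hamiltonian_instance
  assumes q: "1 \<le> q" and K: "1 \<le> K" and valid: "valid_instance q k d p I"
begin

abbreviation n :: nat where "n \<equiv> num_qudits I"
abbreviation m :: nat where "m \<equiv> length (ham_terms I)"
abbreviation X :: "nat list set" where "X \<equiv> qstrings q n"
abbreviation Z :: "nat list set" where "Z \<equiv> qstrings q k"
abbreviation tm :: "nat \<Rightarrow> local_term" where "tm i \<equiv> ham_terms I ! i"

abbreviation E :: "nat \<Rightarrow> qoperator" where "E i \<equiv> embedded_operator n (tm i)"

definition lev :: "nat \<Rightarrow> nat list \<Rightarrow> nat list \<Rightarrow> int" where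
  "lev i x y = level K (rat_embed n (tm i) x y)"

definition edge :: "nat \<Rightarrow> nat list \<Rightarrow> nat list \<Rightarrow> bool" where
  "edge i x y \<longleftrightarrow> x \<in> X \<and> y \<in> X \<and> x \<noteq> y \<and> lev i x y \<noteq> 0"

text \<open>By \<open>level_row\<close> a bad string has a positive exact row sum, which rules out a
  nonzero amplitude there in a state of zero energy.\<close>

definition bad :: "nat \<Rightarrow> nat list \<Rightarrow> bool" where
  "bad i x \<longleftrightarrow> int (q ^ k) \<le> (\<Sum>y\<in>X. lev i x y)"

abbreviation supp :: "nat \<Rightarrow> nat set" where
  "supp i \<equiv> valid_local_term.support q n (tm i)"

lemma m: "1 \<le> m"
  using valid by (simp add: valid_instance_def)

lemma local: "i < m \<Longrightarrow> valid_local_term q k n (tm i)"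
  using valid q by (simp add: valid_instance_def valid_local_term_def)

sublocale move_system m n q k d "q ^ k" supp edge bad
proof
  show "1 \<le> q" "1 \<le> m" by (rule q, rule m)
next
  fix i assume "i < m"
  then interpret h: valid_local_term q k n "tm i" by (rule local)
  show "supp i \<subseteq> {..<n}" "card (supp i) \<le> k" by (rule h.support)+
  show "x \<in> X \<and> y \<in> X" if "edge i x y" for x y using that by (simp add: edge_def)
  show "agree ({..<n} - supp i) x y" if "edge i x y" for x y
    using that h.agree_off_support level_nonzero unfolding edge_def lev_def by blast
  show "card {x. edge i x y} \<le> q ^ k" for y
  proof (cases "y \<in> X")
    case True
    have "card {x. edge i x y} \<le> card {x \<in> X. level K (rat_embed n (tm i) x y) \<noteq> 0}"
      by (rule card_mono) (auto simp: edge_def lev_def)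
    then show ?thesis using h.card_level_edge[OF True, of K] by linarith
  qed (simp add: edge_def)
  show "\<exists>y'. edge i x' y' \<and> agree (supp i) y y'"
    if "edge i x y" "x' \<in> X" "agree (supp i) x x'" for x y x'
    using h.level_edge_local[of x y x' K] that unfolding edge_def lev_def by blast
  show "bad i x'" if "bad i x" "x \<in> X" "x' \<in> X" "agree (supp i) x x'" for x x'
    using h.level_row_local[OF that(2-4), of K] that(1) by (simp add: bad_def lev_def)
next
  fix b assume b: "b < n"
  have "{i. i < m \<and> b \<in> supp i} =
      {i. i < m \<and> \<not> acts_trivially_on q n (E i) b}"
    using b valid_local_term.support_def[OF local] by auto
  then show "card {i. i < m \<and> b \<in> supp i} \<le> d"
    using valid b by (simp add: valid_instance_def bounded_degree_def)
qed

abbreviation origin :: "nat list" where "origin \<equiv> replicate n 0"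

lemma origin: "origin \<in> X"
  using q by (auto simp: qstrings_def)

lemma yes_state:
  assumes "pinned_yes q I"
  obtains \<psi> :: qvector where "\<psi> origin \<noteq> 0" "\<And>i x. i < m \<Longrightarrow> x \<in> X \<Longrightarrow> \<psi> x \<noteq> 0 \<Longrightarrow> \<not> bad i x"
    "\<And>i x y. i < m \<Longrightarrow> \<psi> x \<noteq> 0 \<Longrightarrow> edge i x y \<Longrightarrow> \<psi> y = \<psi> x"
proof -
  obtain \<psi> r where r: "r > 0" "braket q n \<psi> (ket origin) = complex_of_real r"
    and zero: "expectation q n (hamiltonian I) \<psi> = 0"
    using assms unfolding pinned_yes_def by blast
  have "braket q n \<psi> (ket origin) = (\<Sum>x\<in>X. if x = origin then cnj (\<psi> x) else 0)"
    unfolding braket_def ket_def by (intro sum.cong) auto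
  also have "\<dots> = cnj (\<psi> origin)" using origin by (simp add: sum.delta)
  finally have nz: "\<psi> origin \<noteq> 0" using r by auto
  have zero_term: "Re (expectation q n (E i) \<psi>) = 0" if "i < m" for i
  proof -
    have "(\<Sum>i<m. expectation q n (E i) \<psi>) = 0"
      using zero m unfolding expectation_hamiltonian by auto
    then have "(\<Sum>i<m. Re (expectation q n (E i) \<psi>)) = 0"
      by (metis Re_sum zero_complex.sel(1))
    then have "\<forall>i\<in>{..<m}. Re (expectation q n (E i) \<psi>) = 0"
      using valid_local_term.embedded_nonneg[OF local] by (subst sum_nonneg_eq_0_iff[symmetric]) auto
    then show ?thesis using that by blast
  qed
  have good: "\<not> bad i x" if "i < m" "x \<in> X" "\<psi> x \<noteq> 0" for i x
  proof -
    interpret h: valid_local_term q k n "tm i" using that(1) by (rule local)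
    show ?thesis
      using h.level_row_zero[OF that(2) h.embedded_kernel(1)[OF zero_term[OF that(1)] that(2,3)], of K]
      by (simp add: bad_def lev_def h.card_Z)
  qed
  have const: "\<psi> y = \<psi> x" if "i < m" "\<psi> x \<noteq> 0" "edge i x y" for i x y
  proof -
    interpret h: valid_local_term q k n "tm i" using that(1) by (rule local)
    show ?thesis
      using h.embedded_kernel(2)[OF zero_term[OF that(1)] _ that(2)] that(3) level_nonzero
      unfolding edge_def lev_def by blast
  qed
  show ?thesis by (rule that[of \<psi>]) (use nz good const in blast)+
qed

text \<open>Up to the factor \<open>card S\<close>, the energy of the uniform superposition is the
  sum of all entries within \<open>S\<close>. By \<open>inner_row_bound\<close> each string
  contributes at most \<epsilon>/2 to a term, thanks to the lower bound on \<open>K\<close>, and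
  \<open>q ^ k\<close> more if it lies on the boundary. So on average at least \<epsilon>/2 per
  string and term is left to boundary strings, at \<open>q ^ k\<close> each.\<close>

lemma no_boundary:
  assumes no: "pinned_no q \<epsilon> I" and \<epsilon>: "\<epsilon> > 0" and K': "6 * q ^ k / \<epsilon> \<le> K"
    and S: "S \<noteq> {}" "S \<subseteq> X" "\<And>i x. i < m \<Longrightarrow> x \<in> S \<Longrightarrow> \<not> bad i x"
  shows "\<epsilon> / (2 * q ^ k) * m * card S \<le> (\<Sum>i<m. real (card (boundary i S)))"
proof -
  have fin: "finite S" by (rule finite_subset[OF S(2)]) simp
  then have card: "0 < card S" using S(1) by (simp add: card_gt_0_iff)
  define c where "c = 1 / sqrt (card S)"
  have c2: "c * c = 1 / card S" by (simp add: c_def)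
  define \<psi> where "\<psi> x = complex_of_real (if x \<in> S then c else 0)" for x
  have restrict: "(\<Sum>x\<in>X. if x \<in> S then g x else 0) = (\<Sum>x\<in>S. g x)" for g :: "nat list \<Rightarrow> real"
    using S(2) by (simp add: sum.inter_restrict[symmetric] Int_absorb1)
  have "braket q n \<psi> \<psi> = complex_of_real (\<Sum>x\<in>X. if x \<in> S then c * c else 0)"
    unfolding braket_def \<psi>_def of_real_sum by (intro sum.cong) auto
  also have "\<dots> = 1" unfolding restrict using card by (simp add: c2)
  finally have "\<psi> \<in> qstates q n" using S(2) by (auto simp: qstates_def qspace_def \<psi>_def)
  then have "\<epsilon> \<le> Re (expectation q n (hamiltonian I) \<psi>)" using no by (simp add: pinned_no_def)
  also have "\<dots> = (\<Sum>i<m. Re (expectation q n (E i) \<psi>)) / m"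
    unfolding expectation_hamiltonian by (simp add: Re_divide_of_nat)
  finally have energy: "\<epsilon> * m \<le> (\<Sum>i<m. Re (expectation q n (E i) \<psi>))"
    by (rule pos_le_divide_eq[THEN iffD1, rotated]) (use m in auto)
  have term_energy: "card S * Re (expectation q n (E i) \<psi>) =
      (\<Sum>x\<in>S. \<Sum>y\<in>S. of_rat (rat_embed n (tm i) x y))" for i
  proof -
    let ?e = "\<lambda>x y. of_rat (rat_embed n (tm i) x y) :: real"
    have "expectation q n (E i) \<psi> =
        complex_of_real (\<Sum>x\<in>X. if x \<in> S then \<Sum>y\<in>X. if y \<in> S then c * c * ?e x y else 0 else 0)"
      unfolding expectation_def braket_def qapply_def embedded_operator_rat \<psi>_def of_real_sum
      by (intro sum.cong refl) (auto simp: sum_distrib_left of_real_of_rat mult_ac intro!: sum.cong)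
    then have "Re (expectation q n (E i) \<psi>) = c * c * (\<Sum>x\<in>S. \<Sum>y\<in>S. ?e x y)"
      unfolding restrict by (simp add: sum_distrib_left)
    then show ?thesis using card by (simp add: c2)
  qed
  have term_bound: "(\<Sum>x\<in>S. \<Sum>y\<in>S. of_rat (rat_embed n (tm i) x y) :: real) \<le>
      card S * (\<epsilon> / 2) + q ^ k * card (boundary i S)" if i: "i < m" for i
  proof -
    interpret h: valid_local_term q k n "tm i" using i by (rule local)
    have "(\<Sum>y\<in>S. h.e x y) \<le> \<epsilon> / 2 + (if x \<in> boundary i S then q ^ k else 0)" if x: "x \<in> S" for x
    proof -
      have "(\<Sum>y\<in>X. level K (rat_embed n (tm i) x y)) < card Z"
        using S(3)[OF i x] by (simp add: bad_def lev_def h.card_Z)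
      from h.inner_row_bound[OF S(2) x K this]
      have "(\<Sum>y\<in>S. h.e x y) \<le> 3 * q ^ k / K +
          (if \<exists>y. y \<in> X \<and> y \<notin> S \<and> level K (rat_embed n (tm i) x y) \<noteq> 0 then q ^ k else 0)"
        unfolding h.card_Z(1) by (simp add: if_distrib[of real])
      moreover have "(\<exists>y. y \<in> X \<and> y \<notin> S \<and> level K (rat_embed n (tm i) x y) \<noteq> 0) \<longleftrightarrow> x \<in> boundary i S"
        using x S(2) by (auto simp: boundary_def edge_def lev_def)
      moreover have "3 * q ^ k / K \<le> \<epsilon> / 2"
        using K' K \<epsilon> by (simp add: field_simps)
      ultimately show ?thesis by auto
    qed
    then have "(\<Sum>x\<in>S. \<Sum>y\<in>S. h.e x y) \<le> (\<Sum>x\<in>S. \<epsilon> / 2 + (if x \<in> boundary i S then q ^ k else 0))"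
      by (rule sum_mono)
    also have "\<dots> = card S * (\<epsilon> / 2) + (\<Sum>x\<in>S. if x \<in> boundary i S then real (q ^ k) else 0)"
      by (simp add: sum.distrib if_distrib[of real] cong: if_cong)
    also have "(\<Sum>x\<in>S. if x \<in> boundary i S then real (q ^ k) else 0) = (\<Sum>x\<in>S \<inter> boundary i S. real (q ^ k))"
      by (rule sum.inter_restrict[OF fin, symmetric])
    also have "S \<inter> boundary i S = boundary i S" by (auto simp: boundary_def)
    finally show ?thesis by (simp add: mult.commute)
  qed
  have "\<epsilon> * m * card S \<le> (\<Sum>i<m. card S * Re (expectation q n (E i) \<psi>))"
    using mult_right_mono[OF energy, of "card S"] by (simp add: sum_distrib_left mult_ac)
  also have "\<dots> \<le> (\<Sum>i<m. card S * (\<epsilon> / 2) + q ^ k * card (boundary i S))"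
    unfolding term_energy by (intro sum_mono term_bound) simp
  also have "\<dots> = m * card S * (\<epsilon> / 2) + q ^ k * (\<Sum>i<m. real (card (boundary i S)))"
    by (simp add: sum.distrib sum_distrib_left)
  finally have "m * card S * (\<epsilon> / 2) \<le> q ^ k * (\<Sum>i<m. real (card (boundary i S)))" by (simp add: algebra_simps)
  then show ?thesis using q by (simp add: field_simps)
qed

section \<open>Walks and refutations\<close>

lemma reach_path:
  assumes "reach r x y"
  shows "\<exists>\<tau> xs. xs 0 = x \<and> xs r = y \<and> (\<forall>t<r. \<tau> t < m \<and> (xs (Suc t) = xs t \<or> edge (\<tau> t) (xs t) (xs (Suc t))))"
  using assms
proof (induction r arbitrary: y)
  case 0
  then show ?case by auto
next
  case (Suc r)
  then obtain z where z: "reach r x z" "y = z \<or> (\<exists>i<m. edge i z y)" by auto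
  then obtain i where i: "i < m" "y = z \<or> edge i z y" using m by (metis Suc_le_eq One_nat_def)
  obtain \<tau> xs where t: "xs 0 = x" "xs r = z"
    "\<forall>t<r. \<tau> t < m \<and> (xs (Suc t) = xs t \<or> edge (\<tau> t) (xs t) (xs (Suc t)))"
    using Suc.IH[OF z(1)] by blast
  have "(xs(Suc r := y)) 0 = x \<and> (xs(Suc r := y)) (Suc r) = y \<and>
    (\<forall>t<Suc r. (\<tau>(r := i)) t < m \<and> ((xs(Suc r := y)) (Suc t) = (xs(Suc r := y)) t \<or>
      edge ((\<tau>(r := i)) t) ((xs(Suc r := y)) t) ((xs(Suc r := y)) (Suc t))))"
    using t i by (auto simp: less_Suc_eq)
  then show ?case by blast
qed

fun walk :: "(nat \<Rightarrow> nat) \<Rightarrow> (nat \<Rightarrow> nat list) \<Rightarrow> nat \<Rightarrow> nat list" where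
  "walk \<tau> zs 0 = origin"
| "walk \<tau> zs (Suc t) = put (term_qudits (tm (\<tau> t))) (zs t) (walk \<tau> zs t)"

context
  fixes R :: nat and \<tau> :: "nat \<Rightarrow> nat"
  assumes \<tau>: "\<And>t. t \<le> R \<Longrightarrow> \<tau> t < m"
begin

interpretation enc: encoding q k K "Suc R"
  by standard (rule q)

abbreviation run where "run \<equiv> walk \<tau>"

abbreviation same where "same \<equiv> enc.same_qudit (\<lambda>t. tm (\<tau> t))"
abbreviation lv where "lv \<equiv> enc.rounded_matrix (\<lambda>t. tm (\<tau> t))"

text \<open>Induction on the number of moves: a qudit of slot \<open>b\<close> is either among those
  just overwritten by slot \<open>t\<close>, which \<open>same\<close> detects, or keeps its
  letter.\<close>

lemma view_run:
  assumes zs: "\<And>t. t < R \<Longrightarrow> zs t \<in> Z" and "t \<le> R"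
  shows "run zs t \<in> X \<and> (\<forall>b\<le>R. view k same zs t b = restrict_string (run zs t) (term_qudits (tm (\<tau> b))))"
  using assms(2)
proof (induction t)
  case 0
  have "view k same zs 0 b = restrict_string origin (term_qudits (tm (\<tau> b)))" if "b \<le> R" for b
  proof -
    interpret h: valid_local_term q k n "tm (\<tau> b)" using \<tau>[OF that] by (rule local)
    show ?thesis using h.bs h.bs_nth by (intro nth_equalityI) (auto simp: view_def restrict_string_def)
  qed
  then show ?case using origin by simp
next
  case (Suc t)
  interpret T: valid_local_term q k n "tm (\<tau> t)" by (rule local, rule \<tau>) (use Suc.prems in simp)
  have IH: "run zs t \<in> X" "\<And>b. b \<le> R \<Longrightarrow> view k same zs t b = restrict_string (run zs t) (term_qudits (tm (\<tau> b)))"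
    using Suc by auto
  have z: "zs t \<in> Z" using zs Suc.prems by simp
  have "view k same zs (Suc t) b = restrict_string (run zs (Suc t)) (term_qudits (tm (\<tau> b)))" if b: "b \<le> R" for b
  proof -
    interpret B: valid_local_term q k n "tm (\<tau> b)" by (rule local, rule \<tau>[OF b])
    have "virtual_letter same zs (Suc t) b j = run zs (Suc t) ! (B.bs ! j)" if j: "j < k" for j
    proof (cases "\<exists>j'. same t j' b j")
      case True
      define j' where "j' = (SOME j'. same t j' b j)"
      have "same t j' b j" unfolding j'_def by (rule someI_ex[OF True])
      then have j': "j' < k" "T.bs ! j' = B.bs ! j" by (auto simp: enc.same_qudit_def)
      have "run zs (Suc t) ! (T.bs ! j') = zs t ! j'"
        using IH(1) z j'(1) T.bs T.bs_nth[OF j'(1)] by (auto simp: qstrings_def intro!: put_nth_in)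
      then show ?thesis using True j' by (simp add: j'_def)
    next
      case False
      then have "B.bs ! j \<notin> set T.bs"
        using j b Suc.prems T.bs(1) by (auto simp: enc.same_qudit_def in_set_conv_nth)
      then have "run zs (Suc t) ! (B.bs ! j) = run zs t ! (B.bs ! j)"
        using T.put_nth_off[OF IH(1) B.bs_nth[OF j]] by simp
      moreover have "virtual_letter same zs t b j = run zs t ! (B.bs ! j)"
        using arg_cong[OF IH(2)[OF b], of "\<lambda>v. v ! j"] j B.bs(1) by (simp add: view_def restrict_string_def)
      ultimately show ?thesis using False by simp
    qed
    then show ?thesis using B.bs(1) by (intro nth_equalityI) (auto simp: view_def restrict_string_def)
  qed
  then show ?case using T.put_in[OF IH(1) z] by simp
qed

text \<open>A move is given by the letters \<open>zs t\<close> that it writes on the qudits of its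
  slot. A nonzero diagonal level does no harm: the string then stays as it is, which is allowed as
  an idle move.\<close>

lemma refuted_iff:
  "refuted q k R same lv \<longleftrightarrow> (\<exists>zs.
    (\<forall>t<R. zs t \<in> Z \<and> (run zs (Suc t) = run zs t \<or> edge (\<tau> t) (run zs t) (run zs (Suc t)))) \<and>
    bad (\<tau> R) (run zs R))"
proof -
  have move: "zs t = view k same zs t t \<or> lv t (view k same zs t t) (zs t) \<noteq> 0 \<longleftrightarrow>
      run zs (Suc t) = run zs t \<or> edge (\<tau> t) (run zs t) (run zs (Suc t))"
    if all: "\<forall>t<R. zs t \<in> Z" and t: "t < R" for zs t
  proof -
    have zs: "\<And>t. t < R \<Longrightarrow> zs t \<in> Z" using all by blast
    interpret T: valid_local_term q k n "tm (\<tau> t)" by (rule local, rule \<tau>) (use t in simp)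
    have x: "run zs t \<in> X" and v: "view k same zs t t = restrict_string (run zs t) T.bs"
      using view_run[OF zs, where t = t] t by auto
    have z: "zs t \<in> Z" using zs t by simp
    have "zs t = restrict_string (run zs t) T.bs \<longleftrightarrow> run zs (Suc t) = run zs t"
      using T.put_restrict[OF x] T.restrict_put[OF x z] by auto
    moreover have "lv t (view k same zs t t) (zs t) = lev (\<tau> t) (run zs t) (run zs (Suc t))"
      using T.rat_embed_put[OF x z] T.restrict_in[OF x] z t by (simp add: enc.rounded_matrix_def lev_def v)
    moreover have "run zs (Suc t) \<in> X" using T.put_in[OF x z] by simp
    ultimately show ?thesis using x v by (auto simp: edge_def)
  qed
  have final: "(\<Sum>z\<in>Z. lv R (view k same zs R R) z) = (\<Sum>y\<in>X. lev (\<tau> R) (run zs R) y)"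
    if all: "\<forall>t<R. zs t \<in> Z" for zs
  proof -
    have zs: "\<And>t. t < R \<Longrightarrow> zs t \<in> Z" using all by blast
    interpret T: valid_local_term q k n "tm (\<tau> R)" by (rule local, rule \<tau>) simp
    have x: "run zs R \<in> X" and v: "view k same zs R R = restrict_string (run zs R) T.bs"
      using view_run[OF zs, where t = R] by auto
    have "(\<Sum>y\<in>X. lev (\<tau> R) (run zs R) y) = (\<Sum>z\<in>Z. lev (\<tau> R) (run zs R) (put T.bs z (run zs R)))"
      by (rule T.sum_rat_embed[OF x]) (simp add: lev_def)
    also have "\<dots> = (\<Sum>z\<in>Z. lv R (view k same zs R R) z)"
      using T.rat_embed_put[OF x] T.restrict_in[OF x]
      by (intro sum.cong refl) (simp add: enc.rounded_matrix_def lev_def v)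
    finally show ?thesis by simp
  qed
  have "(\<forall>t<R. zs t \<in> Z \<and> (zs t = view k same zs t t \<or> lv t (view k same zs t t) (zs t) \<noteq> 0)) \<and>
        int (q ^ k) \<le> (\<Sum>z\<in>Z. lv R (view k same zs R R) z) \<longleftrightarrow>
      (\<forall>t<R. zs t \<in> Z \<and> (run zs (Suc t) = run zs t \<or> edge (\<tau> t) (run zs t) (run zs (Suc t)))) \<and>
        bad (\<tau> R) (run zs R)" for zs
  proof (cases "\<forall>t<R. zs t \<in> Z")
    case True
    show ?thesis unfolding bad_def final[OF True] using move[OF True] by blast
  qed blast
  then show ?thesis unfolding refuted_def by (simp only:)
qed

lemma yes_not_refuted:
  assumes "pinned_yes q I"
  shows "\<not> refuted q k R same lv"
proof
  assume "refuted q k R same lv"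
  then obtain zs where zs: "\<And>t. t < R \<Longrightarrow> zs t \<in> Z"
    "\<And>t. t < R \<Longrightarrow> run zs (Suc t) = run zs t \<or> edge (\<tau> t) (run zs t) (run zs (Suc t))"
    "bad (\<tau> R) (run zs R)"
    unfolding refuted_iff by blast
  obtain \<psi> :: qvector where \<psi>: "\<psi> origin \<noteq> 0" "\<And>i x. i < m \<Longrightarrow> x \<in> X \<Longrightarrow> \<psi> x \<noteq> 0 \<Longrightarrow> \<not> bad i x"
    "\<And>i x y. i < m \<Longrightarrow> \<psi> x \<noteq> 0 \<Longrightarrow> edge i x y \<Longrightarrow> \<psi> y = \<psi> x"
    by (rule yes_state[OF assms]) blast
  have nz: "\<psi> (run zs t) \<noteq> 0" if "t \<le> R" for t
    using that
  proof (induction t)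
    case (Suc t)
    then have "\<psi> (run zs t) \<noteq> 0" "\<tau> t < m" using \<tau> by auto
    then show ?case using zs(2)[of t] \<psi>(3)[of "\<tau> t" "run zs t" "run zs (Suc t)"] Suc.prems by (auto simp del: walk.simps)
  qed (simp add: \<psi>(1))
  have "run zs R \<in> X" using view_run[where zs = zs and t = R] zs(1) by simp
  then show False using \<psi>(2)[OF \<tau>[OF order_refl] _ nz[OF order_refl]] zs(3) by blast
qed

end

lemma reach_refuted:
  assumes "reach R origin y" "i < m" "bad i y"
  shows "\<exists>\<tau>. (\<forall>t\<le>R. \<tau> t < m) \<and> refuted q k R
    (encoding.same_qudit k (Suc R) (\<lambda>t. tm (\<tau> t))) (encoding.rounded_matrix q k K (Suc R) (\<lambda>t. tm (\<tau> t)))"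
proof -
  obtain \<tau>' xs where path: "xs 0 = origin" "xs R = y"
    "\<And>t. t < R \<Longrightarrow> \<tau>' t < m \<and> (xs (Suc t) = xs t \<or> edge (\<tau>' t) (xs t) (xs (Suc t)))"
    using reach_path[OF assms(1)] by blast
  \<comment> \<open>Slot \<open>R\<close> makes no move; it holds the term for which the final
    string is bad.\<close>
  define \<tau> where "\<tau> t = (if t < R then \<tau>' t else i)" for t
  have \<tau>: "\<tau> t < m" for t using path(3) assms(2) by (simp add: \<tau>_def)
  define zs where "zs t = restrict_string (xs (Suc t)) (term_qudits (tm (\<tau> t)))" for t
  have xs: "xs t \<in> X" if "t \<le> R" for t
    using that
  proof (induction t)
    case (Suc t)
    then show ?case using path(3)[of t] by (auto simp: edge_def)
  qed (simp add: path(1) origin)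
  have run: "walk \<tau> zs t = xs t" if "t \<le> R" for t
    using that
  proof (induction t)
    case (Suc t)
    then have t: "t < R" by simp
    interpret T: valid_local_term q k n "tm (\<tau> t)" by (rule local, rule \<tau>)
    have "put T.bs (zs t) (xs t) = xs (Suc t)"
    proof (cases "xs (Suc t) = xs t")
      case True
      then show ?thesis using T.put_restrict[OF xs[of t]] t by (simp add: zs_def)
    next
      case False
      then have "rat_embed n (tm (\<tau> t)) (xs t) (xs (Suc t)) \<noteq> 0"
        using path(3)[OF t] t level_nonzero by (auto simp: edge_def lev_def \<tau>_def)
      then show ?thesis unfolding zs_def by (rule T.rat_embed_nonzero_put[OF xs xs, rotated 2]) (use t in auto)
    qed
    then show ?case using Suc by simp
  qed (simp add: path(1))
  have "zs t \<in> Z \<and> (walk \<tau> zs (Suc t) = walk \<tau> zs t \<or> edge (\<tau> t) (walk \<tau> zs t) (walk \<tau> zs (Suc t)))" if t: "t < R" for t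
  proof -
    interpret T: valid_local_term q k n "tm (\<tau> t)" by (rule local, rule \<tau>)
    have "zs t \<in> Z" unfolding zs_def by (rule T.restrict_in[OF xs]) (use t in simp)
    moreover have "walk \<tau> zs t = xs t" "walk \<tau> zs (Suc t) = xs (Suc t)" by (rule run, use t in simp)+
    ultimately show ?thesis using path(3)[OF t] t by (simp add: \<tau>_def del: walk.simps)
  qed
  moreover have "bad (\<tau> R) (walk \<tau> zs R)" using assms(3) run[of R] path(2) by (simp add: \<tau>_def)
  ultimately have "refuted q k R (encoding.same_qudit k (Suc R) (\<lambda>t. tm (\<tau> t)))
      (encoding.rounded_matrix q k K (Suc R) (\<lambda>t. tm (\<tau> t)))"
    using refuted_iff[of R \<tau>, OF \<tau>] by blast
  then show ?thesis using \<tau> by blast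
qed

end

theorem theoremA4:
  fixes q k d :: nat and p :: "nat poly" and \<epsilon> :: real
  assumes "q \<ge> 1" and "\<epsilon> > 0"
  shows "pinned_hamiltonian_problem q k d p \<epsilon> \<in> promise_P"
proof -
  \<comment> \<open>This precision gives \<open>3 * q ^ k / K \<le> \<epsilon> / 2\<close>.\<close>
  define K where "K = Suc (nat \<lceil>6 * q ^ k / \<epsilon>\<rceil>)"
  have prec: "1 \<le> K" "6 * q ^ k / \<epsilon> \<le> K" unfolding K_def by linarith+
  \<comment> \<open>The remaining \<epsilon>/2, divided by the largest amount \<open>q ^ k\<close>
    that a boundary string can contribute.\<close>
  define \<eta> where "\<eta> = \<epsilon> / (2 * q ^ k)"
  have \<eta>: "0 < \<eta>" using assms by (simp add: \<eta>_def)
  have D: "1 \<le> q ^ k" using assms(1) by simp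
  \<comment> \<open>Positive and independent of the instance, so one \<open>T\<close>, and with it
    one \<open>R\<close>, serves all inputs.\<close>
  have "0 < \<eta> / (2 * (k * d + 1)) * ln (1 + \<eta> / (2 * real (q ^ k)))"
    using \<eta> assms(1) by (intro mult_pos_pos divide_pos_pos ln_gt_zero) (auto simp: add_pos_nonneg)
  then obtain T :: nat where T: "k * ln q < T * (\<eta> / (2 * (k * d + 1)) * ln (1 + \<eta> / (2 * real (q ^ k))))"
    using reals_Archimedean3 by blast
  define R where "R = k * cone k T"
  \<comment> \<open>One slot for each of the \<open>R\<close> moves and one for the term that finds
    the end of the walk bad.\<close>
  interpret enc: encoding q k K "Suc R" by standard (rule assms(1))
  let ?valid = "valid_instance q k d p"
  show ?thesis unfolding pinned_hamiltonian_problem_def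
  proof (rule enc.local_checks[where G = "refuted q k R"])
    fix I h assume "I \<in> {I. ?valid I \<and> pinned_yes q I} \<union> {I. ?valid I \<and> pinned_no q \<epsilon> I}" "h \<in> set (ham_terms I)"
    then show "length (term_qudits h) = k" by (auto simp: valid_instance_def valid_term_def)
  next
    fix I hs assume I: "I \<in> {I. ?valid I \<and> pinned_yes q I}"
      and hs: "\<And>t. t < Suc R \<Longrightarrow> hs t \<in> set (ham_terms I)"
    interpret valid_hamiltonian q k d K p I by standard (use assms prec I in auto)
    have "\<forall>t. \<exists>i. t \<le> R \<longrightarrow> i < m \<and> tm i = hs t" using hs by (metis in_set_conv_nth less_Suc_eq_le)
    then obtain \<tau> where \<tau>: "\<And>t. t \<le> R \<Longrightarrow> \<tau> t < m" "\<And>t. t \<le> R \<Longrightarrow> tm (\<tau> t) = hs t" by metis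
    have "enc.same_qudit (\<lambda>t. tm (\<tau> t)) = enc.same_qudit hs"
      "enc.rounded_matrix (\<lambda>t. tm (\<tau> t)) = enc.rounded_matrix hs"
      using \<tau>(2) by (auto simp: fun_eq_iff enc.same_qudit_def enc.rounded_matrix_def)
    then show "\<not> refuted q k R (enc.same_qudit hs) (enc.rounded_matrix hs)"
      using yes_not_refuted[of R \<tau>, OF \<tau>(1)] I by simp
  next
    fix I assume I: "I \<in> {I. ?valid I \<and> pinned_no q \<epsilon> I}"
    interpret valid_hamiltonian q k d K p I by standard (use assms prec I in auto)
    have "\<exists>i y. i < m \<and> reach (k * cone k T) origin y \<and> bad i y"
    proof (rule bad_reachable[OF \<eta> origin _ _ D])
      show "\<eta> * m * card S \<le> (\<Sum>i<m. real (card (boundary i S)))"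
        if "S \<noteq> {}" "S \<subseteq> strings" "\<And>i x. i < m \<Longrightarrow> x \<in> S \<Longrightarrow> \<not> bad i x" for S
        unfolding \<eta>_def by (rule no_boundary[OF _ assms(2) prec(2) that]) (use I in auto)
    qed (use T in \<open>simp add: mult.assoc\<close>)
    then obtain i y where "reach R origin y" "i < m" "bad i y" unfolding R_def by blast
    from reach_refuted[OF this] obtain \<tau> where "\<forall>t\<le>R. \<tau> t < m"
      "refuted q k R (enc.same_qudit (\<lambda>t. tm (\<tau> t))) (enc.rounded_matrix (\<lambda>t. tm (\<tau> t)))" by blast
    then show "\<exists>hs. (\<forall>t<Suc R. hs t \<in> set (ham_terms I)) \<and>
        refuted q k R (enc.same_qudit hs) (enc.rounded_matrix hs)"
      by (intro exI[of _ "\<lambda>t. tm (\<tau> t)"]) auto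
  qed
qed

end
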